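(* Let $n\ge 1$ and $m\ge 0$ be integers and let $f(z,\overline z)=\sum_{|\alpha|=m}\sum_{|\beta|=m}c_{\alpha\beta}z^\alpha\overline z^\beta$ be a real-valued polynomial on $\mathbf{C}^n$ that is homogeneous of degree $m$ in $z$ and also homogeneous of degree $m$ in $\overline z$. Let $P$ and $N$ be holomorphic homogeneous vector-valued polynomials of degree $m$ on $\mathbf{C}^n$ (with values in finite-dimensional complex Euclidean spaces) such that $f(z,\overline z)=\|P(z)\|^2-\|N(z)\|^2$. The following are equivalent. 1) $f$ achieves a positive minimum value on the unit sphere $\{\|z\|=1\}$. 2) There is an integer $d\ge 0$ such that the underlying Hermitian matrix of coefficients for $\|z\|^{2d}f(z,\overline z)$ is positive definite; that is, $\|z\|^{2d}f(z,\overline z)=\sum_{|\mu|=|\nu|=m+d}E_{\mu\nu}z^\mu\overline z^\nu$ where $(E_{\mu\nu})$ is positive definite. 3) There is an integer $d\ge 0$ such that the integral operator $R_{m+d}$ on $A^2(B_n)$ with kernel $k_d(z,\zeta)=\langle z,\zeta\rangle^d f(z,\overline\zeta)$, i.e. $R_{m+d}g(z)=\int_{B_n}k_d(z,\zeta)g(\zeta)\,dV(\zeta)$, is a positive operator from $V_{m+d}\subset A^2(B_n)$ to itself. 4) There is an integer $d\ge 0$ and a holomorphic homogeneous vector-valued polynomial $g$ of degree $m+d$ such that $\mathbf{V}(g)=\{0\}$ and $\|z\|^{2d}f(z,\overline z)=\|g(z)\|^2$. 5) There is an integer $d\ge 0$ and a linear transformation $L$ such that: (5.1) $I-L^*L$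 is positive semi-definite; (5.2) $H_d\otimes N=L(H_d\otimes P)$; (5.3) $\mathbf{V}\bigl(\sqrt{I-L^*L}\,(H_d\otimes P)\bigr)=\{0\}$.
   Context: Multi-index notation is used: $z^\alpha=\prod z_j^{\alpha_j}$, $|\alpha|=\sum\alpha_j$, $\alpha!=\prod\alpha_j!$. $\|\cdot\|$ is the complex Euclidean norm and $\langle z,\zeta\rangle=\sum_j z_j\overline{\zeta_j}$. The matrix $(c_{\alpha\beta})$ is called the underlying matrix of coefficients of $f$; it is indexed by all multi-indices of length $m$, and it is Hermitian because $f$ is real-valued. $f(z,\overline\zeta)$ denotes $\sum c_{\alpha\beta}z^\alpha\overline\zeta^\beta$. $B_n$ is the unit ball in $\mathbf{C}^n$, $dV$ is Lebesgue measure, $A^2(B_n)$ is the Hilbert space of square integrable holomorphic functions on $B_n$ with the $L^2$ inner product, and $V_k$ is the space of holomorphic homogeneous polynomials of degree $k$ in $n$ variables, regarded as a subspace of $A^2(B_n)$. A linear operator $R$ on a subspace $V$ is called positive if there is a number $c>0$ such that $\langle Rg,g\rangle\ge c\langle g,g\rangle$ for all $g\in V$. For a vector-valued holomorphic mapping $g$ on $\mathbf{C}^n$, $\mathbf{V}(g)$ is the set of common zeroes of the components of $g$. For vector-valued functions $h,g$, the tensor product $h\otimes g$ is the mapping whose components are all products $h_jg_k$ of components of $h$ and $g$, in some determined order. $H_d$ is the mapping with components $\sqrt{d!/\alpha!}\,z^\alpha$, $|\alpha|=d$ (the $d$-fold tensor product of the identity mapping with itself, with like monomials collected), so that $\|H_d(z)\|^2=\|z\|^{2d}$.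 In 5), $L$ is a linear map from the target space of $H_d\otimes P$ to the target space of $H_d\otimes N$, $L^*$ is its adjoint, and $\sqrt{\cdot}$ is the positive semi-definite square root. *)

theory Defs
  imports "HOL-Analysis.Analysis"
begin

definition multi_indices :: "nat \<Rightarrow> ('n::finite \<Rightarrow> nat) set" where
  "multi_indices k = {\<alpha>. (\<Sum>j\<in>UNIV. \<alpha> j) = k}"

definition mpow :: "complex ^ 'n \<Rightarrow> ('n::finite \<Rightarrow> nat) \<Rightarrow> complex" where
  "mpow z \<alpha> = (\<Prod>j\<in>UNIV. (z $ j) ^ \<alpha> j)"

definition mfact :: "('n::finite \<Rightarrow> nat) \<Rightarrow> nat" where
  "mfact \<alpha> = (\<Prod>j\<in>UNIV. fact (\<alpha> j))"

definition herm_inner :: "complex ^ 'n::finite \<Rightarrow> complex ^ 'n \<Rightarrow> complex" where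
  "herm_inner z \<zeta> = (\<Sum>j\<in>UNIV. z $ j * cnj (\<zeta> $ j))"

text \<open>The polarization: holomorphic in \<open>z\<close>, antiholomorphic in \<open>\<zeta>\<close>; the polynomial itself is the case \<open>\<zeta> = z\<close>.\<close>

definition bihom_poly ::
  "nat \<Rightarrow> (('n::finite \<Rightarrow> nat) \<Rightarrow> ('n \<Rightarrow> nat) \<Rightarrow> complex) \<Rightarrow> complex ^ 'n \<Rightarrow> complex ^ 'n \<Rightarrow> complex" where
  "bihom_poly m c z \<zeta> =
     (\<Sum>\<alpha>\<in>multi_indices m. \<Sum>\<beta>\<in>multi_indices m. c \<alpha> \<beta> * mpow z \<alpha> * cnj (mpow \<zeta> \<beta>))"

definition hom_poly_space :: "nat \<Rightarrow> (complex ^ 'n::finite \<Rightarrow> complex) set" where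
  "hom_poly_space k = {h. \<exists>a. \<forall>z. h z = (\<Sum>\<alpha>\<in>multi_indices k. a \<alpha> * mpow z \<alpha>)}"

text \<open>
  Vectors and matrices over a finite index set are functions of the index. Only the entries whose
  indices lie in the set matter, so \<open>\<complex>\<^sup>p\<close> corresponds to the index set \<open>{..<p}\<close>, with \<open>p = 0\<close> allowed.
\<close>

definition norm_sq_on :: "'i set \<Rightarrow> ('i \<Rightarrow> complex) \<Rightarrow> real" where
  "norm_sq_on I u = (\<Sum>i\<in>I. (cmod (u i))\<^sup>2)"

definition mat_vec_on :: "'j set \<Rightarrow> ('i \<Rightarrow> 'j \<Rightarrow> complex) \<Rightarrow> ('j \<Rightarrow> complex) \<Rightarrow> 'i \<Rightarrow> complex" where
  "mat_vec_on J A u = (\<lambda>i. \<Sum>j\<in>J. A i j * u j)"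

definition mat_mul_on ::
  "'j set \<Rightarrow> ('i \<Rightarrow> 'j \<Rightarrow> complex) \<Rightarrow> ('j \<Rightarrow> 'k \<Rightarrow> complex) \<Rightarrow> 'i \<Rightarrow> 'k \<Rightarrow> complex" where
  "mat_mul_on J A B = (\<lambda>i k. \<Sum>j\<in>J. A i j * B j k)"

definition mat_adj :: "('i \<Rightarrow> 'j \<Rightarrow> complex) \<Rightarrow> 'j \<Rightarrow> 'i \<Rightarrow> complex" where
  "mat_adj A = (\<lambda>j i. cnj (A i j))"

definition mat_id :: "'i \<Rightarrow> 'i \<Rightarrow> complex" where
  "mat_id = (\<lambda>i j. if i = j then 1 else 0)"

definition hermitian_on :: "'i set \<Rightarrow> ('i \<Rightarrow> 'i \<Rightarrow> complex) \<Rightarrow> bool" where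
  "hermitian_on I A \<longleftrightarrow> (\<forall>i\<in>I. \<forall>j\<in>I. A j i = cnj (A i j))"

definition quad_form_on :: "'i set \<Rightarrow> ('i \<Rightarrow> 'i \<Rightarrow> complex) \<Rightarrow> ('i \<Rightarrow> complex) \<Rightarrow> complex" where
  "quad_form_on I A u = (\<Sum>i\<in>I. mat_vec_on I A u i * cnj (u i))"

definition pos_semidef_on :: "'i set \<Rightarrow> ('i \<Rightarrow> 'i \<Rightarrow> complex) \<Rightarrow> bool" where
  "pos_semidef_on I A \<longleftrightarrow> hermitian_on I A \<and> (\<forall>u. 0 \<le> Re (quad_form_on I A u))"

definition pos_def_on :: "'i set \<Rightarrow> ('i \<Rightarrow> 'i \<Rightarrow> complex) \<Rightarrow> bool" where
  "pos_def_on I A \<longleftrightarrow>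
     hermitian_on I A \<and> (\<forall>u. (\<exists>i\<in>I. u i \<noteq> 0) \<longrightarrow> 0 < Re (quad_form_on I A u))"

text \<open>
  The entries outside \<open>I \<times> I\<close> are fixed to be \<open>0\<close> so that the square root is unique as a function.
\<close>

definition psd_sqrt_on :: "'i set \<Rightarrow> ('i \<Rightarrow> 'i \<Rightarrow> complex) \<Rightarrow> 'i \<Rightarrow> 'i \<Rightarrow> complex" where
  "psd_sqrt_on I A =
     (THE S. pos_semidef_on I S
        \<and> (\<forall>i\<in>I. \<forall>j\<in>I. mat_mul_on I S S i j = A i j)
        \<and> (\<forall>i j. i \<notin> I \<or> j \<notin> I \<longrightarrow> S i j = 0))"

definition hom_poly_map :: "nat \<Rightarrow> 'i set \<Rightarrow> (complex ^ 'n::finite \<Rightarrow> 'i \<Rightarrow> complex) \<Rightarrow> bool" where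
  "hom_poly_map k I g \<longleftrightarrow> (\<forall>i\<in>I. (\<lambda>z. g z i) \<in> hom_poly_space k)"

definition common_zeros :: "'i set \<Rightarrow> (complex ^ 'n::finite \<Rightarrow> 'i \<Rightarrow> complex) \<Rightarrow> (complex ^ 'n) set" where
  "common_zeros I g = {z. \<forall>i\<in>I. g z i = 0}"

definition tensor :: "('i \<Rightarrow> complex) \<Rightarrow> ('j \<Rightarrow> complex) \<Rightarrow> 'i \<times> 'j \<Rightarrow> complex" where
  "tensor u v = (\<lambda>(i, j). u i * v j)"

text \<open>\<open>H\<^sub>d\<close>, whose components are indexed by \<open>multi_indices d\<close>.\<close>

definition H_map :: "nat \<Rightarrow> complex ^ 'n::finite \<Rightarrow> ('n \<Rightarrow> nat) \<Rightarrow> complex" where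
  "H_map d z \<alpha> = complex_of_real (sqrt (fact d / real (mfact \<alpha>))) * mpow z \<alpha>"

definition ball_inner ::
  "(complex ^ 'n::finite \<Rightarrow> complex) \<Rightarrow> (complex ^ 'n \<Rightarrow> complex) \<Rightarrow> complex" where
  "ball_inner g h = (LINT z : ball 0 1 | lborel. g z * cnj (h z))"

definition kernel_operator ::
  "(complex ^ 'n::finite \<Rightarrow> complex ^ 'n \<Rightarrow> complex) \<Rightarrow> (complex ^ 'n \<Rightarrow> complex) \<Rightarrow> complex ^ 'n \<Rightarrow> complex" where
  "kernel_operator k g z = (LINT \<zeta> : ball 0 1 | lborel. k z \<zeta> * g \<zeta>)"

text \<open>
  The inequality between the complex numbers \<open>\<langle>R g, g\<rangle>\<close> and \<open>c \<langle>g, g\<rangle>\<close> includes that the former is real.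
\<close>

definition positive_operator_on ::
  "(complex ^ 'n::finite \<Rightarrow> complex) set
    \<Rightarrow> ((complex ^ 'n \<Rightarrow> complex) \<Rightarrow> complex ^ 'n \<Rightarrow> complex) \<Rightarrow> bool" where
  "positive_operator_on V R \<longleftrightarrow>
     (\<forall>g\<in>V. R g \<in> V)
   \<and> (\<forall>g\<in>V. \<forall>h\<in>V. R (\<lambda>z. g z + h z) = (\<lambda>z. R g z + R h z))
   \<and> (\<forall>a. \<forall>g\<in>V. R (\<lambda>z. a * g z) = (\<lambda>z. a * R g z))
   \<and> (\<exists>c>0. \<forall>g\<in>V. ball_inner (R g) g \<in> \<real>
          \<and> c * Re (ball_inner g g) \<le> Re (ball_inner (R g) g))"

definition attains_positive_min_on :: "('a \<Rightarrow> real) \<Rightarrow> 'a set \<Rightarrow> bool" where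
  "attains_positive_min_on f S \<longleftrightarrow> (\<exists>z\<in>S. 0 < f z \<and> (\<forall>w\<in>S. f z \<le> f w))"

end

theory Submission
  imports Defs "HOL-Computational_Algebra.Polynomial" "HOL-Probability.Sinc_Integral"
begin

text \<open>
  Everything is reduced to the matrix of coefficients \<open>E\<close> of \<open>\<parallel>z\<parallel>\<^bsup>2d\<^esup> f\<close>. The main point is that \<open>E\<close> is positive
  definite for large \<open>d\<close> if \<open>f \<ge> \<epsilon> > 0\<close> on the sphere. After the substitution \<open>u\<^sub>\<mu> = \<surd>\<mu>! v\<^sub>\<mu>\<close> the quadratic form
  of \<open>E / d!\<close> is \<open>\<Sum> c\<^sub>\<alpha>\<^sub>\<beta> \<langle>\<partial>\<^sup>\<beta> h, \<partial>\<^sup>\<alpha> h\<rangle>\<close> in Fock space for the polynomial \<open>h = \<Sum> (v\<^sub>\<mu> / \<surd>\<mu>!) z\<^sup>\<mu>\<close> of degree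
  \<open>k = m + d\<close>. Replacing derivatives by multiplications turns it into
  \<open>\<Sum> c\<^sub>\<alpha>\<^sub>\<beta> \<langle>z\<^sup>\<alpha> h, z\<^sup>\<beta> h\<rangle>\<close>, the integral of \<open>f |h|\<^sup>2\<close> against the Gaussian, which is at least \<open>\<epsilon> k\<^sup>m \<parallel>v\<parallel>\<^sup>2\<close>,
  whereas the two forms differ by \<open>O(k\<^bsup>m - 1/2\<^esup>) \<parallel>v\<parallel>\<^sup>2\<close>.

  For 3), the operator has the quadratic form of \<open>E\<close> evaluated at the vector of inner products with the
  monomials, and the Gram matrix of the monomials on the ball is positive definite. For 4), the components of
  \<open>g\<close> are read off from a square root of \<open>E\<close>. For 5), if \<open>a\<^sub>\<mu>\<close> and \<open>b\<^sub>\<mu>\<close> are the coefficient vectors of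
  \<open>H\<^sub>d \<otimes> P\<close> and \<open>H\<^sub>d \<otimes> N\<close>, positivity of \<open>E\<close> says \<open>\<parallel>\<Sum> x\<^sub>\<mu> b\<^sub>\<mu>\<parallel> < \<parallel>\<Sum> x\<^sub>\<mu> a\<^sub>\<mu>\<parallel>\<close>, so \<open>a\<^sub>\<mu> \<mapsto> b\<^sub>\<mu>\<close> is a contraction on
  the span of the \<open>a\<^sub>\<mu>\<close>, extended by zero on the orthogonal complement.
\<close>

section \<open>Hermitian matrices over a finite index set\<close>

text \<open>The weights of the two forms carry square roots of factorials and are hard to compare
  directly. Their squares are products of factorial quotients of total degree 2 m and differ by
  O(k^(2 m - 1)); as both weights are nonnegative, the weights themselves differ by at most the
  square root of that, whence the half power. For fixed \<alpha>, \<beta> the condition \<alpha> +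
  \<mu> = \<beta> + \<nu> pairs each \<mu> with at most one \<nu>, so a bound on the entries is
  already a bound on the form, and the number of multi-indices, which grows with k, never enters.

  One exponent d serves 2) to 5). It is taken at least 1 because for m = 0 the function f is a
  positive constant, and only the factor ||z||^(2 d) makes the origin a zero, as 4) and 5) require.
  The given coefficient matrix is replaced by the one built from the coefficients of P and N, which
  is Hermitian by construction. Since 3) uses values of the polynomial off the diagonal, the two are
  identified by polarization.\<close>

definition inner_on :: "'i set \<Rightarrow> ('i \<Rightarrow> complex) \<Rightarrow> ('i \<Rightarrow> complex) \<Rightarrow> complex" where
  "inner_on I u v = (\<Sum>i\<in>I. u i * cnj (v i))"

lemma quad_form_eq_inner: "quad_form_on I A u = inner_on I (mat_vec_on I A u) u"
  by (simp add: quad_form_on_def inner_on_def)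

lemma inner_on_self: "inner_on I u u = complex_of_real (norm_sq_on I u)"
  by (simp add: inner_on_def norm_sq_on_def complex_norm_square del: of_real_power)

lemma inner_on_commute: "inner_on I v u = cnj (inner_on I u v)"
  by (simp add: inner_on_def mult.commute)

lemma inner_on_add_left: "inner_on I (\<lambda>i. u i + v i) w = inner_on I u w + inner_on I v w"
  by (simp add: inner_on_def sum.distrib algebra_simps)

lemma inner_on_add_right: "inner_on I w (\<lambda>i. u i + v i) = inner_on I w u + inner_on I w v"
  by (simp add: inner_on_def sum.distrib algebra_simps)

lemma inner_on_diff_left: "inner_on I (\<lambda>i. u i - v i) w = inner_on I u w - inner_on I v w"
  by (simp add: inner_on_def sum_subtractf algebra_simps)

lemma inner_on_scale_left: "inner_on I (\<lambda>i. a * u i) w = a * inner_on I u w"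
  by (simp add: inner_on_def sum_distrib_left mult_ac)

lemma inner_on_scale_right: "inner_on I w (\<lambda>i. a * u i) = cnj a * inner_on I w u"
  by (simp add: inner_on_def sum_distrib_left mult_ac)

lemma inner_on_sum_left: "inner_on I (\<lambda>i. \<Sum>k\<in>K. u k i) w = (\<Sum>k\<in>K. inner_on I (u k) w)"
  unfolding inner_on_def sum_distrib_right by (rule sum.swap)

lemma inner_on_cong:
  "(\<And>i. i \<in> I \<Longrightarrow> u i = u' i) \<Longrightarrow> (\<And>i. i \<in> I \<Longrightarrow> v i = v' i) \<Longrightarrow> inner_on I u v = inner_on I u' v'"
  by (auto simp: inner_on_def)

lemma norm_sq_on_nonneg: "0 \<le> norm_sq_on I u"
  by (simp add: norm_sq_on_def sum_nonneg)

lemma norm_sq_on_eq_0_iff: "finite I \<Longrightarrow> norm_sq_on I u = 0 \<longleftrightarrow> (\<forall>i\<in>I. u i = 0)"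
  by (simp add: norm_sq_on_def sum_nonneg_eq_0_iff)

lemma norm_sq_on_scale: "norm_sq_on I (\<lambda>i. a * u i) = (cmod a)\<^sup>2 * norm_sq_on I u"
  by (simp add: norm_sq_on_def sum_distrib_left norm_mult power_mult_distrib)

lemma cmod_inner_on_le:
  "cmod (inner_on I u v) \<le> sqrt (norm_sq_on I u) * sqrt (norm_sq_on I v)"
proof -
  have "cmod (inner_on I u v) \<le> (\<Sum>i\<in>I. cmod (u i) * cmod (v i))"
    unfolding inner_on_def by (rule order_trans[OF norm_sum]) (simp add: norm_mult)
  also have "\<dots> \<le> L2_set (\<lambda>i. cmod (u i)) I * L2_set (\<lambda>i. cmod (v i)) I"
    using L2_set_mult_ineq[of "\<lambda>i. cmod (u i)" "\<lambda>i. cmod (v i)" I] by simp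
  finally show ?thesis by (simp add: L2_set_def norm_sq_on_def)
qed

lemma mat_vec_on_add: "mat_vec_on I A (\<lambda>i. u i + v i) = (\<lambda>i. mat_vec_on I A u i + mat_vec_on I A v i)"
  by (simp add: mat_vec_on_def sum.distrib algebra_simps)

lemma mat_vec_on_scale: "mat_vec_on I A (\<lambda>i. a * u i) = (\<lambda>i. a * mat_vec_on I A u i)"
  by (simp add: mat_vec_on_def sum_distrib_left mult_ac)

lemma mat_vec_on_sum:
  "mat_vec_on I A (\<lambda>i. \<Sum>k\<in>K. u k i) = (\<lambda>i. \<Sum>k\<in>K. mat_vec_on I A (u k) i)"
proof
  fix i
  show "mat_vec_on I A (\<lambda>i. \<Sum>k\<in>K. u k i) i = (\<Sum>k\<in>K. mat_vec_on I A (u k) i)"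
    unfolding mat_vec_on_def sum_distrib_left by (rule sum.swap)
qed

lemma mat_vec_on_cong: "(\<And>i. i \<in> I \<Longrightarrow> u i = v i) \<Longrightarrow> mat_vec_on I A u = mat_vec_on I A v"
  by (auto simp: mat_vec_on_def)

lemma mat_vec_on_mul: "mat_vec_on I (mat_mul_on J A B) u = mat_vec_on J A (mat_vec_on I B u)"
proof
  fix i
  have "mat_vec_on I (mat_mul_on J A B) u i = (\<Sum>k\<in>I. \<Sum>j\<in>J. A i j * B j k * u k)"
    by (simp add: mat_vec_on_def mat_mul_on_def sum_distrib_right)
  also have "\<dots> = (\<Sum>j\<in>J. \<Sum>k\<in>I. A i j * B j k * u k)" by (rule sum.swap)
  finally show "mat_vec_on I (mat_mul_on J A B) u i = mat_vec_on J A (mat_vec_on I B u) i"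
    by (simp add: mat_vec_on_def sum_distrib_left mult.assoc)
qed

lemma inner_on_mat_adj: "inner_on J (mat_vec_on I A u) v = inner_on I u (mat_vec_on J (mat_adj A) v)"
proof -
  have "inner_on J (mat_vec_on I A u) v = (\<Sum>j\<in>J. \<Sum>i\<in>I. A j i * u i * cnj (v j))"
    by (simp add: inner_on_def mat_vec_on_def sum_distrib_right)
  also have "\<dots> = (\<Sum>i\<in>I. \<Sum>j\<in>J. A j i * u i * cnj (v j))" by (rule sum.swap)
  finally show ?thesis
    by (simp add: inner_on_def mat_vec_on_def mat_adj_def sum_distrib_left mult_ac)
qed

lemma inner_on_hermitian:
  assumes "hermitian_on I A"
  shows "inner_on I (mat_vec_on I A u) v = inner_on I u (mat_vec_on I A v)"
proof -
  have "mat_vec_on I (mat_adj A) v i = mat_vec_on I A v i" if "i \<in> I" for i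
  proof -
    have "cnj (A j i) = A i j" if "j \<in> I" for j
      using assms that \<open>i \<in> I\<close> unfolding hermitian_on_def by metis
    then show ?thesis by (simp add: mat_vec_on_def mat_adj_def)
  qed
  then show ?thesis
    unfolding inner_on_mat_adj by (intro inner_on_cong) auto
qed

text \<open>Gaussian elimination: an unknown \<open>i0\<close> with nonzero coefficient in the new
  equation is expressed by the others, substituted into the remaining equations, and recovered at
  the end. This is the dimension count for vectors that are stored as functions on an index
  set.\<close>

lemma ex_nonzero_solution:
  fixes a :: "'k \<Rightarrow> 'i \<Rightarrow> complex"
  assumes "finite K" "finite I" "card K < card I"
  shows "\<exists>u. (\<exists>i\<in>I. u i \<noteq> 0) \<and> (\<forall>i. i \<notin> I \<longrightarrow> u i = 0) \<and> (\<forall>k\<in>K. (\<Sum>i\<in>I. a k i * u i) = 0)"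
  using assms
proof (induction K arbitrary: I a rule: finite_induct)
  case empty
  then have "I \<noteq> {}" by auto
  then obtain i where "i \<in> I" by auto
  then show ?case by (intro exI[of _ "\<lambda>j. if j = i then 1 else 0"]) auto
next
  case (insert k K)
  show ?case
  proof (cases "\<forall>i\<in>I. a k i = 0")
    case True
    have "card K < card I" using insert by simp
    from insert.IH[OF \<open>finite I\<close> this, of a] True show ?thesis by auto
  next
    case False
    then obtain i0 where i0: "i0 \<in> I" "a k i0 \<noteq> 0" by auto
    have "card K < card (I - {i0})" using insert i0 by simp
    from insert.IH[OF _ this, of "\<lambda>l i. a l i - a l i0 * a k i / a k i0"] insert.prems
    obtain u where u: "\<exists>i\<in>I - {i0}. u i \<noteq> 0" "\<forall>i. i \<notin> I - {i0} \<longrightarrow> u i = 0"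
      "\<forall>l\<in>K. (\<Sum>i\<in>I - {i0}. (a l i - a l i0 * a k i / a k i0) * u i) = 0" by auto
    define s where "s = (\<Sum>i\<in>I - {i0}. a k i * u i)"
    define w where "w = (\<lambda>i. if i = i0 then - s / a k i0 else u i)"
    have sumw: "(\<Sum>i\<in>I. a l i * w i) = - a l i0 * s / a k i0 + (\<Sum>i\<in>I - {i0}. a l i * u i)" for l
      using insert.prems i0 by (subst sum.remove[of _ i0]) (auto simp: w_def intro!: sum.cong)
    have "(\<Sum>i\<in>I. a l i * w i) = 0" if "l \<in> insert k K" for l
    proof (cases "l = k")
      case True
      have "- a k i0 * s / a k i0 + s = 0" using i0(2) by simp
      then show ?thesis unfolding True by (simp only: sumw s_def)
    next
      case False
      then have "(\<Sum>i\<in>I - {i0}. (a l i - a l i0 * a k i / a k i0) * u i) = 0"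
        using u(3) that by blast
      moreover have "(a l i - a l i0 * a k i / a k i0) * u i
          = a l i * u i - (a l i0 / a k i0) * (a k i * u i)" for i
        by (simp add: left_diff_distrib)
      ultimately have "(\<Sum>i\<in>I - {i0}. a l i * u i - (a l i0 / a k i0) * (a k i * u i)) = 0"
        by simp
      then have "(\<Sum>i\<in>I - {i0}. a l i * u i) = (a l i0 / a k i0) * s"
        by (simp only: sum_subtractf sum_distrib_left[symmetric] s_def right_minus_eq)
      then show ?thesis by (simp only: sumw) simp
    qed
    moreover have "\<exists>i\<in>I. w i \<noteq> 0" using u(1) by (auto simp: w_def)
    moreover have "\<forall>i. i \<notin> I \<longrightarrow> w i = 0" using u(2) i0 by (auto simp: w_def)
    ultimately show ?thesis by blast
  qed
qed

section \<open>Orthonormal bases and diagonalization of Hermitian matrices\<close>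

definition orthonormal_on :: "'i set \<Rightarrow> nat \<Rightarrow> (nat \<Rightarrow> 'i \<Rightarrow> complex) \<Rightarrow> bool" where
  "orthonormal_on I k e \<longleftrightarrow> (\<forall>a<k. \<forall>b<k. inner_on I (e a) (e b) = (if a = b then 1 else 0))"

text \<open>The residual \<open>w\<close> is orthogonal to every \<open>e a\<close>. Together with
  the \<open>e a\<close> it gives one vector more than \<open>I\<close> has elements, hence a
  nontrivial linear relation. Pairing the relation with \<open>e b\<close> kills the coefficient of
  \<open>e b\<close>; so \<open>w\<close> has a nonzero coefficient, and pairing with
  \<open>w\<close> yields ||w|| = 0.\<close>

lemma orthonormal_expansion:
  assumes "finite I" and e: "orthonormal_on I (card I) e" and i: "i \<in> I"
  shows "u i = (\<Sum>a<card I. inner_on I u (e a) * e a i)"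
proof -
  define w where "w = (\<lambda>i. u i - (\<Sum>a<card I. inner_on I u (e a) * e a i))"
  have w_orth: "inner_on I w (e b) = 0" if "b < card I" for b
  proof -
    have "inner_on I w (e b) = inner_on I u (e b)
        - (\<Sum>a<card I. inner_on I u (e a) * inner_on I (e a) (e b))"
      unfolding w_def inner_on_diff_left inner_on_sum_left inner_on_scale_left by simp
    also have "(\<Sum>a<card I. inner_on I u (e a) * inner_on I (e a) (e b))
        = (\<Sum>a<card I. if a = b then inner_on I u (e a) else 0)"
      using e that by (intro sum.cong) (auto simp: orthonormal_on_def)
    finally show ?thesis using that by simp
  qed
  define e' where "e' = (\<lambda>a. if a = card I then w else e a)"
  from ex_nonzero_solution[of I "{..card I}" "\<lambda>i a. e' a i"] \<open>finite I\<close>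
  obtain x where x: "\<exists>a\<le>card I. x a \<noteq> 0" "\<forall>i\<in>I. (\<Sum>a\<le>card I. e' a i * x a) = 0" by auto
  have comb: "(\<Sum>a\<le>card I. x a * inner_on I (e' a) v) = 0" for v
  proof -
    have "inner_on I (\<lambda>i. \<Sum>a\<le>card I. x a * e' a i) v = inner_on I (\<lambda>i. 0) v"
      using x(2) by (intro inner_on_cong) (auto simp: mult.commute)
    then show ?thesis by (simp add: inner_on_sum_left inner_on_scale_left) (simp add: inner_on_def)
  qed
  have xb: "x b = 0" if "b < card I" for b
  proof -
    have "(\<Sum>a\<le>card I. x a * inner_on I (e' a) (e b)) = (\<Sum>a\<le>card I. if a = b then x a else 0)"
      using that w_orth e by (intro sum.cong) (auto simp: e'_def orthonormal_on_def)
    then show ?thesis using comb[of "e b"] that by simp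
  qed
  then have "x (card I) \<noteq> 0" using x(1) by (metis le_neq_implies_less)
  moreover have "(\<Sum>a\<le>card I. x a * inner_on I (e' a) w) = (\<Sum>a\<le>card I. if a = card I then x a * inner_on I w w else 0)"
    by (intro sum.cong) (auto simp: xb e'_def)
  ultimately have "inner_on I w w = 0" using comb[of w] by simp
  then have "w i = 0" using \<open>finite I\<close> i by (simp add: inner_on_self norm_sq_on_eq_0_iff)
  then show ?thesis by (simp add: w_def)
qed

text \<open>The ambient function type may have infinitely many coordinates, so compactness comes
  from Tychonoff: coordinates outside \<open>I\<close> are pinned to 0 and those in \<open>I\<close>
  range over the closed unit disc.\<close>

lemma compact_unit_sphere_on:
  assumes "finite I"
  shows "compact {u. (\<forall>i. i \<notin> I \<longrightarrow> u i = 0) \<and> norm_sq_on I u = 1}"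
proof -
  define C where "C = PiE UNIV (\<lambda>i. if i \<in> I then cball (0::complex) 1 else {0})"
  have "compactin (product_topology (\<lambda>i. euclidean) UNIV) C"
    unfolding C_def compactin_PiE by auto
  then have "compact C" by (simp add: euclidean_product_topology)
  moreover have "closed {u::'a \<Rightarrow> complex. norm_sq_on I u = 1}"
    unfolding norm_sq_on_def
    by (intro closed_Collect_eq continuous_intros continuous_on_product_coordinates)
  moreover have "{u. (\<forall>i. i \<notin> I \<longrightarrow> u i = 0) \<and> norm_sq_on I u = 1} = C \<inter> {u. norm_sq_on I u = 1}"
  proof -
    have "cmod (u i) \<le> 1" if "norm_sq_on I u = 1" "i \<in> I" for u i
    proof -
      have "(cmod (u i))\<^sup>2 \<le> norm_sq_on I u"
        unfolding norm_sq_on_def using assms that by (intro member_le_sum) auto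
      then show ?thesis using that by (simp add: power_le_one_iff)
    qed
    then show ?thesis by (auto simp: C_def PiE_def Pi_def split: if_splits)
  qed
  ultimately show ?thesis by (simp add: compact_Int_closed)
qed

lemma nonneg_quadratic_imp_zero:
  fixes b q :: real
  assumes "\<And>t::real. 0 \<le> 2 * t * b + t\<^sup>2 * q"
  shows "b = 0"
proof (rule ccontr)
  assume b: "b \<noteq> 0"
  have q: "q \<ge> 0" using assms[of 1] assms[of "-1"] by simp
  \<comment> \<open>The minimiser would be - b / q; the denominator q + 1 covers q = 0 as
    well.\<close>
  define t where "t = - b / (q + 1)"
  have "t * (q + 1) = - b" using q by (simp add: t_def)
  then have "2 * t * b + t\<^sup>2 * q = t * b - t\<^sup>2" by algebra
  also have "t * b = - (b\<^sup>2 / (q + 1))" by (simp add: t_def power2_eq_square)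
  also have "- (b\<^sup>2 / (q + 1)) - t\<^sup>2 < 0"
    using b q by (smt (verit) divide_pos_pos zero_less_power2 zero_le_power2)
  finally show False using assms[of t] by simp
qed

text \<open>The maximiser of the quadratic form on the unit vectors orthogonal to the eigenvectors already
  found is the next eigenvector.\<close>

lemma extend_orthonormal_eigenvectors:
  assumes I: "finite I" and A: "hermitian_on I A" and k: "k < card I"
    and e: "orthonormal_on I k e"
    and eig: "\<And>a i. a < k \<Longrightarrow> i \<in> I \<Longrightarrow> mat_vec_on I A (e a) i = complex_of_real (l a) * e a i"
  shows "\<exists>u r. norm_sq_on I u = 1 \<and> (\<forall>a<k. inner_on I u (e a) = 0)
           \<and> (\<forall>i\<in>I. mat_vec_on I A u i = complex_of_real r * u i)"
proof -
  define W where "W = {u. \<forall>a<k. inner_on I u (e a) = 0}"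
  define S where "S = {u. (\<forall>i. i \<notin> I \<longrightarrow> u i = 0) \<and> norm_sq_on I u = 1} \<inter> W"
  define Q where "Q = (\<lambda>u. Re (quad_form_on I A u))"
  have W_closed: "closed W"
  proof -
    have "W = (\<Inter>a\<in>{..<k}. {u. inner_on I u (e a) = 0})" by (auto simp: W_def)
    moreover have "closed {u. inner_on I u (e a) = 0}" for a
      unfolding inner_on_def
      by (intro closed_Collect_eq continuous_intros continuous_on_product_coordinates)
    ultimately show ?thesis by auto
  qed
  have "compact S"
    unfolding S_def using compact_unit_sphere_on[OF I] W_closed by (rule compact_Int_closed)
  moreover have "continuous_on S Q"
    unfolding Q_def quad_form_on_def mat_vec_on_def
    by (intro continuous_intros continuous_on_subset[OF continuous_on_product_coordinates]) auto
  moreover have normalize: "\<exists>c v. c > 0 \<and> v \<in> S \<and> (\<forall>i\<in>I. w i = complex_of_real c * v i) \<and> c\<^sup>2 = norm_sq_on I w"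
    if "w \<in> W" "\<exists>i\<in>I. w i \<noteq> 0" for w
  proof -
    define c where "c = sqrt (norm_sq_on I w)"
    have "norm_sq_on I w > 0"
      using that(2) norm_sq_on_nonneg[of I w] norm_sq_on_eq_0_iff[OF I, of w] by force
    then have c: "c > 0" "c\<^sup>2 = norm_sq_on I w" by (simp_all add: c_def)
    define v where "v = (\<lambda>i. if i \<in> I then complex_of_real (1 / c) * w i else 0)"
    have "norm_sq_on I v = norm_sq_on I (\<lambda>i. complex_of_real (1 / c) * w i)"
      by (simp add: norm_sq_on_def v_def)
    also have "\<dots> = 1" using c \<open>norm_sq_on I w > 0\<close> unfolding norm_sq_on_scale by (simp add: norm_divide power_divide)
    finally have "norm_sq_on I v = 1" .
    moreover have "inner_on I v (e a) = complex_of_real (1 / c) * inner_on I w (e a)" for a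
      unfolding inner_on_scale_left[symmetric] by (intro inner_on_cong) (auto simp: v_def)
    ultimately have "v \<in> S" using that(1) by (auto simp: S_def W_def v_def)
    moreover have "\<forall>i\<in>I. w i = complex_of_real c * v i" using c by (auto simp: v_def)
    ultimately show ?thesis using c by blast
  qed
  moreover have "S \<noteq> {}"
  proof -
    obtain w where "\<exists>i\<in>I. w i \<noteq> 0" "\<forall>a\<in>{..<k}. (\<Sum>i\<in>I. cnj (e a i) * w i) = 0"
      using ex_nonzero_solution[of "{..<k}" I "\<lambda>a i. cnj (e a i)"] I k by auto
    then have "w \<in> W" "\<exists>i\<in>I. w i \<noteq> 0" by (auto simp: W_def inner_on_def mult.commute)
    from normalize[OF this] show ?thesis by auto
  qed
  ultimately obtain u where u: "u \<in> S" "\<And>v. v \<in> S \<Longrightarrow> Q v \<le> Q u"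
    using continuous_attains_sup[of S Q] by auto
  define r where "r = Q u"
  have QW: "Q w \<le> r * norm_sq_on I w" if w: "w \<in> W" for w
  proof (cases "\<exists>i\<in>I. w i \<noteq> 0")
    case True
    from normalize[OF w True] obtain c v where cv: "c > 0" "v \<in> S"
      "\<forall>i\<in>I. w i = complex_of_real c * v i" "c\<^sup>2 = norm_sq_on I w" by auto
    have "quad_form_on I A w = quad_form_on I A (\<lambda>i. complex_of_real c * v i)"
      unfolding quad_form_eq_inner using cv(3)
      by (intro inner_on_cong fun_cong[OF mat_vec_on_cong]) auto
    also have "\<dots> = complex_of_real (c\<^sup>2) * quad_form_on I A v"
      by (simp add: quad_form_eq_inner mat_vec_on_scale inner_on_scale_left inner_on_scale_right
            power2_eq_square)
    finally have "Q w = c\<^sup>2 * Q v" by (simp add: Q_def del: of_real_power)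
    also have "\<dots> \<le> c\<^sup>2 * r" using u(2)[OF cv(2)] by (simp add: r_def mult_left_mono)
    finally show ?thesis using cv(4) by (simp add: mult.commute)
  next
    case False
    then show ?thesis by (simp add: Q_def quad_form_on_def norm_sq_on_def)
  qed
  \<comment> \<open>On \<open>W\<close> the form of \<open>B\<close> = r - A is nonnegative by
    \<open>QW\<close>, and it vanishes at the maximiser \<open>u\<close>. Evaluating it at u + t B u
    leaves the linear term 2 t ||B u||^2, which must therefore be 0.\<close>
  define B where "B = (\<lambda>w i. complex_of_real r * w i - mat_vec_on I A w i)"
  have B_sa: "inner_on I (B v) w = inner_on I v (B w)" for v w
  proof -
    have "inner_on I v (B w) = cnj (inner_on I (B w) v)" by (rule inner_on_commute)
    also have "\<dots> = complex_of_real r * cnj (inner_on I w v) - cnj (inner_on I (mat_vec_on I A w) v)"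
      unfolding B_def inner_on_diff_left inner_on_scale_left by simp
    also have "\<dots> = complex_of_real r * inner_on I v w - inner_on I v (mat_vec_on I A w)"
      by (simp only: inner_on_commute[symmetric])
    finally show ?thesis
      unfolding B_def inner_on_diff_left inner_on_scale_left inner_on_hermitian[OF A] by simp
  qed
  have B_lin: "B (\<lambda>i. v i + complex_of_real t * w i) = (\<lambda>i. B v i + complex_of_real t * B w i)" for v w t
    by (simp add: B_def mat_vec_on_add mat_vec_on_scale fun_eq_iff algebra_simps)
  have B_quad: "Re (inner_on I (B w) w) = r * norm_sq_on I w - Q w" for w
    by (simp add: B_def inner_on_diff_left inner_on_scale_left inner_on_self Q_def quad_form_eq_inner)
  have uW: "u \<in> W" "norm_sq_on I u = 1" using u(1) by (auto simp: S_def)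
  \<comment> \<open>\<open>W\<close> is invariant under \<open>B\<close> because the vectors it is
    orthogonal to are eigenvectors; without this the variation in direction \<open>B u\<close> would
    leave \<open>W\<close>.\<close>
  have BuW: "B u \<in> W"
  proof -
    have "inner_on I (B u) (e a) = 0" if "a < k" for a
    proof -
      have "inner_on I (B u) (e a) = inner_on I u (B (e a))" by (rule B_sa)
      also have "\<dots> = inner_on I u (\<lambda>i. complex_of_real (r - l a) * e a i)"
        using eig that by (intro inner_on_cong) (auto simp: B_def algebra_simps)
      finally show ?thesis using uW(1) that by (simp add: inner_on_scale_right W_def)
    qed
    then show ?thesis by (simp add: W_def)
  qed
  define nB where "nB = norm_sq_on I (B u)"
  have "0 \<le> 2 * t * nB + t\<^sup>2 * Re (inner_on I (B (B u)) (B u))" for t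
  proof -
    define w where "w = (\<lambda>i. u i + complex_of_real t * B u i)"
    have "w \<in> W" using uW(1) BuW
      by (auto simp: W_def w_def inner_on_add_left inner_on_scale_left)
    then have "0 \<le> Re (inner_on I (B w) w)" using QW[of w] by (simp add: B_quad)
    also have "inner_on I (B w) w = inner_on I (B u) u + complex_of_real t * inner_on I (B u) (B u)
        + complex_of_real t * inner_on I (B (B u)) u
        + complex_of_real (t\<^sup>2) * inner_on I (B (B u)) (B u)"
      unfolding w_def B_lin
      by (simp add: inner_on_add_left inner_on_add_right inner_on_scale_left inner_on_scale_right
          algebra_simps power2_eq_square)
    also have "inner_on I (B (B u)) u = inner_on I (B u) (B u)" by (rule B_sa)
    also have "Re (inner_on I (B u) u + complex_of_real t * inner_on I (B u) (B u)
        + complex_of_real t * inner_on I (B u) (B u)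
        + complex_of_real (t\<^sup>2) * inner_on I (B (B u)) (B u))
       = 2 * t * nB + t\<^sup>2 * Re (inner_on I (B (B u)) (B u))"
      using uW(2) by (simp add: B_quad r_def inner_on_self nB_def del: of_real_power)
    finally show ?thesis .
  qed
  then have "nB = 0" by (rule nonneg_quadratic_imp_zero)
  then have "\<forall>i\<in>I. B u i = 0" using I by (simp add: nB_def norm_sq_on_eq_0_iff)
  then have "\<forall>i\<in>I. mat_vec_on I A u i = complex_of_real r * u i"
    unfolding B_def by (metis right_minus_eq)
  moreover have "\<forall>a<k. inner_on I u (e a) = 0" using uW(1) unfolding W_def by blast
  ultimately show ?thesis using uW(2) by blast
qed

lemma spectral_theorem_on:
  assumes I: "finite I" and A: "hermitian_on I A"
  obtains e l where "orthonormal_on I (card I) e"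
    and "\<And>a i. a < card I \<Longrightarrow> i \<in> I \<Longrightarrow> mat_vec_on I A (e a) i = complex_of_real (l a) * e a i"
proof -
  have "\<exists>e l. orthonormal_on I k e
      \<and> (\<forall>a<k. \<forall>i\<in>I. mat_vec_on I A (e a) i = complex_of_real (l a) * e a i)" if "k \<le> card I" for k
    using that
  proof (induction k)
    case 0
    show ?case by (simp add: orthonormal_on_def)
  next
    case (Suc k)
    then obtain e l where e: "orthonormal_on I k e"
      and l': "\<forall>a<k. \<forall>i\<in>I. mat_vec_on I A (e a) i = complex_of_real (l a) * e a i"
      using Suc_leD[OF Suc.prems] by blast
    have l: "mat_vec_on I A (e a) i = complex_of_real (l a) * e a i" if "a < k" "i \<in> I" for a i
      using l' that by blast
    have "k < card I" using Suc.prems by simp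
    from extend_orthonormal_eigenvectors[OF I A this e l]
    obtain u r where u: "norm_sq_on I u = 1" "\<forall>a<k. inner_on I u (e a) = 0"
      "\<forall>i\<in>I. mat_vec_on I A u i = complex_of_real r * u i" by blast
    have u': "inner_on I (e a) u = 0" if "a < k" for a
      using u(2) that by (subst inner_on_commute) simp
    have uu: "inner_on I u u = 1" using u(1) by (simp add: inner_on_self)
    have "orthonormal_on I (Suc k) (e(k := u))"
      unfolding orthonormal_on_def
    proof (intro allI impI)
      fix a b assume "a < Suc k" "b < Suc k"
      then show "inner_on I ((e(k := u)) a) ((e(k := u)) b) = (if a = b then 1 else 0)"
        using e u(2) u' uu by (cases "a = k"; cases "b = k") (auto simp: orthonormal_on_def)
    qed
    moreover have "\<forall>a<Suc k. \<forall>i\<in>I. mat_vec_on I A ((e(k := u)) a) i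
        = complex_of_real ((l(k := r)) a) * (e(k := u)) a i"
      using l u(3) by auto
    ultimately show ?case by blast
  qed
  from this[of "card I"] show thesis using that by blast
qed

lemma pos_def_onD: "pos_def_on I A \<Longrightarrow> \<exists>i\<in>I. u i \<noteq> 0 \<Longrightarrow> 0 < Re (quad_form_on I A u)"
  unfolding pos_def_on_def by blast

text \<open>Only the eigenbasis is recorded, so that the locale can be interpreted for two matrices
  that share one basis. This is how a square root is constructed and how two square roots are
  compared.\<close>

locale hermitian_eigenbasis =
  fixes I :: "'i set" and A :: "'i \<Rightarrow> 'i \<Rightarrow> complex" and e :: "nat \<Rightarrow> 'i \<Rightarrow> complex" and l :: "nat \<Rightarrow> real"
  assumes I: "finite I"
    and orthonormal: "orthonormal_on I (card I) e"
    and eigen: "\<And>a i. a < card I \<Longrightarrow> i \<in> I \<Longrightarrow> mat_vec_on I A (e a) i = complex_of_real (l a) * e a i"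
begin

lemma expansion: "i \<in> I \<Longrightarrow> u i = (\<Sum>a<card I. inner_on I u (e a) * e a i)"
  by (rule orthonormal_expansion[OF I orthonormal])

lemma mat_vec_expansion:
  assumes "i \<in> I"
  shows "mat_vec_on I A u i = (\<Sum>a<card I. complex_of_real (l a) * inner_on I u (e a) * e a i)"
proof -
  have "mat_vec_on I A u i = mat_vec_on I A (\<lambda>i. \<Sum>a<card I. inner_on I u (e a) * e a i) i"
    by (intro fun_cong[OF mat_vec_on_cong] expansion)
  also have "\<dots> = (\<Sum>a<card I. inner_on I u (e a) * mat_vec_on I A (e a) i)"
    by (simp add: mat_vec_on_sum mat_vec_on_scale)
  also have "\<dots> = (\<Sum>a<card I. complex_of_real (l a) * inner_on I u (e a) * e a i)"
    using assms by (intro sum.cong) (auto simp: eigen)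
  finally show ?thesis .
qed

lemma inner_combination:
  assumes "b < card I"
  shows "inner_on I (\<lambda>i. \<Sum>a<card I. x a * e a i) (e b) = x b"
proof -
  have "inner_on I (\<lambda>i. \<Sum>a<card I. x a * e a i) (e b) = (\<Sum>a<card I. if a = b then x a else 0)"
    unfolding inner_on_sum_left inner_on_scale_left
    using orthonormal assms by (intro sum.cong) (auto simp: orthonormal_on_def)
  then show ?thesis using assms by simp
qed

lemma inner_expansion:
  "inner_on I (\<lambda>i. \<Sum>a<card I. x a * e a i) u = (\<Sum>a<card I. x a * cnj (inner_on I u (e a)))"
  unfolding inner_on_sum_left inner_on_scale_left by (simp only: inner_on_commute[of I "e _" u])

lemma quad_form_expansion:
  "Re (quad_form_on I A u) = (\<Sum>a<card I. l a * (cmod (inner_on I u (e a)))\<^sup>2)"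
proof -
  have "quad_form_on I A u
      = inner_on I (\<lambda>i. \<Sum>a<card I. complex_of_real (l a) * inner_on I u (e a) * e a i) u"
    unfolding quad_form_eq_inner by (intro inner_on_cong mat_vec_expansion refl)
  also have "\<dots> = (\<Sum>a<card I. complex_of_real (l a * (cmod (inner_on I u (e a)))\<^sup>2))"
    unfolding inner_expansion
    by (intro sum.cong) (simp_all add: complex_norm_square mult.assoc del: of_real_power)
  finally show ?thesis by (simp del: of_real_mult)
qed

lemma norm_sq_expansion: "norm_sq_on I u = (\<Sum>a<card I. (cmod (inner_on I u (e a)))\<^sup>2)"
proof -
  have "complex_of_real (norm_sq_on I u) = inner_on I (\<lambda>i. \<Sum>a<card I. inner_on I u (e a) * e a i) u"
    unfolding inner_on_self[symmetric] by (intro inner_on_cong expansion refl)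
  also have "\<dots> = complex_of_real (\<Sum>a<card I. (cmod (inner_on I u (e a)))\<^sup>2)"
    unfolding inner_expansion by (simp add: complex_norm_square del: of_real_power)
  finally show ?thesis by (simp only: of_real_eq_iff)
qed

lemma quad_form_eigenvector:
  assumes "b < card I"
  shows "Re (quad_form_on I A (e b)) = l b"
proof -
  have "(\<Sum>a<card I. l a * (cmod (inner_on I (e b) (e a)))\<^sup>2) = (\<Sum>a<card I. if a = b then l a else 0)"
    using orthonormal assms by (intro sum.cong) (auto simp: orthonormal_on_def)
  then show ?thesis unfolding quad_form_expansion using assms by simp
qed

lemma eigenvector_nonzero:
  assumes "b < card I"
  shows "\<exists>i\<in>I. e b i \<noteq> 0"
proof (rule ccontr)
  assume "\<not> ?thesis"
  then have "inner_on I (e b) (e b) = 0" by (simp add: inner_on_def)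
  then show False using orthonormal assms by (simp add: orthonormal_on_def)
qed

end

lemma hermitian_eigenbasis_ex:
  assumes "finite I" "hermitian_on I A"
  obtains e l where "hermitian_eigenbasis I A e l"
  using spectral_theorem_on[OF assms] assms(1) by (metis hermitian_eigenbasis.intro)

section \<open>Positive definite matrices: coercivity and solvability\<close>

lemma pos_def_imp_pos_semidef: "pos_def_on I A \<Longrightarrow> pos_semidef_on I A"
proof -
  assume A: "pos_def_on I A"
  have "0 \<le> Re (quad_form_on I A u)" for u
  proof (cases "\<exists>i\<in>I. u i \<noteq> 0")
    case True
    then show ?thesis using A by (auto simp: pos_def_on_def less_imp_le)
  qed (simp add: quad_form_on_def)
  then show ?thesis using A by (simp add: pos_def_on_def pos_semidef_on_def)
qed

lemma pos_def_coercive: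
  assumes I: "finite I" and A: "pos_def_on I A"
  obtains c where "c > 0" "\<And>u. c * norm_sq_on I u \<le> Re (quad_form_on I A u)"
proof -
  have "hermitian_on I A" using A by (simp add: pos_def_on_def)
  from hermitian_eigenbasis_ex[OF I this] obtain e l where "hermitian_eigenbasis I A e l" .
  then interpret hermitian_eigenbasis I A e l .
  have l: "l a > 0" if "a < card I" for a
    using A that eigenvector_nonzero[OF that] quad_form_eigenvector[OF that]
    by (metis pos_def_on_def)
  \<comment> \<open>The smallest eigenvalue, capped at 1; inserting 1 keeps the set nonempty when
    \<open>I\<close> is empty.\<close>
  define c where "c = Min (insert 1 (l ` {..<card I}))"
  have "c > 0" unfolding c_def using l by (subst Min_gr_iff) auto
  moreover have cl: "c \<le> l a" if "a < card I" for a
    unfolding c_def using that by (intro Min_le) auto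
  have "c * norm_sq_on I u \<le> Re (quad_form_on I A u)" for u
    unfolding norm_sq_expansion quad_form_expansion sum_distrib_left
    using cl by (intro sum_mono mult_right_mono) auto
  ultimately show thesis using that by blast
qed

lemma pos_def_solvable:
  assumes I: "finite I" and A: "pos_def_on I A"
  shows "\<exists>u. \<forall>i\<in>I. mat_vec_on I A u i = y i"
proof -
  have "hermitian_on I A" using A by (simp add: pos_def_on_def)
  from hermitian_eigenbasis_ex[OF I this] obtain e l where "hermitian_eigenbasis I A e l" .
  then interpret hermitian_eigenbasis I A e l .
  have l: "l a > 0" if "a < card I" for a
    using A that eigenvector_nonzero[OF that] quad_form_eigenvector[OF that]
    by (metis pos_def_on_def)
  define u where "u = (\<lambda>i. \<Sum>a<card I. inner_on I y (e a) / complex_of_real (l a) * e a i)"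
  have "mat_vec_on I A u i = y i" if i: "i \<in> I" for i
  proof -
    have "complex_of_real (l a) * inner_on I u (e a) = inner_on I y (e a)" if "a < card I" for a
      using l[OF that] unfolding u_def inner_combination[OF that] by simp
    then show ?thesis
      unfolding mat_vec_expansion[OF i] expansion[OF i, of y] by (intro sum.cong) auto
  qed
  then show ?thesis by blast
qed

section \<open>The positive semi-definite square root\<close>

lemma mat_vec_unit:
  assumes "finite I" "j \<in> I"
  shows "mat_vec_on I A (\<lambda>k. if k = j then 1 else 0) i = A i j"
proof -
  have "mat_vec_on I A (\<lambda>k. if k = j then 1 else 0) i = (\<Sum>k\<in>I. if k = j then A i k else 0)"
    unfolding mat_vec_on_def by (intro sum.cong) auto
  then show ?thesis using assms by simp
qed

text \<open>The eigenbasis of \<open>A\<close> is kept and the eigenvalues are replaced by their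
  square roots. Applied to a unit vector, \<open>S\<close> twice multiplies each coordinate by the
  eigenvalue of \<open>A\<close>, which is the corresponding column of \<open>A\<close>.\<close>

lemma psd_sqrt_exists:
  assumes I: "finite I" and A: "pos_semidef_on I A"
  shows "\<exists>S. pos_semidef_on I S \<and> (\<forall>i\<in>I. \<forall>j\<in>I. mat_mul_on I S S i j = A i j)
          \<and> (\<forall>i j. i \<notin> I \<or> j \<notin> I \<longrightarrow> S i j = 0)"
proof -
  have "hermitian_on I A" using A by (simp add: pos_semidef_on_def)
  from hermitian_eigenbasis_ex[OF I this] obtain e l where "hermitian_eigenbasis I A e l" .
  then interpret hermitian_eigenbasis I A e l .
  have l: "l a \<ge> 0" if "a < card I" for a
    using A that quad_form_eigenvector[OF that] by (metis pos_semidef_on_def)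
  define S where "S = (\<lambda>i j. if i \<in> I \<and> j \<in> I
    then \<Sum>a<card I. complex_of_real (sqrt (l a)) * e a i * cnj (e a j) else 0)"
  have S_vec: "mat_vec_on I S u i = (\<Sum>a<card I. complex_of_real (sqrt (l a)) * inner_on I u (e a) * e a i)"
    if "i \<in> I" for u i
  proof -
    have "mat_vec_on I S u i
        = (\<Sum>j\<in>I. \<Sum>a<card I. complex_of_real (sqrt (l a)) * e a i * (u j * cnj (e a j)))"
      using that by (auto simp: mat_vec_on_def S_def sum_distrib_left mult_ac intro!: sum.cong)
    also have "\<dots> = (\<Sum>a<card I. \<Sum>j\<in>I. complex_of_real (sqrt (l a)) * e a i * (u j * cnj (e a j)))"
      by (rule sum.swap)
    also have "\<dots> = (\<Sum>a<card I. complex_of_real (sqrt (l a)) * e a i * inner_on I u (e a))"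
      by (simp add: inner_on_def sum_distrib_left)
    finally show ?thesis by (simp add: mult_ac)
  qed
  have S_basis: "hermitian_eigenbasis I S e (\<lambda>a. sqrt (l a))"
  proof
    fix b i assume b: "b < card I" and i: "i \<in> I"
    have "mat_vec_on I S (e b) i = (\<Sum>a<card I. if a = b then complex_of_real (sqrt (l a)) * e a i else 0)"
      unfolding S_vec[OF i] using orthonormal b by (intro sum.cong) (auto simp: orthonormal_on_def)
    then show "mat_vec_on I S (e b) i = complex_of_real (sqrt (l b)) * e b i" using b by simp
  qed (use I orthonormal in auto)
  have "pos_semidef_on I S"
    unfolding pos_semidef_on_def hermitian_eigenbasis.quad_form_expansion[OF S_basis]
    using l by (auto simp: hermitian_on_def S_def mult_ac intro!: sum_nonneg)
  moreover have "mat_mul_on I S S i j = A i j" if i: "i \<in> I" and j: "j \<in> I" for i j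
  proof -
    define \<delta> where "\<delta> = (\<lambda>k. if k = j then 1 else (0::complex))"
    have "mat_mul_on I S S i j = mat_vec_on I (mat_mul_on I S S) \<delta> i"
      unfolding \<delta>_def mat_vec_unit[OF I j] ..
    also have "\<dots> = mat_vec_on I S (mat_vec_on I S \<delta>) i" by (simp add: mat_vec_on_mul)
    also have "\<dots> = (\<Sum>a<card I. complex_of_real (sqrt (l a)) * inner_on I (mat_vec_on I S \<delta>) (e a) * e a i)"
      by (rule S_vec[OF i])
    also have "\<dots> = (\<Sum>a<card I. complex_of_real (l a) * inner_on I \<delta> (e a) * e a i)"
    proof (intro sum.cong refl)
      fix a assume "a \<in> {..<card I}"
      then have a: "a < card I" by simp
      have "inner_on I (mat_vec_on I S \<delta>) (e a)
          = inner_on I (\<lambda>i. \<Sum>a<card I. complex_of_real (sqrt (l a)) * inner_on I \<delta> (e a) * e a i) (e a)"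
        by (intro inner_on_cong S_vec refl)
      also have "\<dots> = complex_of_real (sqrt (l a)) * inner_on I \<delta> (e a)"
        by (rule inner_combination[OF a])
      finally show "complex_of_real (sqrt (l a)) * inner_on I (mat_vec_on I S \<delta>) (e a) * e a i
          = complex_of_real (l a) * inner_on I \<delta> (e a) * e a i"
        using l[OF a] by (simp flip: of_real_mult mult.assoc)
    qed
    also have "\<dots> = mat_vec_on I A \<delta> i" by (rule mat_vec_expansion[OF i, symmetric])
    also have "\<dots> = A i j" unfolding \<delta>_def by (rule mat_vec_unit[OF I j])
    finally show ?thesis .
  qed
  ultimately show ?thesis by (intro exI[of _ S]) (auto simp: S_def)
qed

text \<open>If \<open>T v = \<tau> v\<close> and \<open>S\<^sup>2 = T\<^sup>2\<close>, then \<open>w = S v - \<tau> v\<close> satisfies \<open>S w = - \<tau> w\<close>, so \<open>w = 0\<close> unless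
  \<open>\<tau> = 0\<close>, and in that case \<open>\<parallel>S v\<parallel>\<^sup>2 = \<langle>S\<^sup>2 v, v\<rangle> = 0\<close>.\<close>

lemma psd_sqrt_unique:
  assumes I: "finite I" and S: "pos_semidef_on I S" and T: "pos_semidef_on I T"
    and eq: "\<forall>i\<in>I. \<forall>j\<in>I. mat_mul_on I S S i j = mat_mul_on I T T i j"
    and i: "i \<in> I" and j: "j \<in> I"
  shows "S i j = T i j"
proof -
  have hS: "hermitian_on I S" and hT: "hermitian_on I T"
    using S T by (auto simp: pos_semidef_on_def)
  from hermitian_eigenbasis_ex[OF I hT] obtain e l where "hermitian_eigenbasis I T e l" .
  then interpret hermitian_eigenbasis I T e l .
  have l: "l a \<ge> 0" if "a < card I" for a
    using T that quad_form_eigenvector[OF that] by (metis pos_semidef_on_def)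
  have sq: "mat_vec_on I S (mat_vec_on I S u) i = mat_vec_on I T (mat_vec_on I T u) i" if "i \<in> I" for u i
    using eq that unfolding mat_vec_on_mul[symmetric] by (simp add: mat_vec_on_def)
  have Se: "mat_vec_on I S (e a) i = complex_of_real (l a) * e a i" if a: "a < card I" and i: "i \<in> I" for a i
  proof -
    define Sv where "Sv = mat_vec_on I S (e a)"
    have SSv: "mat_vec_on I S Sv i = complex_of_real (l a * l a) * e a i" if "i \<in> I" for i
    proof -
      have "mat_vec_on I S Sv i = mat_vec_on I T (\<lambda>i. complex_of_real (l a) * e a i) i"
        unfolding Sv_def sq[OF that] by (intro fun_cong[OF mat_vec_on_cong] eigen a)
      then show ?thesis using that a by (simp add: mat_vec_on_scale eigen mult_ac)
    qed
    define w where "w = (\<lambda>i. Sv i + complex_of_real (- l a) * e a i)"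
    have "norm_sq_on I w = 0"
    proof (cases "l a = 0")
      case True
      have "complex_of_real (norm_sq_on I Sv) = inner_on I (e a) (mat_vec_on I S Sv)"
        unfolding inner_on_self[symmetric] by (subst Sv_def, rule inner_on_hermitian[OF hS])
      also have "\<dots> = inner_on I (e a) (\<lambda>i. 0)"
        using SSv True by (intro inner_on_cong) auto
      finally have "norm_sq_on I Sv = 0" by (simp add: inner_on_def)
      moreover have "w = Sv" using True by (simp add: w_def)
      ultimately show ?thesis by simp
    next
      case False
      then have la: "l a > 0" using l[OF a] by simp
      have Sw: "mat_vec_on I S w i = complex_of_real (- l a) * w i" if "i \<in> I" for i
        unfolding w_def mat_vec_on_add mat_vec_on_scale SSv[OF that] Sv_def[symmetric]
        by (simp add: algebra_simps)
      have "quad_form_on I S w = inner_on I (\<lambda>i. complex_of_real (- l a) * w i) w"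
        unfolding quad_form_eq_inner by (intro inner_on_cong Sw refl)
      also have "\<dots> = complex_of_real (- l a * norm_sq_on I w)"
        unfolding inner_on_scale_left inner_on_self by simp
      finally have "Re (quad_form_on I S w) = - l a * norm_sq_on I w"
        by (simp only: Re_complex_of_real)
      moreover have "0 \<le> Re (quad_form_on I S w)" using S by (simp add: pos_semidef_on_def)
      ultimately have "norm_sq_on I w \<le> 0" using la by (simp add: mult_le_0_iff)
      then show ?thesis using norm_sq_on_nonneg[of I w] by simp
    qed
    then have "w i = 0" using I i by (simp add: norm_sq_on_eq_0_iff)
    then show ?thesis by (simp add: w_def Sv_def)
  qed
  interpret S: hermitian_eigenbasis I S e l
    by unfold_locales (use I orthonormal Se in auto)
  define \<delta> where "\<delta> = (\<lambda>k. if k = j then 1 else (0::complex))"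
  have "S i j = mat_vec_on I S \<delta> i" unfolding \<delta>_def mat_vec_unit[OF I j] ..
  also have "\<dots> = mat_vec_on I T \<delta> i" unfolding mat_vec_expansion[OF i] S.mat_vec_expansion[OF i] ..
  also have "\<dots> = T i j" unfolding \<delta>_def mat_vec_unit[OF I j] ..
  finally show ?thesis .
qed

lemma
  assumes I: "finite I" and A: "pos_semidef_on I A"
  shows pos_semidef_psd_sqrt: "pos_semidef_on I (psd_sqrt_on I A)"
    and psd_sqrt_square: "\<And>i j. i \<in> I \<Longrightarrow> j \<in> I \<Longrightarrow> mat_mul_on I (psd_sqrt_on I A) (psd_sqrt_on I A) i j = A i j"
proof -
  let ?P = "\<lambda>S. pos_semidef_on I S \<and> (\<forall>i\<in>I. \<forall>j\<in>I. mat_mul_on I S S i j = A i j)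
          \<and> (\<forall>i j. i \<notin> I \<or> j \<notin> I \<longrightarrow> S i j = 0)"
  obtain S where S: "?P S" using psd_sqrt_exists[OF I A] by blast
  have "T = S" if T: "?P T" for T
  proof (intro ext)
    fix i j
    show "T i j = S i j"
    proof (cases "i \<in> I \<and> j \<in> I")
      case True
      have "\<forall>i\<in>I. \<forall>j\<in>I. mat_mul_on I T T i j = mat_mul_on I S S i j" using S T by simp
      then show ?thesis using psd_sqrt_unique[of I T S i j] I S T True by blast
    next
      case False
      then have "T i j = 0" "S i j = 0" using S T by blast+
      then show ?thesis by simp
    qed
  qed
  with S have "?P (psd_sqrt_on I A)" unfolding psd_sqrt_on_def by (rule theI[of ?P])
  then show "pos_semidef_on I (psd_sqrt_on I A)"
    and "\<And>i j. i \<in> I \<Longrightarrow> j \<in> I \<Longrightarrow> mat_mul_on I (psd_sqrt_on I A) (psd_sqrt_on I A) i j = A i j"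
    by blast+
qed

text \<open>One factor of the Hermitian root is moved across the inner product. This is how the root
  enters both sums of squares and (5.3): its zero set on a family of vectors is that of the
  quadratic form of \<open>A\<close>.\<close>

lemma norm_sq_psd_sqrt:
  assumes I: "finite I" and A: "pos_semidef_on I A"
  shows "norm_sq_on I (mat_vec_on I (psd_sqrt_on I A) u) = Re (quad_form_on I A u)"
proof -
  let ?S = "psd_sqrt_on I A"
  have "hermitian_on I ?S" using pos_semidef_psd_sqrt[OF assms] by (simp add: pos_semidef_on_def)
  from inner_on_hermitian[OF this]
  have "complex_of_real (norm_sq_on I (mat_vec_on I ?S u)) = inner_on I (mat_vec_on I ?S (mat_vec_on I ?S u)) u"
    by (simp add: inner_on_self[symmetric])
  also have "\<dots> = inner_on I (mat_vec_on I A u) u"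
    unfolding mat_vec_on_mul[symmetric]
    by (intro inner_on_cong refl) (simp add: mat_vec_on_def psd_sqrt_square[OF assms])
  finally show ?thesis by (simp add: quad_form_eq_inner) (metis Re_complex_of_real)
qed

text \<open>The strict inequality makes the \<open>a \<mu>\<close> linearly independent, so their
  Gram matrix \<open>G\<close> is invertible. Solving with \<open>G\<close> yields the coordinates
  \<open>xs u\<close> of the orthogonal projection of \<open>u\<close> onto the span, and
  \<open>L\<close> combines the \<open>b \<mu>\<close> with these coordinates.\<close>

lemma contraction_exists:
  assumes I: "finite I" and K: "finite K"
    and less: "\<And>x. \<exists>\<mu>\<in>K. x \<mu> \<noteq> 0 \<Longrightarrow>
      norm_sq_on J (\<lambda>j. \<Sum>\<mu>\<in>K. x \<mu> * b \<mu> j) < norm_sq_on I (\<lambda>i. \<Sum>\<mu>\<in>K. x \<mu> * a \<mu> i)"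
  shows "\<exists>L. (\<forall>u. norm_sq_on J (mat_vec_on I L u) \<le> norm_sq_on I u)
           \<and> (\<forall>\<mu>\<in>K. \<forall>j\<in>J. mat_vec_on I L (a \<mu>) j = b \<mu> j)"
proof -
  define G where "G = (\<lambda>\<nu> \<mu>. inner_on I (a \<mu>) (a \<nu>))"
  have G_vec: "mat_vec_on K G x \<nu> = inner_on I (\<lambda>i. \<Sum>\<mu>\<in>K. x \<mu> * a \<mu> i) (a \<nu>)" for x \<nu>
    by (simp add: mat_vec_on_def G_def inner_on_sum_left inner_on_scale_left mult.commute)
  have inner_comb: "inner_on I u (\<lambda>i. \<Sum>\<mu>\<in>K. x \<mu> * a \<mu> i) = (\<Sum>\<mu>\<in>K. inner_on I u (a \<mu>) * cnj (x \<mu>))" for u x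
  proof -
    have "inner_on I u (\<lambda>i. \<Sum>\<mu>\<in>K. x \<mu> * a \<mu> i) = cnj (\<Sum>\<mu>\<in>K. x \<mu> * inner_on I (a \<mu>) u)"
      by (subst inner_on_commute) (simp only: inner_on_sum_left inner_on_scale_left)
    also have "\<dots> = (\<Sum>\<mu>\<in>K. cnj (inner_on I (a \<mu>) u) * cnj (x \<mu>))"
      by (simp add: mult.commute)
    finally show ?thesis by (simp only: inner_on_commute[symmetric])
  qed
  have quadG: "quad_form_on K G x = complex_of_real (norm_sq_on I (\<lambda>i. \<Sum>\<mu>\<in>K. x \<mu> * a \<mu> i))" for x
    unfolding quad_form_on_def G_vec inner_on_self[symmetric] inner_comb ..
  have le: "norm_sq_on J (\<lambda>j. \<Sum>\<mu>\<in>K. x \<mu> * b \<mu> j) \<le> norm_sq_on I (\<lambda>i. \<Sum>\<mu>\<in>K. x \<mu> * a \<mu> i)" for x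
  proof (cases "\<exists>\<mu>\<in>K. x \<mu> \<noteq> 0")
    case True
    then show ?thesis using less[of x] by simp
  next
    case False
    then show ?thesis by (simp add: norm_sq_on_def)
  qed
  have G: "pos_def_on K G"
    unfolding pos_def_on_def
  proof (intro conjI allI impI)
    show "hermitian_on K G" by (simp add: hermitian_on_def G_def inner_on_commute[symmetric])
    fix x :: "'b \<Rightarrow> complex" assume "\<exists>\<mu>\<in>K. x \<mu> \<noteq> 0"
    from less[OF this] show "0 < Re (quad_form_on K G x)"
      using norm_sq_on_nonneg[of J "\<lambda>j. \<Sum>\<mu>\<in>K. x \<mu> * b \<mu> j"] unfolding quadG by simp
  qed
  have "\<forall>i. \<exists>x. \<forall>\<nu>\<in>K. mat_vec_on K G x \<nu> = cnj (a \<nu> i)"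
    by (intro allI pos_def_solvable[OF K G])
  \<comment> \<open>\<open>X i\<close> contains the coordinates, with respect to the
    \<open>a \<mu>\<close>, of the projection of the unit vector at \<open>i\<close>; by linearity
    \<open>xs u\<close> contains those of the projection of \<open>u\<close>.\<close>
  from choice[OF this] obtain X where "\<forall>i. \<forall>\<nu>\<in>K. mat_vec_on K G (X i) \<nu> = cnj (a \<nu> i)" ..
  then have X: "mat_vec_on K G (X i) \<nu> = cnj (a \<nu> i)" if "\<nu> \<in> K" for i \<nu> using that by blast
  define xs where "xs = (\<lambda>u \<mu>. \<Sum>i\<in>I. u i * X i \<mu>)"
  have xs: "mat_vec_on K G (xs u) \<nu> = inner_on I u (a \<nu>)" if "\<nu> \<in> K" for u \<nu>
    unfolding xs_def mat_vec_on_sum mat_vec_on_scale inner_on_def using X[OF that] by simp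
  define L where "L = (\<lambda>j i. \<Sum>\<mu>\<in>K. b \<mu> j * X i \<mu>)"
  have L: "mat_vec_on I L u j = (\<Sum>\<mu>\<in>K. xs u \<mu> * b \<mu> j)" for u j
  proof -
    have "mat_vec_on I L u j = (\<Sum>i\<in>I. \<Sum>\<mu>\<in>K. b \<mu> j * X i \<mu> * u i)"
      by (simp add: mat_vec_on_def L_def sum_distrib_right)
    also have "\<dots> = (\<Sum>\<mu>\<in>K. \<Sum>i\<in>I. b \<mu> j * X i \<mu> * u i)" by (rule sum.swap)
    also have "\<dots> = (\<Sum>\<mu>\<in>K. xs u \<mu> * b \<mu> j)"
      unfolding xs_def sum_distrib_right by (intro sum.cong refl) (simp add: mult_ac)
    finally show ?thesis .
  qed
  have "norm_sq_on J (mat_vec_on I L u) \<le> norm_sq_on I u" for u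
  proof -
    \<comment> \<open>\<open>y\<close> is the projection of \<open>u\<close>. From ||y||^2 = <u, y>
      and the Cauchy-Schwarz inequality follows ||y|| \<le> ||u||.\<close>
    define y where "y = (\<lambda>i. \<Sum>\<mu>\<in>K. xs u \<mu> * a \<mu> i)"
    have "complex_of_real (norm_sq_on I y) = quad_form_on K G (xs u)" unfolding quadG y_def ..
    also have "\<dots> = (\<Sum>\<mu>\<in>K. inner_on I u (a \<mu>) * cnj (xs u \<mu>))"
      unfolding quad_form_on_def by (intro sum.cong refl) (simp add: xs)
    also have "\<dots> = inner_on I u y" unfolding y_def inner_comb ..
    finally have "norm_sq_on I y = cmod (inner_on I u y)"
      using norm_sq_on_nonneg[of I y] by (metis norm_of_real abs_of_nonneg)
    also have "\<dots> \<le> sqrt (norm_sq_on I u) * sqrt (norm_sq_on I y)" by (rule cmod_inner_on_le)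
    finally have *: "sqrt (norm_sq_on I y) * sqrt (norm_sq_on I y) \<le> sqrt (norm_sq_on I u) * sqrt (norm_sq_on I y)"
      using norm_sq_on_nonneg[of I y] by simp
    have "norm_sq_on I y \<le> norm_sq_on I u"
    proof (cases "norm_sq_on I y = 0")
      case True
      then show ?thesis using norm_sq_on_nonneg[of I u] by simp
    next
      case False
      then have "sqrt (norm_sq_on I y) > 0" using norm_sq_on_nonneg[of I y] by simp
      from mult_right_le_imp_le[OF * this] show ?thesis by simp
    qed
    moreover have "norm_sq_on J (mat_vec_on I L u) \<le> norm_sq_on I y"
      unfolding y_def using le[of "xs u"] by (simp add: norm_sq_on_def L)
    ultimately show ?thesis by simp
  qed
  moreover have "mat_vec_on I L (a \<kappa>) j = b \<kappa> j" if \<kappa>: "\<kappa> \<in> K" for \<kappa> j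
  proof -
    define \<delta> where "\<delta> = (\<lambda>\<mu>. if \<mu> = \<kappa> then 1 else (0::complex))"
    have G\<delta>: "mat_vec_on K G \<delta> \<nu> = inner_on I (a \<kappa>) (a \<nu>)" for \<nu>
      unfolding \<delta>_def mat_vec_unit[OF K \<kappa>] G_def ..
    \<comment> \<open>The computed coordinates of \<open>a \<kappa>\<close> minus the evident ones.
      The difference lies in the kernel of \<open>G\<close>, so it vanishes on
      \<open>K\<close>.\<close>
    define x where "x = (\<lambda>\<mu>. xs (a \<kappa>) \<mu> + (- 1) * \<delta> \<mu>)"
    have "mat_vec_on K G x \<nu> = 0" if "\<nu> \<in> K" for \<nu>
      unfolding x_def mat_vec_on_add mat_vec_on_scale using that by (simp add: xs G\<delta>)
    then have "quad_form_on K G x = 0" by (simp add: quad_form_on_def)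
    then have "\<forall>\<mu>\<in>K. x \<mu> = 0" using pos_def_onD[OF G, of x] by auto
    then have "mat_vec_on I L (a \<kappa>) j = (\<Sum>\<mu>\<in>K. if \<mu> = \<kappa> then b \<mu> j else 0)"
      unfolding L by (intro sum.cong) (auto simp: x_def \<delta>_def)
    then show ?thesis using K \<kappa> by simp
  qed
  ultimately show ?thesis by blast
qed

lemma quad_form_id_minus_adj:
  assumes I: "finite I"
  shows "quad_form_on I (\<lambda>i k. mat_id i k - mat_mul_on J (mat_adj L) L i k) u
    = complex_of_real (norm_sq_on I u - norm_sq_on J (mat_vec_on I L u))"
proof -
  have "mat_vec_on I (\<lambda>i k. mat_id i k - mat_mul_on J (mat_adj L) L i k) u i
      = u i - mat_vec_on J (mat_adj L) (mat_vec_on I L u) i" if "i \<in> I" for i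
  proof -
    have "(\<Sum>k\<in>I. mat_id i k * u k) = (\<Sum>k\<in>I. if k = i then u k else 0)"
      by (intro sum.cong) (auto simp: mat_id_def)
    then have "(\<Sum>k\<in>I. mat_id i k * u k) = u i" using I that by simp
    then show ?thesis
      unfolding mat_vec_on_mul[symmetric] by (simp add: mat_vec_on_def left_diff_distrib sum_subtractf)
  qed
  then have "quad_form_on I (\<lambda>i k. mat_id i k - mat_mul_on J (mat_adj L) L i k) u
      = inner_on I (\<lambda>i. u i - mat_vec_on J (mat_adj L) (mat_vec_on I L u) i) u"
    unfolding quad_form_eq_inner by (intro inner_on_cong) auto
  also have "\<dots> = inner_on I u u - cnj (inner_on I u (mat_vec_on J (mat_adj L) (mat_vec_on I L u)))"
    unfolding inner_on_diff_left inner_on_commute[symmetric] ..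
  also have "\<dots> = inner_on I u u - cnj (inner_on J (mat_vec_on I L u) (mat_vec_on I L u))"
    unfolding inner_on_mat_adj ..
  finally show ?thesis by (simp add: inner_on_self)
qed

lemma pos_semidef_id_minus_adj_iff:
  assumes I: "finite I"
  shows "pos_semidef_on I (\<lambda>i k. mat_id i k - mat_mul_on J (mat_adj L) L i k)
    \<longleftrightarrow> (\<forall>u. norm_sq_on J (mat_vec_on I L u) \<le> norm_sq_on I u)"
proof -
  have "hermitian_on I (\<lambda>i k. mat_id i k - mat_mul_on J (mat_adj L) L i k)"
    by (auto simp: hermitian_on_def mat_id_def mat_mul_on_def mat_adj_def mult.commute)
  then show ?thesis
    by (simp add: pos_semidef_on_def quad_form_id_minus_adj[OF I])
qed

section \<open>Multi-indices and bihomogeneous polynomials\<close>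

abbreviation madd :: "('n \<Rightarrow> nat) \<Rightarrow> ('n \<Rightarrow> nat) \<Rightarrow> 'n \<Rightarrow> nat" where
  "madd \<alpha> \<beta> \<equiv> (\<lambda>j. \<alpha> j + \<beta> j)"

lemma finite_multi_indices [simp]: "finite (multi_indices k :: ('n::finite \<Rightarrow> nat) set)"
proof (rule finite_subset)
  show "multi_indices k \<subseteq> PiE (UNIV :: 'n set) (\<lambda>_. {..k})"
  proof
    fix \<alpha> :: "'n \<Rightarrow> nat" assume "\<alpha> \<in> multi_indices k"
    then have "\<alpha> j \<le> k" for j
      unfolding multi_indices_def using member_le_sum[of j UNIV \<alpha>] by simp
    then show "\<alpha> \<in> PiE UNIV (\<lambda>_. {..k})" by auto
  qed
qed (simp add: finite_PiE)

lemma madd_multi_indices: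
  "\<alpha> \<in> multi_indices a \<Longrightarrow> \<beta> \<in> multi_indices b \<Longrightarrow> madd \<alpha> \<beta> \<in> multi_indices (a + b)"
  by (simp add: multi_indices_def sum.distrib)

lemma diff_multi_indices:
  assumes "\<mu> \<in> multi_indices (a + b)" "\<beta> \<in> multi_indices b" "\<forall>j. \<beta> j \<le> \<mu> j"
  shows "(\<lambda>j. \<mu> j - \<beta> j) \<in> multi_indices a"
  using assms by (simp add: multi_indices_def sum_subtractf_nat)

lemma mpow_madd: "mpow z (madd \<alpha> \<beta>) = mpow z \<alpha> * mpow z \<beta>"
  by (simp add: mpow_def power_add prod.distrib)

lemma mfact_pos: "mfact \<alpha> > 0"
  by (simp add: mfact_def prod_pos)

text \<open>The substitution \<mu> = \<gamma> + \<alpha> is a bijection from the \<alpha> of degree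
  m onto those \<mu> of degree m + d that dominate \<gamma>. The guard discards the \<mu> for which
  truncated subtraction would produce a spurious term.\<close>

lemma sum_shift_multi_indices:
  fixes Y :: "('n::finite \<Rightarrow> nat) \<Rightarrow> ('n \<Rightarrow> nat) \<Rightarrow> complex"
  assumes "\<gamma> \<in> multi_indices d"
  shows "(\<Sum>\<mu>\<in>multi_indices (m + d). if \<forall>j. \<gamma> j \<le> \<mu> j then Y (\<lambda>j. \<mu> j - \<gamma> j) \<mu> else 0)
       = (\<Sum>\<alpha>\<in>multi_indices m. Y \<alpha> (madd \<gamma> \<alpha>))"
proof -
  have "(\<Sum>\<mu>\<in>multi_indices (m + d). if \<forall>j. \<gamma> j \<le> \<mu> j then Y (\<lambda>j. \<mu> j - \<gamma> j) \<mu> else 0)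
      = (\<Sum>\<mu>\<in>{\<mu>\<in>multi_indices (m + d). \<forall>j. \<gamma> j \<le> \<mu> j}. Y (\<lambda>j. \<mu> j - \<gamma> j) \<mu>)"
    by (simp add: sum.inter_filter)
  also have "\<dots> = (\<Sum>\<alpha>\<in>multi_indices m. Y \<alpha> (madd \<gamma> \<alpha>))"
    using assms
    by (intro sum.reindex_bij_witness[of _ "\<lambda>\<alpha>. madd \<gamma> \<alpha>" "\<lambda>\<mu> j. \<mu> j - \<gamma> j"])
       (auto simp: diff_multi_indices madd_multi_indices add.commute[of m])
  finally show ?thesis .
qed

text \<open>In the induction step d + 1 is written as the sum of the \<gamma>_i, so the coefficient
  (d + 1)! / \<gamma>! splits into terms d! \<gamma>_i / \<gamma>!. Lowering \<gamma>_i by one turns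
  the i-th term into x_i times a term of the expansion for d.\<close>

lemma multinomial_theorem:
  fixes x :: "'n::finite \<Rightarrow> complex"
  shows "(\<Sum>j\<in>UNIV. x j) ^ d
       = (\<Sum>\<gamma>\<in>multi_indices d. fact d / of_nat (mfact \<gamma>) * (\<Prod>j\<in>UNIV. x j ^ \<gamma> j))"
proof (induction d)
  case 0
  have "multi_indices 0 = {\<lambda>_::'n. 0}" by (auto simp: multi_indices_def)
  then show ?case by (simp add: mfact_def)
next
  case (Suc d)
  define t where "t = (\<lambda>\<gamma>. \<Prod>j\<in>UNIV. x j ^ \<gamma> j)"
  define \<delta> where "\<delta> = (\<lambda>i j::'n. if j = i then 1 else (0::nat))"
  have \<delta>: "\<delta> i \<in> multi_indices 1" for i by (simp add: \<delta>_def multi_indices_def)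
  have t_add: "t (madd (\<delta> i) \<alpha>) = x i * t \<alpha>" for i \<alpha>
  proof -
    have "(\<Prod>j\<in>UNIV. x j ^ \<delta> i j) = (\<Prod>j\<in>UNIV. if j = i then x j else 1)"
      by (intro prod.cong) (auto simp: \<delta>_def)
    then show ?thesis by (simp add: t_def power_add prod.distrib)
  qed
  have mfact_add: "mfact (madd (\<delta> i) \<alpha>) = Suc (\<alpha> i) * mfact \<alpha>" for i \<alpha>
  proof -
    have "mfact (madd (\<delta> i) \<alpha>) = (\<Prod>j\<in>UNIV. (if j = i then Suc (\<alpha> j) else 1) * fact (\<alpha> j))"
      unfolding mfact_def by (intro prod.cong) (auto simp: \<delta>_def)
    then show ?thesis by (simp add: prod.distrib mfact_def)
  qed
  have "(\<Sum>\<gamma>\<in>multi_indices (Suc d). fact (Suc d) / of_nat (mfact \<gamma>) * t \<gamma>)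
      = (\<Sum>\<gamma>\<in>multi_indices (Suc d). \<Sum>i\<in>UNIV. fact d * of_nat (\<gamma> i) / of_nat (mfact \<gamma>) * t \<gamma>)"
  proof (intro sum.cong refl)
    fix \<gamma> :: "'n \<Rightarrow> nat" assume "\<gamma> \<in> multi_indices (Suc d)"
    then have "(of_nat (Suc d) :: complex) = (\<Sum>i\<in>UNIV. of_nat (\<gamma> i))"
      by (simp add: multi_indices_def flip: of_nat_sum)
    then show "fact (Suc d) / of_nat (mfact \<gamma>) * t \<gamma>
        = (\<Sum>i\<in>UNIV. fact d * of_nat (\<gamma> i) / of_nat (mfact \<gamma>) * t \<gamma>)"
      by (simp add: sum_distrib_right[symmetric] sum_divide_distrib[symmetric]
          sum_distrib_left[symmetric] mult_ac del: of_nat_Suc)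
  qed
  also have "\<dots> = (\<Sum>i\<in>UNIV. \<Sum>\<gamma>\<in>multi_indices (Suc d). fact d * of_nat (\<gamma> i) / of_nat (mfact \<gamma>) * t \<gamma>)"
    by (rule sum.swap)
  also have "\<dots> = (\<Sum>i\<in>UNIV. \<Sum>\<alpha>\<in>multi_indices d. fact d / of_nat (mfact \<alpha>) * (x i * t \<alpha>))"
  proof (rule sum.cong[OF refl])
    fix i :: 'n
    have "(\<Sum>\<gamma>\<in>multi_indices (Suc d). fact d * of_nat (\<gamma> i) / of_nat (mfact \<gamma>) * t \<gamma>)
        = (\<Sum>\<gamma>\<in>multi_indices (d + 1). if \<forall>j. \<delta> i j \<le> \<gamma> j
             then fact d * of_nat (\<gamma> i) / of_nat (mfact \<gamma>) * t \<gamma> else 0)"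
      by (intro sum.cong) (auto simp: \<delta>_def Suc_le_eq)
    also have "\<dots> = (\<Sum>\<alpha>\<in>multi_indices d. fact d * of_nat (madd (\<delta> i) \<alpha> i)
        / of_nat (mfact (madd (\<delta> i) \<alpha>)) * t (madd (\<delta> i) \<alpha>))"
      by (rule sum_shift_multi_indices[OF \<delta>])
    also have "\<dots> = (\<Sum>\<alpha>\<in>multi_indices d. fact d / of_nat (mfact \<alpha>) * (x i * t \<alpha>))"
    proof (intro sum.cong refl)
      fix \<alpha> :: "'n \<Rightarrow> nat"
      have "of_nat (Suc (\<alpha> i)) \<noteq> (0::complex)" by (simp del: of_nat_Suc)
      then show "fact d * of_nat (madd (\<delta> i) \<alpha> i) / of_nat (mfact (madd (\<delta> i) \<alpha>)) * t (madd (\<delta> i) \<alpha>)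
          = fact d / of_nat (mfact \<alpha>) * (x i * t \<alpha>)"
        unfolding t_add mfact_add of_nat_mult by (simp add: \<delta>_def del: of_nat_Suc)
    qed
    finally show "(\<Sum>\<gamma>\<in>multi_indices (Suc d). fact d * of_nat (\<gamma> i) / of_nat (mfact \<gamma>) * t \<gamma>)
        = (\<Sum>\<alpha>\<in>multi_indices d. fact d / of_nat (mfact \<alpha>) * (x i * t \<alpha>))" .
  qed
  also have "\<dots> = (\<Sum>i\<in>UNIV. x i) * (\<Sum>\<alpha>\<in>multi_indices d. fact d / of_nat (mfact \<alpha>) * t \<alpha>)"
    by (simp add: sum_product mult_ac)
  finally show ?case using Suc.IH by (simp add: t_def)
qed

section \<open>Coefficients after multiplication by a power of the Hermitian product\<close>

lemma herm_inner_power: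
  "herm_inner z \<zeta> ^ d = (\<Sum>\<gamma>\<in>multi_indices d. fact d / of_nat (mfact \<gamma>) * (mpow z \<gamma> * cnj (mpow \<zeta> \<gamma>)))"
  unfolding herm_inner_def multinomial_theorem mpow_def
  by (simp add: power_mult_distrib prod.distrib)

lemma herm_inner_self: "herm_inner z z = complex_of_real ((norm z)\<^sup>2)"
  by (simp add: herm_inner_def norm_vec_def L2_set_def sum_nonneg complex_norm_square del: of_real_power)

text \<open>The coefficient matrix of <z, \<zeta>>^d f(z, \<zeta>), with conjugated \<zeta>: each
  term d!/\<gamma>! z^\<gamma> of the multinomial expansion, with its conjugate partner, shifts both
  indices of \<open>c\<close> by the same \<gamma>.\<close>

definition lift_coeff ::
  "nat \<Rightarrow> (('n::finite \<Rightarrow> nat) \<Rightarrow> ('n \<Rightarrow> nat) \<Rightarrow> complex) \<Rightarrow> ('n \<Rightarrow> nat) \<Rightarrow> ('n \<Rightarrow> nat) \<Rightarrow> complex" where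
  "lift_coeff d c \<mu> \<nu> = (\<Sum>\<gamma>\<in>multi_indices d. fact d / of_nat (mfact \<gamma>) *
     (if (\<forall>j. \<gamma> j \<le> \<mu> j) \<and> (\<forall>j. \<gamma> j \<le> \<nu> j) then c (\<lambda>j. \<mu> j - \<gamma> j) (\<lambda>j. \<nu> j - \<gamma> j) else 0))"

text \<open>The test function \<open>F\<close> is arbitrary so that one reindexing serves two
  purposes: products of monomials give the value of the lifted polynomial, products of vector
  entries its quadratic form.\<close>

lemma sum_lift_coeff:
  fixes F :: "('n::finite \<Rightarrow> nat) \<Rightarrow> ('n \<Rightarrow> nat) \<Rightarrow> complex"
  shows "(\<Sum>\<mu>\<in>multi_indices (m + d). \<Sum>\<nu>\<in>multi_indices (m + d). lift_coeff d c \<mu> \<nu> * F \<mu> \<nu>)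
    = (\<Sum>\<gamma>\<in>multi_indices d. fact d / of_nat (mfact \<gamma>) *
        (\<Sum>\<alpha>\<in>multi_indices m. \<Sum>\<beta>\<in>multi_indices m. c \<alpha> \<beta> * F (madd \<gamma> \<alpha>) (madd \<gamma> \<beta>)))"
proof -
  let ?M = "multi_indices (m + d) :: ('n \<Rightarrow> nat) set"
  define w where "w = (\<lambda>\<gamma>::'n \<Rightarrow> nat. fact d / of_nat (mfact \<gamma>) :: complex)"
  define g where "g = (\<lambda>\<gamma> \<mu> \<nu>. w \<gamma> *
     (if (\<forall>j. \<gamma> j \<le> \<mu> j) \<and> (\<forall>j. \<gamma> j \<le> \<nu> j) then c (\<lambda>j. \<mu> j - \<gamma> j) (\<lambda>j. \<nu> j - \<gamma> j) else 0) * F \<mu> \<nu>)"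
  have "(\<Sum>\<mu>\<in>?M. \<Sum>\<nu>\<in>?M. lift_coeff d c \<mu> \<nu> * F \<mu> \<nu>) = (\<Sum>\<mu>\<in>?M. \<Sum>\<nu>\<in>?M. \<Sum>\<gamma>\<in>multi_indices d. g \<gamma> \<mu> \<nu>)"
    unfolding lift_coeff_def g_def w_def sum_distrib_right ..
  also have "\<dots> = (\<Sum>\<mu>\<in>?M. \<Sum>\<gamma>\<in>multi_indices d. \<Sum>\<nu>\<in>?M. g \<gamma> \<mu> \<nu>)"
    by (intro sum.cong refl sum.swap)
  also have "\<dots> = (\<Sum>\<gamma>\<in>multi_indices d. \<Sum>\<mu>\<in>?M. \<Sum>\<nu>\<in>?M. g \<gamma> \<mu> \<nu>)"
    by (rule sum.swap)
  also have "\<dots> = (\<Sum>\<gamma>\<in>multi_indices d. w \<gamma> *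
        (\<Sum>\<alpha>\<in>multi_indices m. \<Sum>\<beta>\<in>multi_indices m. c \<alpha> \<beta> * F (madd \<gamma> \<alpha>) (madd \<gamma> \<beta>)))"
  proof (intro sum.cong refl)
    fix \<gamma> :: "'n \<Rightarrow> nat" assume \<gamma>: "\<gamma> \<in> multi_indices d"
    define Y where "Y = (\<lambda>\<alpha> \<mu>. \<Sum>\<nu>\<in>?M. if \<forall>j. \<gamma> j \<le> \<nu> j then c \<alpha> (\<lambda>j. \<nu> j - \<gamma> j) * F \<mu> \<nu> else 0)"
    have Y: "Y \<alpha> \<mu> = (\<Sum>\<beta>\<in>multi_indices m. c \<alpha> \<beta> * F \<mu> (madd \<gamma> \<beta>))" for \<alpha> \<mu>
      unfolding Y_def by (rule sum_shift_multi_indices[OF \<gamma>])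
    have "(\<Sum>\<mu>\<in>?M. \<Sum>\<nu>\<in>?M. g \<gamma> \<mu> \<nu>) = w \<gamma> * (\<Sum>\<mu>\<in>?M. if \<forall>j. \<gamma> j \<le> \<mu> j then Y (\<lambda>j. \<mu> j - \<gamma> j) \<mu> else 0)"
      unfolding sum_distrib_left
    proof (intro sum.cong refl)
      fix \<mu>
      show "(\<Sum>\<nu>\<in>?M. g \<gamma> \<mu> \<nu>) = w \<gamma> * (if \<forall>j. \<gamma> j \<le> \<mu> j then Y (\<lambda>j. \<mu> j - \<gamma> j) \<mu> else 0)"
      proof (cases "\<forall>j. \<gamma> j \<le> \<mu> j")
        case True
        then show ?thesis by (auto simp: g_def Y_def sum_distrib_left intro!: sum.cong)
      next
        case False
        then have "g \<gamma> \<mu> \<nu> = 0" for \<nu> unfolding g_def by auto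
        then show ?thesis using False by auto
      qed
    qed
    also have "\<dots> = w \<gamma> * (\<Sum>\<alpha>\<in>multi_indices m. Y \<alpha> (madd \<gamma> \<alpha>))"
      by (simp only: sum_shift_multi_indices[OF \<gamma>])
    finally show "(\<Sum>\<mu>\<in>?M. \<Sum>\<nu>\<in>?M. g \<gamma> \<mu> \<nu>) = w \<gamma> *
        (\<Sum>\<alpha>\<in>multi_indices m. \<Sum>\<beta>\<in>multi_indices m. c \<alpha> \<beta> * F (madd \<gamma> \<alpha>) (madd \<gamma> \<beta>))"
      unfolding Y .
  qed
  finally show ?thesis by (simp only: w_def)
qed

lemma bihom_poly_lift_coeff:
  "bihom_poly (m + d) (lift_coeff d c) z \<zeta> = herm_inner z \<zeta> ^ d * bihom_poly m c z \<zeta>"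
proof -
  have "bihom_poly (m + d) (lift_coeff d c) z \<zeta>
      = (\<Sum>\<gamma>\<in>multi_indices d. fact d / of_nat (mfact \<gamma>) *
        (\<Sum>\<alpha>\<in>multi_indices m. \<Sum>\<beta>\<in>multi_indices m. c \<alpha> \<beta> * (mpow z (madd \<gamma> \<alpha>) * cnj (mpow \<zeta> (madd \<gamma> \<beta>)))))"
    unfolding bihom_poly_def mult.assoc by (rule sum_lift_coeff)
  also have "\<dots> = (\<Sum>\<gamma>\<in>multi_indices d. fact d / of_nat (mfact \<gamma>) *
        (mpow z \<gamma> * cnj (mpow \<zeta> \<gamma>) * bihom_poly m c z \<zeta>))"
    unfolding bihom_poly_def sum_distrib_left mpow_madd by (simp add: mult_ac)
  finally show ?thesis
    unfolding herm_inner_power sum_distrib_right by (simp add: mult.assoc)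
qed

lemma hermitian_lift_coeff:
  fixes c :: "('n::finite \<Rightarrow> nat) \<Rightarrow> ('n \<Rightarrow> nat) \<Rightarrow> complex"
  assumes "hermitian_on (multi_indices m) c"
  shows "hermitian_on (multi_indices (m + d)) (lift_coeff d c)"
proof -
  have c: "c \<beta> \<alpha> = cnj (c \<alpha> \<beta>)" if "\<alpha> \<in> multi_indices m" "\<beta> \<in> multi_indices m" for \<alpha> \<beta>
    using assms that unfolding hermitian_on_def by blast
  have "lift_coeff d c \<nu> \<mu> = cnj (lift_coeff d c \<mu> \<nu>)"
    if "\<mu> \<in> multi_indices (m + d)" "\<nu> \<in> multi_indices (m + d)" for \<mu> \<nu>
    unfolding lift_coeff_def cnj_sum complex_cnj_mult
  proof (rule sum.cong[OF refl])
    fix \<gamma> :: "'n \<Rightarrow> nat" assume \<gamma>: "\<gamma> \<in> multi_indices d"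
    have "(if (\<forall>j. \<gamma> j \<le> \<nu> j) \<and> (\<forall>j. \<gamma> j \<le> \<mu> j) then c (\<lambda>j. \<nu> j - \<gamma> j) (\<lambda>j. \<mu> j - \<gamma> j) else 0)
        = cnj (if (\<forall>j. \<gamma> j \<le> \<mu> j) \<and> (\<forall>j. \<gamma> j \<le> \<nu> j) then c (\<lambda>j. \<mu> j - \<gamma> j) (\<lambda>j. \<nu> j - \<gamma> j) else 0)"
      using c[OF diff_multi_indices[OF that(1) \<gamma>] diff_multi_indices[OF that(2) \<gamma>]] by auto
    then show "fact d / of_nat (mfact \<gamma>) *
        (if (\<forall>j. \<gamma> j \<le> \<nu> j) \<and> (\<forall>j. \<gamma> j \<le> \<mu> j) then c (\<lambda>j. \<nu> j - \<gamma> j) (\<lambda>j. \<mu> j - \<gamma> j) else 0)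
      = cnj (fact d / of_nat (mfact \<gamma>)) *
        cnj (if (\<forall>j. \<gamma> j \<le> \<mu> j) \<and> (\<forall>j. \<gamma> j \<le> \<nu> j) then c (\<lambda>j. \<mu> j - \<gamma> j) (\<lambda>j. \<nu> j - \<gamma> j) else 0)"
      by (simp only: complex_cnj_divide complex_cnj_fact complex_cnj_of_nat)
  qed
  then show ?thesis unfolding hermitian_on_def by blast
qed

section \<open>Polarization\<close>

lemma infinite_unit_circle: "infinite {\<omega>::complex. cmod \<omega> = 1}"
proof
  assume fin: "finite {\<omega>::complex. cmod \<omega> = 1}"
  have "(\<lambda>x. Complex x (sqrt (1 - x\<^sup>2))) ` {0..1} \<subseteq> {\<omega>. cmod \<omega> = 1}"
    by (auto simp: cmod_def abs_square_le_1 power_le_one)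
  moreover have "inj_on (\<lambda>x. Complex x (sqrt (1 - x\<^sup>2))) {0..1}" by (auto simp: inj_on_def)
  ultimately have "finite {0..1::real}" using fin by (meson finite_imageD finite_subset)
  then show False using infinite_Icc[of 0 "1::real"] by simp
qed

text \<open>A polynomial with infinitely many roots is zero. Several \<open>s\<close> may share an
  exponent, so only the sum of the \<open>C s\<close> over each exponent is determined.\<close>

lemma sum_monomials_vanish:
  fixes C :: "'s \<Rightarrow> complex"
  assumes S: "finite S" and X: "infinite X" "\<And>x. x \<in> X \<Longrightarrow> (\<Sum>s\<in>S. C s * x ^ a s) = 0"
  shows "(\<Sum>s\<in>{s\<in>S. a s = k}. C s) = 0"
proof -
  define p where "p = (\<Sum>s\<in>S. monom (C s) (a s))"
  have "poly p x = 0" if "x \<in> X" for x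
    using X(2)[OF that] by (simp add: p_def poly_sum poly_monom)
  then have "p = 0" using X(1) poly_roots_finite[of p] by (meson finite_subset mem_Collect_eq subsetI)
  then have "(\<Sum>s\<in>S. if a s = k then C s else 0) = 0"
    using coeff_sum[of "\<lambda>s. monom (C s) (a s)" S k] by (simp add: p_def)
  then show ?thesis using S by (simp add: sum.inter_filter)
qed

text \<open>In polar coordinates \<open>t = r \<omega>\<close> a monomial is \<open>r\<^bsup>a+b\<^esup> \<omega>\<^bsup>a-b\<^esup>\<close>; comparing powers of \<open>r\<close> and then of \<open>\<omega>\<close>
  isolates each pair \<open>(a, b)\<close>.\<close>

lemma polarization_one_variable:
  fixes C :: "'s \<Rightarrow> complex"
  assumes S: "finite S" and 0: "\<And>t. (\<Sum>s\<in>S. C s * t ^ a s * cnj t ^ b s) = 0"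
  shows "(\<Sum>s\<in>S. C s * x ^ a s * y ^ b s) = 0"
proof -
  have coeff0: "(\<Sum>s\<in>{s\<in>S. a s = i \<and> b s = k}. C s) = 0" for i k
  proof -
    have circle: "(\<Sum>s\<in>{s\<in>S. a s + b s = i + k}. C s * (\<omega>\<^sup>2) ^ a s) = 0" if \<omega>: "cmod \<omega> = 1" for \<omega>
    proof -
      have \<omega>1: "cnj \<omega> * \<omega> = 1" using \<omega> by (metis complex_norm_square mult.commute of_real_1 one_power2)
      have "(\<Sum>s\<in>S. C s * \<omega> ^ a s * cnj \<omega> ^ b s * x ^ (a s + b s)) = 0" if "x \<in> range complex_of_real" for x
        using that 0[of "x * \<omega>"] by (auto simp: power_mult_distrib power_add mult_ac)
      moreover have "infinite (range complex_of_real)"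
        by (simp add: finite_image_iff inj_on_def infinite_UNIV_char_0)
      ultimately have "(\<Sum>s\<in>{s\<in>S. a s + b s = i + k}. C s * \<omega> ^ a s * cnj \<omega> ^ b s) = 0"
        using sum_monomials_vanish[OF S, of _ "\<lambda>s. C s * \<omega> ^ a s * cnj \<omega> ^ b s" "\<lambda>s. a s + b s"] by blast
      \<comment> \<open>On the circle with a + b = i + k, multiplying by the power i + k of \<omega>
        turns the exponent a - b, possibly negative, into 2 a. The polynomial lemma then applies
        with the exponents 2 a.\<close>
      then have "(\<Sum>s\<in>{s\<in>S. a s + b s = i + k}. C s * \<omega> ^ a s * cnj \<omega> ^ b s) * \<omega> ^ (i + k) = 0" by simp
      moreover have "(\<Sum>s\<in>{s\<in>S. a s + b s = i + k}. C s * \<omega> ^ a s * cnj \<omega> ^ b s) * \<omega> ^ (i + k)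
          = (\<Sum>s\<in>{s\<in>S. a s + b s = i + k}. C s * (\<omega>\<^sup>2) ^ a s)"
        unfolding sum_distrib_right
      proof (intro sum.cong refl)
        fix s assume "s \<in> {s\<in>S. a s + b s = i + k}"
        then have "\<omega> ^ (i + k) = \<omega> ^ a s * \<omega> ^ b s" by (auto simp flip: power_add)
        then have "C s * \<omega> ^ a s * cnj \<omega> ^ b s * \<omega> ^ (i + k)
            = C s * (\<omega> * \<omega>) ^ a s * (cnj \<omega> * \<omega>) ^ b s"
          by (simp only: power_mult_distrib mult_ac)
        then show "C s * \<omega> ^ a s * cnj \<omega> ^ b s * \<omega> ^ (i + k) = C s * (\<omega>\<^sup>2) ^ a s"
          unfolding \<omega>1 by (simp add: power2_eq_square)
      qed
      ultimately show ?thesis by simp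
    qed
    have "(\<Sum>s\<in>{s\<in>{s\<in>S. a s + b s = i + k}. 2 * a s = 2 * i}. C s) = 0"
    proof (rule sum_monomials_vanish[OF _ infinite_unit_circle])
      fix \<omega> :: complex assume "\<omega> \<in> {\<omega>. cmod \<omega> = 1}"
      then show "(\<Sum>s\<in>{s\<in>S. a s + b s = i + k}. C s * \<omega> ^ (2 * a s)) = 0"
        using circle by (simp only: power_mult mem_Collect_eq)
    qed (use S in simp)
    moreover have "{s\<in>{s\<in>S. a s + b s = i + k}. 2 * a s = 2 * i} = {s\<in>S. a s = i \<and> b s = k}" by auto
    ultimately show ?thesis by simp
  qed
  define h where "h = (\<lambda>s. (a s, b s))"
  have "(\<Sum>s\<in>S. C s * x ^ a s * y ^ b s)
      = (\<Sum>q\<in>h ` S. \<Sum>s\<in>{s\<in>S. h s = q}. C s * x ^ a s * y ^ b s)"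
    by (rule sum.image_gen[OF S])
  also have "\<dots> = (\<Sum>q\<in>h ` S. (\<Sum>s\<in>{s\<in>S. a s = fst q \<and> b s = snd q}. C s) * (x ^ fst q * y ^ snd q))"
    unfolding sum_distrib_right by (intro sum.cong refl) (auto simp: h_def mult_ac)
  also have "\<dots> = 0" by (simp add: coeff0)
  finally show ?thesis .
qed

lemma mpow_update:
  "mpow (\<chi> i. if i = j then x else z $ i) \<alpha> = x ^ \<alpha> j * (\<Prod>i\<in>UNIV - {j}. (z $ i) ^ \<alpha> i)"
  unfolding mpow_def by (subst prod.remove[of _ j]) auto

text \<open>\<open>K\<close> is the set of coordinates in which z and \<zeta> may differ, and it
  grows by one coordinate at a time. Setting coordinate \<open>j\<close> of both points to the same
  t gives 0 by induction; the one-variable lemma then lets the two entries vary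
  independently.\<close>

lemma bihom_poly_eq_0_polarize:
  fixes z \<zeta> :: "complex ^ 'n::finite"
  assumes "\<And>z. bihom_poly m c z z = 0"
  shows "bihom_poly m c z \<zeta> = 0"
proof -
  have "(\<forall>j. j \<notin> K \<longrightarrow> z $ j = \<zeta> $ j) \<longrightarrow> bihom_poly m c z \<zeta> = 0" if "finite K" for K and z \<zeta> :: "complex ^ 'n"
    using that
  proof (induction K arbitrary: z \<zeta> rule: finite_induct)
    case empty
    then show ?case using assms by (auto simp: vec_eq_iff[symmetric])
  next
    case (insert j K)
    show ?case
    proof
      assume agree: "\<forall>i. i \<notin> insert j K \<longrightarrow> z $ i = \<zeta> $ i"
      define up where "up = (\<lambda>x (w::complex^'n). \<chi> i. if i = j then x else w $ i)"
      define C where "C = (\<lambda>(\<alpha>, \<beta>). c \<alpha> \<beta> * (\<Prod>i\<in>UNIV - {j}. (z $ i) ^ \<alpha> i)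
          * cnj (\<Prod>i\<in>UNIV - {j}. (\<zeta> $ i) ^ \<beta> i))"
      have up: "bihom_poly m c (up x z) (up y \<zeta>)
          = (\<Sum>s\<in>multi_indices m \<times> multi_indices m. C s * x ^ (fst s j) * cnj y ^ (snd s j))" for x y
        unfolding bihom_poly_def up_def mpow_update sum.cartesian_product
        by (intro sum.cong refl) (auto simp: C_def mult_ac)
      have "bihom_poly m c (up t z) (up t \<zeta>) = 0" for t
        using insert.IH[of "up t z" "up t \<zeta>"] agree by (auto simp: up_def)
      then have "(\<Sum>s\<in>multi_indices m \<times> multi_indices m. C s * (z $ j) ^ (fst s j) * cnj (\<zeta> $ j) ^ (snd s j)) = 0"
        unfolding up
        by (rule polarization_one_variable[where a = "\<lambda>s. fst s j" and b = "\<lambda>s. snd s j", rotated]) simp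
      moreover have "up (z $ j) z = z" "up (\<zeta> $ j) \<zeta> = \<zeta>" by (auto simp: up_def vec_eq_iff)
      ultimately show "bihom_poly m c z \<zeta> = 0" using up[of "z $ j" "\<zeta> $ j"] by simp
    qed
  qed
  from this[of UNIV z \<zeta>] show ?thesis by simp
qed

lemma continuous_on_mpow [continuous_intros]: "continuous_on S (\<lambda>z. mpow z \<alpha>)"
  unfolding mpow_def
  by (intro continuous_intros bounded_linear.continuous_on[OF bounded_linear_vec_nth])

lemma continuous_on_bihom_poly: "continuous_on S (\<lambda>z. bihom_poly m c z z)"
  unfolding bihom_poly_def by (intro continuous_intros)

lemma mpow_scaleR: "mpow (r *\<^sub>R z) \<alpha> = complex_of_real r ^ (\<Sum>j\<in>UNIV. \<alpha> j) * mpow z \<alpha>"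
proof -
  have "(r *\<^sub>R z) $ j = complex_of_real r * z $ j" for j
    by (metis scaleR_conv_of_real vector_scaleR_component)
  then show ?thesis by (simp add: mpow_def power_mult_distrib prod.distrib power_sum)
qed

lemma bihom_poly_scaleR:
  "bihom_poly m c (r *\<^sub>R z) (r *\<^sub>R z) = complex_of_real (r ^ (2 * m)) * bihom_poly m c z z"
proof -
  have "complex_of_real (r ^ (2 * m)) = complex_of_real r ^ m * complex_of_real r ^ m"
    by (metis mult_2 of_real_power power_add)
  then show ?thesis
    unfolding bihom_poly_def sum_distrib_left
    by (intro sum.cong refl) (simp add: mpow_scaleR multi_indices_def mult_ac)
qed

lemma mpow_nonzero:
  assumes "z \<noteq> 0"
  shows "\<exists>\<mu>\<in>multi_indices k. mpow z \<mu> \<noteq> 0"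
proof -
  obtain j where j: "z $ j \<noteq> 0" using assms by (auto simp: vec_eq_iff)
  define \<mu> where "\<mu> = (\<lambda>i. if i = j then k else 0)"
  have "mpow z \<mu> = (\<Prod>i\<in>UNIV. if i = j then (z $ i) ^ k else 1)"
    unfolding mpow_def \<mu>_def by (intro prod.cong) auto
  then have "mpow z \<mu> \<noteq> 0" using j by simp
  moreover have "\<mu> \<in> multi_indices k" by (simp add: \<mu>_def multi_indices_def)
  ultimately show ?thesis by blast
qed

text \<open>The conjugation reconciles two conventions: \<open>quad_form_on\<close> conjugates the
  vector at the row index, \<open>bihom_poly\<close> the monomial at the column index.\<close>

lemma quad_form_cnj_mpow:
  "quad_form_on (multi_indices k) E (\<lambda>\<mu>. cnj (mpow z \<mu>)) = bihom_poly k E z z"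
  unfolding quad_form_on_def mat_vec_on_def bihom_poly_def sum_distrib_right by (simp add: mult_ac)

lemma pos_def_bihom_poly_pos:
  assumes "pos_def_on (multi_indices k) E" "z \<noteq> 0"
  shows "0 < Re (bihom_poly k E z z)"
proof -
  have "\<exists>\<mu>\<in>multi_indices k. cnj (mpow z \<mu>) \<noteq> 0" using mpow_nonzero[OF assms(2)] by simp
  from pos_def_onD[OF assms(1) this] show ?thesis by (simp only: quad_form_cnj_mpow)
qed

lemma norm_sq_H_map: "norm_sq_on (multi_indices d) (H_map d z) = norm z ^ (2 * d)"
proof -
  have "complex_of_real ((cmod (H_map d z \<gamma>))\<^sup>2)
      = fact d / of_nat (mfact \<gamma>) * (mpow z \<gamma> * cnj (mpow z \<gamma>))" for \<gamma>
  proof -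
    have "(cmod (H_map d z \<gamma>))\<^sup>2 = fact d / real (mfact \<gamma>) * (cmod (mpow z \<gamma>))\<^sup>2"
      by (simp add: H_map_def norm_mult power_mult_distrib)
    then have "complex_of_real ((cmod (H_map d z \<gamma>))\<^sup>2)
        = complex_of_real (fact d / real (mfact \<gamma>)) * complex_of_real ((cmod (mpow z \<gamma>))\<^sup>2)"
      by (simp only: of_real_mult)
    then show ?thesis unfolding complex_norm_square[of "mpow z \<gamma>"] by simp
  qed
  then have "complex_of_real (norm_sq_on (multi_indices d) (H_map d z)) = herm_inner z z ^ d"
    unfolding norm_sq_on_def of_real_sum herm_inner_power by (simp only:)
  also have "\<dots> = complex_of_real (norm z ^ (2 * d))" by (simp add: herm_inner_self power_mult)
  finally show ?thesis by (simp only: of_real_eq_iff)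
qed

lemma norm_sq_tensor:
  "norm_sq_on (I \<times> J) (tensor u v) = norm_sq_on I u * norm_sq_on J v"
  by (simp add: norm_sq_on_def tensor_def norm_mult power_mult_distrib sum_product
      sum.cartesian_product case_prod_beta)

section \<open>Moments of the complex Gaussian\<close>

text \<open>Orthogonality of the characters of the circle: the integrand is \<open>cis\<close> of (a
  - b) t, and \<open>g\<close> is the uniform probability density on one period.\<close>

lemma angle_moments:
  fixes a b :: nat
  defines "g \<equiv> (\<lambda>t::real. indicator {0..2 * pi} t / (2 * pi))"
  shows "integrable (density lborel g) (\<lambda>t. cis t ^ a * cnj (cis t) ^ b)"
    and "(\<integral>t. cis t ^ a * cnj (cis t) ^ b \<partial>density lborel g) = (if a = b then 1 else 0)"
proof -
  define k where "k = real a - real b"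
  have cis_pow: "cis t ^ a * cnj (cis t) ^ b = cis (k * t)" for t
    unfolding cis_cnj Complex.DeMoivre cis_mult by (simp add: k_def algebra_simps)
  have cont: "continuous_on S (\<lambda>t. cis (k * t))" for S
    by (intro continuous_intros)
  have g [measurable]: "g \<in> borel_measurable lborel" unfolding g_def by measurable
  have g0: "AE t in lborel. 0 \<le> g t" by (simp add: g_def)
  have f [measurable]: "(\<lambda>t. cis (k * t)) \<in> borel_measurable lborel"
    using cont[of UNIV] by (simp add: borel_measurable_continuous_onI)
  have g_scale: "g t *\<^sub>R cis (k * t) = (1 / (2 * pi)) *\<^sub>R (indicator {0..2 * pi} t *\<^sub>R cis (k * t))" for t
    by (simp add: g_def)
  have int: "integrable lborel (\<lambda>t. indicator {0..2 * pi} t *\<^sub>R cis (k * t))"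
    by (rule borel_integrable_compact) (auto intro: cont)
  show "integrable (density lborel g) (\<lambda>t. cis t ^ a * cnj (cis t) ^ b)"
    unfolding cis_pow integrable_density[OF f g g0] g_scale by (intro integrable_scaleR_right int)
  have "(\<integral>t. cis t ^ a * cnj (cis t) ^ b \<partial>density lborel g)
      = (1 / (2 * pi)) *\<^sub>R (\<integral>t. indicator {0..2 * pi} t *\<^sub>R cis (k * t) \<partial>lborel)"
    unfolding cis_pow integral_density[OF f g g0] g_scale by (rule integral_scaleR_right)
  also have "(\<integral>t. indicator {0..2 * pi} t *\<^sub>R cis (k * t) \<partial>lborel) = (if a = b then 2 * pi else 0)"
  proof (cases "a = b")
    case True
    then have "k = 0" by (simp add: k_def)
    then have "(\<integral>t. indicator {0..2 * pi} t *\<^sub>R cis (k * t) \<partial>lborel)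
        = complex_of_real (\<integral>t. indicator {0..2 * pi} t \<partial>lborel)"
      unfolding integral_complex_of_real[symmetric]
      by (intro Bochner_Integration.integral_cong) (auto simp: scaleR_conv_of_real)
    then show ?thesis using True by simp
  next
    case False
    then have k: "k \<noteq> 0" by (simp add: k_def)
    have "(\<integral>t. indicator {0..2 * pi} t *\<^sub>R cis (k * t) \<partial>lborel)
        = cis (k * (2 * pi)) / (\<i> * complex_of_real k) - cis (k * 0) / (\<i> * complex_of_real k)"
    proof (rule integral_FTC_Icc)
      fix x
      have "((\<lambda>t. exp (\<i> * complex_of_real k * complex_of_real t) / (\<i> * complex_of_real k)) has_vector_derivative
          exp (\<i> * complex_of_real k * complex_of_real x)) (at x within {0..2 * pi})"
        using k by (intro has_vector_derivative_real_field) (auto intro!: derivative_eq_intros)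
      then show "((\<lambda>t. cis (k * t) / (\<i> * complex_of_real k)) has_vector_derivative cis (k * x))
          (at x within {0..2 * pi})"
        by (simp add: cis_conv_exp mult.assoc)
    qed (auto intro: cont)
    also have "cis (k * (2 * pi)) = 1"
      using cis_multiple_2pi[of k] by (simp add: k_def mult_ac)
    finally show ?thesis using False by simp
  qed
  finally show "(\<integral>t. cis t ^ a * cnj (cis t) ^ b \<partial>density lborel g) = (if a = b then 1 else 0)"
    by (simp add: scaleR_conv_of_real)
qed

text \<open>Here t is the squared modulus, so a modulus raised to a power is a power of sqrt t. The
  even case is the Gamma integral for k!; for odd powers integrability is enough, because the
  angular factor annihilates those moments.\<close>

lemma radius_moments:
  fixes k :: nat
  defines "g \<equiv> (\<lambda>t::real. exp (- t) * indicator {0..} t)"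
  shows "integrable (density lborel g) (\<lambda>t. complex_of_real (sqrt t ^ k))"
    and "(\<integral>t. complex_of_real (sqrt t ^ (k + k)) \<partial>density lborel g) = fact k"
proof -
  have g [measurable]: "g \<in> borel_measurable lborel" unfolding g_def by measurable
  have g0: "AE t in lborel. 0 \<le> g t" by (simp add: g_def)
  have f [measurable]: "(\<lambda>t. complex_of_real (sqrt t ^ k)) \<in> borel_measurable lborel" for k
    by measurable
  have mom: "has_bochner_integral lborel (\<lambda>t. g t * t ^ k) (fact k)" for k
    using has_bochner_integral_I0i_power_exp_m'[of k] by (simp add: g_def mult_ac)
  \<comment> \<open>The dominating function: for t \<ge> 0 the k-th power of sqrt t is at most 1 +
    t^k.\<close>
  have "integrable lborel (\<lambda>t. g t * t ^ 0 + g t * t ^ k)"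
    using mom[of 0] mom[of k] by (intro Bochner_Integration.integrable_add) (auto simp: has_bochner_integral_iff)
  then have "integrable lborel (\<lambda>t. g t *\<^sub>R complex_of_real (sqrt t ^ k))"
  proof (rule Bochner_Integration.integrable_bound)
    show "AE t in lborel. norm (g t *\<^sub>R complex_of_real (sqrt t ^ k)) \<le> norm (g t * t ^ 0 + g t * t ^ k)"
    proof (intro AE_I2)
      fix t :: real
      have "sqrt t ^ k \<le> 1 + t ^ k" if "t \<ge> 0"
      proof (cases "t \<le> 1")
        case True
        then show ?thesis using that by (simp add: power_le_one add_increasing2)
      next
        case False
        then have "t * 1 \<le> t * t" by (intro mult_left_mono) auto
        then have "sqrt t \<le> t" using that by (simp add: real_le_lsqrt power2_eq_square)
        then have "sqrt t ^ k \<le> t ^ k" using that by (intro power_mono) auto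
        then show ?thesis by simp
      qed
      then have "g t * sqrt t ^ k \<le> g t * (1 + t ^ k)"
        by (cases "t \<ge> 0") (auto simp: g_def)
      moreover have "norm (g t *\<^sub>R complex_of_real (sqrt t ^ k)) = g t * sqrt t ^ k"
        by (cases "t \<ge> 0") (auto simp: g_def norm_power)
      moreover have "g t * (1 + t ^ k) \<le> norm (g t * t ^ 0 + g t * t ^ k)"
        by (simp add: distrib_left)
      ultimately show "norm (g t *\<^sub>R complex_of_real (sqrt t ^ k)) \<le> norm (g t * t ^ 0 + g t * t ^ k)"
        by linarith
    qed
  qed measurable
  then show "integrable (density lborel g) (\<lambda>t. complex_of_real (sqrt t ^ k))"
    unfolding integrable_density[OF f g g0] .
  have "g t *\<^sub>R complex_of_real (sqrt t ^ (k + k)) = complex_of_real (g t * t ^ k)" for t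
  proof (cases "t \<ge> 0")
    case True
    then have "sqrt t ^ (k + k) = t ^ k" by (simp add: power_add flip: power_mult_distrib)
    then show ?thesis by (simp only: scaleR_conv_of_real of_real_mult)
  qed (simp add: g_def)
  then have "(\<integral>t. complex_of_real (sqrt t ^ (k + k)) \<partial>density lborel g) = complex_of_real (\<integral>t. g t * t ^ k \<partial>lborel)"
    unfolding integral_density[OF f g g0] by (simp only: integral_complex_of_real)
  then show "(\<integral>t. complex_of_real (sqrt t ^ (k + k)) \<partial>density lborel g) = fact k"
    using mom[of k] by (simp add: has_bochner_integral_iff)
qed

text \<open>The measure is the complex Gaussian in polar coordinates: each \<open>|z\<^sub>j|\<^sup>2\<close> is exponentially distributed and
  each argument is uniform.\<close>

lemma gaussian_moments:
  "\<exists>(M :: ('n::finite + 'n \<Rightarrow> real) measure) (Z :: _ \<Rightarrow> complex ^ 'n).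
     (\<forall>\<alpha> \<beta>. integrable M (\<lambda>x. mpow (Z x) \<alpha> * cnj (mpow (Z x) \<beta>)))
   \<and> (\<forall>\<alpha> \<beta>. (\<integral>x. mpow (Z x) \<alpha> * cnj (mpow (Z x) \<beta>) \<partial>M) = (if \<alpha> = \<beta> then of_nat (mfact \<alpha>) else 0))"
proof -
  \<comment> \<open>\<open>Inl j\<close> carries the squared modulus and \<open>Inr j\<close> the
    argument of the j-th coordinate; the integrand factors over these 2 n real coordinates.\<close>
  define g :: "'n + 'n \<Rightarrow> real \<Rightarrow> real" where
    "g = case_sum (\<lambda>_ t. exp (- t) * indicator {0..} t) (\<lambda>_ t. indicator {0..2 * pi} t / (2 * pi))"
  define D where "D = (\<lambda>i. density lborel (\<lambda>t. ennreal (g i t)))"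
  define Z :: "('n + 'n \<Rightarrow> real) \<Rightarrow> complex ^ 'n" where
    "Z = (\<lambda>x. \<chi> j. complex_of_real (sqrt (x (Inl j))) * cis (x (Inr j)))"
  have meas: "g i \<in> borel_measurable borel" for i
    by (cases i) (auto simp: g_def)
  interpret product_sigma_finite D
  proof (rule product_sigma_finite.intro)
    fix i
    show "sigma_finite_measure (D i)"
      unfolding D_def using meas by (subst sigma_finite_measure.sigma_finite_iff_density_finite[OF sigma_finite_lborel]) auto
  qed
  define F :: "('n \<Rightarrow> nat) \<Rightarrow> ('n \<Rightarrow> nat) \<Rightarrow> 'n + 'n \<Rightarrow> real \<Rightarrow> complex" where
    "F = (\<lambda>\<alpha> \<beta>. case_sum (\<lambda>j t. complex_of_real (sqrt t ^ (\<alpha> j + \<beta> j)))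
      (\<lambda>j t. cis t ^ \<alpha> j * cnj (cis t) ^ \<beta> j))"
  have prod_split: "(\<Prod>i\<in>UNIV. G i) = (\<Prod>j\<in>UNIV. G (Inl j)) * (\<Prod>j\<in>UNIV. G (Inr j))" for G :: "'n + 'n \<Rightarrow> complex"
    by (subst UNIV_Plus_UNIV[symmetric], subst prod.Plus) auto
  have int: "integrable (D i) (F \<alpha> \<beta> i)" for \<alpha> \<beta> i
    using radius_moments(1) angle_moments(1) by (cases i) (auto simp: D_def g_def F_def)
  have F: "mpow (Z x) \<alpha> * cnj (mpow (Z x) \<beta>) = (\<Prod>i\<in>UNIV. F \<alpha> \<beta> i (x i))" for \<alpha> \<beta> x
    unfolding prod_split
    by (simp add: mpow_def Z_def F_def power_mult_distrib power_add prod.distrib mult_ac)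
  show ?thesis
  proof (intro exI[of _ "Pi\<^sub>M UNIV D"] exI[of _ Z] conjI allI)
    fix \<alpha> \<beta> :: "'n \<Rightarrow> nat"
    show "integrable (Pi\<^sub>M UNIV D) (\<lambda>x. mpow (Z x) \<alpha> * cnj (mpow (Z x) \<beta>))"
      unfolding F by (intro product_integrable_prod int) auto
    have "(\<integral>x. mpow (Z x) \<alpha> * cnj (mpow (Z x) \<beta>) \<partial>Pi\<^sub>M UNIV D) = (\<Prod>i\<in>UNIV. integral\<^sup>L (D i) (F \<alpha> \<beta> i))"
      unfolding F by (intro product_integral_prod int) auto
    \<comment> \<open>The angles alone force \<alpha> = \<beta>, so the radial factors need to be
      evaluated only in that case.\<close>
    also have "\<dots> = (\<Prod>j\<in>UNIV. integral\<^sup>L (D (Inl j)) (F \<alpha> \<beta> (Inl j))) * (\<Prod>j\<in>UNIV. if \<alpha> j = \<beta> j then 1 else 0)"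
      unfolding prod_split by (simp add: D_def g_def F_def angle_moments(2))
    also have "\<dots> = (if \<alpha> = \<beta> then of_nat (mfact \<alpha>) else 0)"
    proof (cases "\<alpha> = \<beta>")
      case True
      have "integral\<^sup>L (D (Inl j)) (F \<alpha> \<alpha> (Inl j)) = fact (\<alpha> j)" for j
        using radius_moments(2)[of "\<alpha> j"] by (simp only: D_def g_def F_def sum.case)
      then show ?thesis using True by (simp add: mfact_def)
    next
      case False
      then have "(\<Prod>j\<in>UNIV. if \<alpha> j = \<beta> j then 1 else 0) = (0::complex)" by (auto simp: fun_eq_iff prod_zero_iff)
      then show ?thesis using False by simp
    qed
    finally show "(\<integral>x. mpow (Z x) \<alpha> * cnj (mpow (Z x) \<beta>) \<partial>Pi\<^sub>M UNIV D) = (if \<alpha> = \<beta> then of_nat (mfact \<alpha>) else 0)" .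
  qed
qed

section \<open>Positivity of the lifted coefficient matrix\<close>

text \<open>The sum is the form at H = \<Sum> h_\<mu> z^\<mu> of the Toeplitz (anti-Wick) operator
  on Fock space whose symbol is the polynomial with coefficients \<open>c\<close>. Expanding the
  integrand into monomials leaves exactly the moments with \<alpha> + \<mu> = \<beta> +
  \<nu>.\<close>

lemma anti_wick_nonneg:
  fixes c :: "('n::finite \<Rightarrow> nat) \<Rightarrow> ('n \<Rightarrow> nat) \<Rightarrow> complex"
  assumes pos: "\<And>z. 0 \<le> Re (bihom_poly m c z z)"
  shows "0 \<le> Re (\<Sum>\<alpha>\<in>multi_indices m. \<Sum>\<beta>\<in>multi_indices m. c \<alpha> \<beta> *
    (\<Sum>\<mu>\<in>K. \<Sum>\<nu>\<in>K. if madd \<alpha> \<mu> = madd \<beta> \<nu> then of_nat (mfact (madd \<alpha> \<mu>)) * (h \<mu> * cnj (h \<nu>)) else 0))"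
proof -
  obtain M :: "('n + 'n \<Rightarrow> real) measure" and Z :: "('n + 'n \<Rightarrow> real) \<Rightarrow> complex ^ 'n"
    where int: "\<And>\<alpha> \<beta>. integrable M (\<lambda>x. mpow (Z x) \<alpha> * cnj (mpow (Z x) \<beta>))"
      and mom: "\<And>\<alpha> \<beta>. (\<integral>x. mpow (Z x) \<alpha> * cnj (mpow (Z x) \<beta>) \<partial>M)
                  = (if \<alpha> = \<beta> then of_nat (mfact \<alpha>) else 0)"
    using gaussian_moments by blast
  define H where "H = (\<lambda>z. \<Sum>\<mu>\<in>K. h \<mu> * mpow z \<mu>)"
  have expand: "bihom_poly m c z z * (H z * cnj (H z))
      = (\<Sum>\<alpha>\<in>multi_indices m. \<Sum>\<beta>\<in>multi_indices m. \<Sum>\<mu>\<in>K. \<Sum>\<nu>\<in>K. c \<alpha> \<beta> * (h \<mu> * cnj (h \<nu>)) *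
          (mpow z (madd \<alpha> \<mu>) * cnj (mpow z (madd \<beta> \<nu>))))" for z
  proof -
    have H2: "H z * cnj (H z) = (\<Sum>\<mu>\<in>K. \<Sum>\<nu>\<in>K. h \<mu> * mpow z \<mu> * cnj (h \<nu> * mpow z \<nu>))"
      unfolding H_def cnj_sum by (rule sum_product)
    have bX: "bihom_poly m c z z * X
        = (\<Sum>\<alpha>\<in>multi_indices m. \<Sum>\<beta>\<in>multi_indices m. c \<alpha> \<beta> * mpow z \<alpha> * cnj (mpow z \<beta>) * X)" for X
      by (simp add: bihom_poly_def sum_distrib_right)
    show ?thesis
      unfolding bX unfolding H2 unfolding sum_distrib_left by (simp add: mpow_madd mult_ac)
  qed
  have term_int: "(\<integral>x. c \<alpha> \<beta> * (h \<mu> * cnj (h \<nu>)) * (mpow (Z x) (madd \<alpha> \<mu>) * cnj (mpow (Z x) (madd \<beta> \<nu>))) \<partial>M)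
      = c \<alpha> \<beta> * (if madd \<alpha> \<mu> = madd \<beta> \<nu> then of_nat (mfact (madd \<alpha> \<mu>)) * (h \<mu> * cnj (h \<nu>)) else 0)" for \<alpha> \<beta> \<mu> \<nu>
    by (subst integral_mult_right_zero) (simp add: mom)
  have I1: "(\<integral>x. bihom_poly m c (Z x) (Z x) * (H (Z x) * cnj (H (Z x))) \<partial>M)
      = (\<Sum>\<alpha>\<in>multi_indices m. \<Sum>\<beta>\<in>multi_indices m. \<Sum>\<mu>\<in>K. \<Sum>\<nu>\<in>K. c \<alpha> \<beta> *
          (if madd \<alpha> \<mu> = madd \<beta> \<nu> then of_nat (mfact (madd \<alpha> \<mu>)) * (h \<mu> * cnj (h \<nu>)) else 0))"
    unfolding expand term_int[symmetric]
    by (simp only: Bochner_Integration.integral_sum Bochner_Integration.integrable_sum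
        integrable_mult_right int)
  have I2: "integrable M (\<lambda>x. bihom_poly m c (Z x) (Z x) * (H (Z x) * cnj (H (Z x))))"
    unfolding expand by (intro Bochner_Integration.integrable_sum integrable_mult_right int)
  have "0 \<le> (\<integral>x. Re (bihom_poly m c (Z x) (Z x) * (H (Z x) * cnj (H (Z x)))) \<partial>M)"
  proof (rule Bochner_Integration.integral_nonneg)
    fix x
    have "H (Z x) * cnj (H (Z x)) = complex_of_real ((cmod (H (Z x)))\<^sup>2)"
      by (rule complex_norm_square[symmetric])
    then show "0 \<le> Re (bihom_poly m c (Z x) (Z x) * (H (Z x) * cnj (H (Z x))))"
      using pos[of "Z x"] by (simp del: of_real_power)
  qed
  also have "\<dots> = Re (\<integral>x. bihom_poly m c (Z x) (Z x) * (H (Z x) * cnj (H (Z x))) \<partial>M)"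
    using I2 by (rule integral_Re)
  finally show ?thesis unfolding sum_distrib_left I1 .
qed

text \<open>The quotient is the product of the a consecutive integers n + 1, ..., n + a.\<close>

lemma fact_ratio_bounds:
  fixes n a :: nat
  shows "real n ^ a \<le> fact (n + a) / fact n" and "fact (n + a) / fact n \<le> real (n + a) ^ a"
proof -
  have "real n ^ a * fact n \<le> fact (n + a) \<and> fact (n + a) \<le> real (n + a) ^ a * fact n"
  proof (induction a)
    case (Suc a)
    have "real n ^ Suc a * fact n = real n * (real n ^ a * fact n)" by simp
    also have "\<dots> \<le> real (n + Suc a) * fact (n + a)"
      using Suc.IH by (intro mult_mono) auto
    finally have "real n ^ Suc a * fact n \<le> fact (n + Suc a)" by simp
    moreover have "fact (n + Suc a) = real (n + Suc a) * fact (n + a)" by simp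
    moreover have "real (n + Suc a) * fact (n + a) \<le> real (n + Suc a) * (real (n + Suc a) ^ a * fact n)"
    proof (intro mult_left_mono)
      have "fact (n + a) \<le> real (n + a) ^ a * fact n" using Suc.IH by simp
      also have "\<dots> \<le> real (n + Suc a) ^ a * fact n" by (intro mult_right_mono power_mono) auto
      finally show "fact (n + a) \<le> real (n + Suc a) ^ a * fact n" .
    qed auto
    ultimately show ?case by (simp add: mult_ac)
  qed simp
  then show "real n ^ a \<le> fact (n + a) / fact n" and "fact (n + a) / fact n \<le> real (n + a) ^ a"
    by (simp_all add: field_simps)
qed

text \<open>After division by \<open>B\<close> every factor lies in [0, 1], where a difference of
  products is at most the sum of the differences of the factors. The factor at \<open>j\<close>
  changes by at most e_j D / B.\<close>

lemma prod_power_shift_diff: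
  fixes s e :: "'j \<Rightarrow> nat"
  assumes B: "B > 0" and s: "\<And>j. j \<in> J \<Longrightarrow> s j \<le> B" and fin: "finite J"
  shows "(\<Prod>j\<in>J. real (s j) ^ e j) - (\<Prod>j\<in>J. real (s j - D) ^ e j)
       \<le> real B ^ (\<Sum>j\<in>J. e j) * (real (\<Sum>j\<in>J. e j) * real D / real B)"
proof -
  have scale: "(\<Prod>j\<in>J. real (r j) ^ e j) = real B ^ (\<Sum>j\<in>J. e j) * (\<Prod>j\<in>J. (real (r j) / real B) ^ e j)" for r :: "'j \<Rightarrow> nat"
    using B by (simp add: power_sum prod.distrib[symmetric] power_divide)
  have "(\<Prod>j\<in>J. (real (s j) / real B) ^ e j) - (\<Prod>j\<in>J. (real (s j - D) / real B) ^ e j)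
      \<le> norm ((\<Prod>j\<in>J. (real (s j) / real B) ^ e j) - (\<Prod>j\<in>J. (real (s j - D) / real B) ^ e j))" by simp
  also have "\<dots> \<le> (\<Sum>j\<in>J. norm ((real (s j) / real B) ^ e j - (real (s j - D) / real B) ^ e j))"
    using B s le_trans[OF diff_le_self s, of _ D]
    by (intro norm_prod_diff) (auto simp: norm_power intro!: power_le_one)
  also have "\<dots> \<le> (\<Sum>j\<in>J. real (e j) * (real D / real B))"
  proof (rule sum_mono)
    fix j assume j: "j \<in> J"
    have "norm ((real (s j) / real B) ^ e j - (real (s j - D) / real B) ^ e j)
        \<le> real (e j) * norm (real (s j) / real B - real (s j - D) / real B)"
      using B s[OF j] by (intro norm_power_diff) auto
    also have "norm (real (s j) / real B - real (s j - D) / real B) = (real (s j) - real (s j - D)) / real B"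
      by (simp add: diff_divide_distrib[symmetric])
    also have "\<dots> \<le> real D / real B" by (intro divide_right_mono) auto
    finally show "norm ((real (s j) / real B) ^ e j - (real (s j - D) / real B) ^ e j)
        \<le> real (e j) * (real D / real B)" by (simp add: mult_left_mono)
  qed
  also have "\<dots> = real (\<Sum>j\<in>J. e j) * real D / real B"
    by (simp add: sum_distrib_right sum_divide_distrib)
  finally show ?thesis
    unfolding scale right_diff_distrib[symmetric] by (intro mult_left_mono) auto
qed

text \<open>The Schur test for a 0-1 matrix with at most one nonzero entry in each row and column.
  After a b \<le> a^2/2 + b^2/2, each squared entry of \<open>v\<close> is counted at most once by
  rows and at most once by columns, each time with factor 1/2.\<close>

lemma schur_partial_injection:
  fixes v :: "'a \<Rightarrow> complex" and R :: "'a \<Rightarrow> 'a \<Rightarrow> bool"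
  assumes K: "finite K" and R: "\<And>x y y'. R x y \<Longrightarrow> R x y' \<Longrightarrow> y = y'" "\<And>x x' y. R x y \<Longrightarrow> R x' y \<Longrightarrow> x = x'"
  shows "(\<Sum>x\<in>K. \<Sum>y\<in>K. if R x y then cmod (v x) * cmod (v y) else 0) \<le> (\<Sum>x\<in>K. (cmod (v x))\<^sup>2)"
proof -
  have one: "(\<Sum>y\<in>K. if Q y then a else 0) \<le> a" if "a \<ge> 0" and Q: "\<And>y y'. Q y \<Longrightarrow> Q y' \<Longrightarrow> y = y'"
    for Q :: "'a \<Rightarrow> bool" and a :: real
  proof (cases "\<exists>y. Q y")
    case True
    then obtain y0 where "Q y0" by auto
    then have "Q y \<longleftrightarrow> y = y0" for y using Q by auto
    then show ?thesis using K \<open>a \<ge> 0\<close> by simp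
  next
    case False
    then show ?thesis using \<open>a \<ge> 0\<close> by simp
  qed
  have amgm: "a * b \<le> a\<^sup>2 / 2 + b\<^sup>2 / 2" for a b :: real
    using sum_squares_bound[of a b] by simp
  have "(\<Sum>x\<in>K. \<Sum>y\<in>K. if R x y then cmod (v x) * cmod (v y) else 0)
      \<le> (\<Sum>x\<in>K. \<Sum>y\<in>K. (if R x y then (cmod (v x))\<^sup>2 / 2 else 0) + (if R x y then (cmod (v y))\<^sup>2 / 2 else 0))"
    using amgm by (intro sum_mono) auto
  also have "\<dots> = (\<Sum>x\<in>K. \<Sum>y\<in>K. if R x y then (cmod (v x))\<^sup>2 / 2 else 0)
      + (\<Sum>y\<in>K. \<Sum>x\<in>K. if R x y then (cmod (v y))\<^sup>2 / 2 else 0)"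
    unfolding sum.distrib by (subst (3) sum.swap) simp
  also have "\<dots> \<le> (\<Sum>x\<in>K. (cmod (v x))\<^sup>2 / 2) + (\<Sum>y\<in>K. (cmod (v y))\<^sup>2 / 2)"
    using R by (intro add_mono sum_mono one) auto
  finally show ?thesis by (simp add: sum_divide_distrib[symmetric])
qed

text \<open>The norm of the monomial z^\<mu> in Fock space. Dividing by it makes the monomials
  orthonormal.\<close>

definition msqrt_fact :: "('n::finite \<Rightarrow> nat) \<Rightarrow> real" where
  "msqrt_fact \<mu> = sqrt (real (mfact \<mu>))"

lemma msqrt_fact_pos: "msqrt_fact \<mu> > 0"
  by (simp add: msqrt_fact_def mfact_pos)

lemma msqrt_fact_square: "(msqrt_fact \<mu>)\<^sup>2 = (\<Prod>j\<in>UNIV. fact (\<mu> j))"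
  by (simp add: msqrt_fact_def mfact_def prod_nonneg)

text \<open>With \<open>s = \<alpha> + \<mu> = \<beta> + \<nu>\<close>, the squares of both weights lie between the products of \<open>(s\<^sub>j - 2 m)\<^bsup>\<alpha>\<^sub>j + \<beta>\<^sub>j\<^esup>\<close>
  (truncated subtraction) and of \<open>s\<^sub>j\<^bsup>\<alpha>\<^sub>j + \<beta>\<^sub>j\<^esup>\<close>.\<close>

lemma wick_weight_diff:
  fixes \<alpha> \<beta> \<mu> \<nu> :: "'n::finite \<Rightarrow> nat"
  assumes \<alpha>: "\<alpha> \<in> multi_indices m" and \<beta>: "\<beta> \<in> multi_indices m"
    and \<mu>: "\<mu> \<in> multi_indices k" and eq: "madd \<alpha> \<mu> = madd \<beta> \<nu>" and k: "k > 0"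
  shows "\<bar>real (mfact (madd \<alpha> \<mu>)) / (msqrt_fact \<mu> * msqrt_fact \<nu>)
     - (if \<forall>j. \<beta> j \<le> \<mu> j then msqrt_fact \<mu> * msqrt_fact \<nu> / real (mfact (\<lambda>j. \<mu> j - \<beta> j)) else 0)\<bar>
     \<le> real (m + k) ^ m * (2 * real m / sqrt (real (m + k)))"
    (is "\<bar>?w - ?t\<bar> \<le> _")
proof -
  define s where "s = madd \<alpha> \<mu>"
  define e where "e = madd \<alpha> \<beta>"
  have s1: "s j = \<mu> j + \<alpha> j" and s2: "s j = \<nu> j + \<beta> j" for j
    using fun_cong[OF eq, of j] by (simp_all add: s_def)
  have am: "\<alpha> j \<le> m" and bm: "\<beta> j \<le> m" for j
    using \<alpha> \<beta> member_le_sum[of j UNIV \<alpha>] member_le_sum[of j UNIV \<beta>] by (auto simp: multi_indices_def)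
  define U where "U = (\<Prod>j\<in>UNIV. real (s j) ^ e j)"
  define L where "L = (\<Prod>j\<in>UNIV. real (s j - 2 * m) ^ e j)"
  have sB: "s j \<le> m + k" for j
  proof -
    have "s \<in> multi_indices (m + k)" unfolding s_def by (rule madd_multi_indices[OF \<alpha> \<mu>])
    then show ?thesis using member_le_sum[of j UNIV s] by (auto simp: multi_indices_def)
  qed
  have esum: "(\<Sum>j\<in>UNIV. e j) = 2 * m" using \<alpha> \<beta> by (simp add: e_def multi_indices_def sum.distrib)
  have UL: "U - L \<le> real (m + k) ^ (2 * m) * (real (2 * m) * real (2 * m) / real (m + k))"
    using prod_power_shift_diff[of "m + k" UNIV s e "2 * m", OF _ sB finite] k
    unfolding esum U_def[symmetric] L_def[symmetric] by simp
  have w2: "?w\<^sup>2 = (\<Prod>j\<in>UNIV. (fact (\<mu> j + \<alpha> j) / fact (\<mu> j)) * (fact (\<nu> j + \<beta> j) / fact (\<nu> j)))"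
  proof -
    have "?w\<^sup>2 = (\<Prod>j\<in>UNIV. fact (s j))\<^sup>2 / ((\<Prod>j\<in>UNIV. fact (\<mu> j)) * (\<Prod>j\<in>UNIV. fact (\<nu> j)))"
      by (simp add: power_divide power_mult_distrib msqrt_fact_square mfact_def s_def)
    also have "\<dots> = (\<Prod>j\<in>UNIV. (fact (s j) / fact (\<mu> j)) * (fact (s j) / fact (\<nu> j)))"
      by (simp add: prod.distrib prod_dividef power2_eq_square)
    finally show ?thesis by (simp only: s1[symmetric] s2[symmetric])
  qed
  have lowpow: "real (s j - 2 * m) ^ e j \<le> x * y" if "real (s j - 2 * m) ^ \<alpha> j \<le> x" "real (s j - 2 * m) ^ \<beta> j \<le> y" for x y j
    unfolding e_def power_add using that by (intro mult_mono) (auto intro: order_trans[OF zero_le_power[OF of_nat_0_le_iff]])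
  have uppow: "x * y \<le> real (s j) ^ e j" if "x \<le> real (s j) ^ \<alpha> j" "y \<le> real (s j) ^ \<beta> j" "0 \<le> x" "0 \<le> y" for x y j
    unfolding e_def power_add using that by (intro mult_mono) auto
  have w_bounds: "L \<le> ?w\<^sup>2" "?w\<^sup>2 \<le> U"
  proof -
    show "L \<le> ?w\<^sup>2" unfolding w2 L_def
    proof (intro prod_mono conjI lowpow)
      fix j
      have "real (s j - 2 * m) ^ \<alpha> j \<le> real (\<mu> j) ^ \<alpha> j"
        using am[of j] by (intro power_mono) (auto simp: s1)
      then show "real (s j - 2 * m) ^ \<alpha> j \<le> fact (\<mu> j + \<alpha> j) / fact (\<mu> j)"
        using fact_ratio_bounds(1)[of "\<mu> j" "\<alpha> j"] by linarith
      have "real (s j - 2 * m) ^ \<beta> j \<le> real (\<nu> j) ^ \<beta> j"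
        using bm[of j] by (intro power_mono) (auto simp: s2)
      then show "real (s j - 2 * m) ^ \<beta> j \<le> fact (\<nu> j + \<beta> j) / fact (\<nu> j)"
        using fact_ratio_bounds(1)[of "\<nu> j" "\<beta> j"] by linarith
    qed auto
    show "?w\<^sup>2 \<le> U" unfolding w2 U_def
    proof (intro prod_mono conjI uppow)
      fix j
      show "fact (\<mu> j + \<alpha> j) / fact (\<mu> j) \<le> real (s j) ^ \<alpha> j"
        unfolding s1 by (rule fact_ratio_bounds(2))
      show "fact (\<nu> j + \<beta> j) / fact (\<nu> j) \<le> real (s j) ^ \<beta> j"
        unfolding s2 by (rule fact_ratio_bounds(2))
    qed auto
  qed
  have t_bounds: "L \<le> ?t\<^sup>2 \<and> ?t\<^sup>2 \<le> U"
  proof (cases "\<forall>j. \<beta> j \<le> \<mu> j")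
    case True
    \<comment> \<open>\<open>g\<close> is the common remainder \<mu> - \<beta> = \<nu> - \<alpha>.
      The factors of the squared weight start at \<open>g j\<close>, which is at least s_j - 2 m
      since \<alpha>_j and \<beta>_j are at most m.\<close>
    define g where "g = (\<lambda>j. \<mu> j - \<beta> j)"
    have \<mu>g: "\<mu> j = g j + \<beta> j" for j using True by (simp add: g_def)
    have \<nu>g: "\<nu> j = g j + \<alpha> j" for j using s1[of j] s2[of j] \<mu>g[of j] by simp
    have "?t\<^sup>2 = (\<Prod>j\<in>UNIV. fact (\<mu> j)) * (\<Prod>j\<in>UNIV. fact (\<nu> j)) / (\<Prod>j\<in>UNIV. fact (g j))\<^sup>2"
      using True by (simp add: power_divide power_mult_distrib msqrt_fact_square mfact_def g_def)
    also have "\<dots> = (\<Prod>j\<in>UNIV. (fact (g j + \<alpha> j) / fact (g j)) * (fact (g j + \<beta> j) / fact (g j)))"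
      by (simp add: prod.distrib prod_dividef power2_eq_square \<mu>g \<nu>g)
    finally have t2: "?t\<^sup>2 = (\<Prod>j\<in>UNIV. (fact (g j + \<alpha> j) / fact (g j)) * (fact (g j + \<beta> j) / fact (g j)))" .
    have sg: "s j - 2 * m \<le> g j" for j using am[of j] bm[of j] s1[of j] \<mu>g[of j] by simp
    have gs: "g j + \<alpha> j \<le> s j" "g j + \<beta> j \<le> s j" for j using s1[of j] \<mu>g[of j] by simp_all
    have low: "real (s j - 2 * m) ^ a \<le> fact (g j + a) / fact (g j)" for a j
    proof -
      have "real (s j - 2 * m) ^ a \<le> real (g j) ^ a" using sg[of j] by (intro power_mono) auto
      then show ?thesis using fact_ratio_bounds(1)[of "g j" a] by linarith
    qed
    have up: "fact (g j + a) / fact (g j) \<le> real (s j) ^ a" if "g j + a \<le> s j" for a j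
    proof -
      have "real (g j + a) ^ a \<le> real (s j) ^ a" using that by (intro power_mono) auto
      then show ?thesis using fact_ratio_bounds(2)[of "g j" a] by linarith
    qed
    show ?thesis unfolding t2 L_def U_def
      by (intro conjI prod_mono lowpow uppow low up gs) auto
  next
    case False
    \<comment> \<open>Here \<beta> does not divide \<mu> and the derivative weight is 0. The shift
      by 2 m is large enough that the lower product vanishes too: s_j = \<mu>_j + \<alpha>_j < 2 m,
      and its exponent is positive.\<close>
    then obtain j where j: "\<mu> j < \<beta> j" by (auto simp: not_le)
    then have "s j - 2 * m = 0" "e j > 0" using am[of j] bm[of j] s1[of j] by (auto simp: e_def)
    then have "\<exists>j\<in>UNIV. real (s j - 2 * m) ^ e j = 0" by (intro bexI[of _ j]) auto
    then have "L = 0" unfolding L_def by (intro prod_zero) auto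
    moreover have "U \<ge> 0" unfolding U_def by (intro prod_nonneg) auto
    moreover have "?t = 0" using False by (simp only: if_False)
    ultimately show ?thesis by simp
  qed
  have w0: "?w \<ge> 0" using msqrt_fact_pos[of \<mu>] msqrt_fact_pos[of \<nu>] by (simp add: less_imp_le)
  have t0: "?t \<ge> 0" using msqrt_fact_pos[of \<mu>] msqrt_fact_pos[of \<nu>] by (auto simp: less_imp_le)
  \<comment> \<open>For nonnegative numbers (w - t)^2 \<le> |w^2 - t^2|. This is the passage from
    order 2 m - 1 for the squares to order m - 1/2 for the weights.\<close>
  have "\<bar>?w - ?t\<bar>\<^sup>2 \<le> \<bar>?w - ?t\<bar> * (?w + ?t)"
    unfolding power2_eq_square using w0 t0 by (intro mult_left_mono) linarith+
  also have "\<dots> = \<bar>(?w - ?t) * (?w + ?t)\<bar>" using w0 t0 by (simp only: abs_mult abs_of_nonneg add_nonneg_nonneg)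
  also have "(?w - ?t) * (?w + ?t) = ?w\<^sup>2 - ?t\<^sup>2" by (simp only: square_diff_square_factored power2_eq_square mult.commute)
  also have "\<bar>?w\<^sup>2 - ?t\<^sup>2\<bar> \<le> U - L" using w_bounds t_bounds by linarith
  also have "\<dots> \<le> real (m + k) ^ (2 * m) * (real (2 * m) * real (2 * m) / real (m + k))" by (rule UL)
  also have "\<dots> = (real (m + k) ^ m * (2 * real m / sqrt (real (m + k))))\<^sup>2"
    by (simp add: power_mult_distrib power_divide power_even_eq) (simp add: power2_eq_square)
  finally show ?thesis
    by (rule power2_le_imp_le) simp
qed

lemma quad_form_lift_coeff:
  "quad_form_on (multi_indices (m + d)) (lift_coeff d c) u
   = (\<Sum>\<gamma>\<in>multi_indices d. fact d / of_nat (mfact \<gamma>) *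
      (\<Sum>\<alpha>\<in>multi_indices m. \<Sum>\<beta>\<in>multi_indices m. c \<alpha> \<beta> * (u (madd \<gamma> \<beta>) * cnj (u (madd \<gamma> \<alpha>)))))"
proof -
  have "quad_form_on (multi_indices (m + d)) (lift_coeff d c) u
      = (\<Sum>\<mu>\<in>multi_indices (m + d). \<Sum>\<nu>\<in>multi_indices (m + d). lift_coeff d c \<mu> \<nu> * (u \<nu> * cnj (u \<mu>)))"
    by (simp add: quad_form_on_def mat_vec_on_def sum_distrib_right mult.assoc)
  also have "\<dots> = (\<Sum>\<gamma>\<in>multi_indices d. fact d / of_nat (mfact \<gamma>) *
      (\<Sum>\<alpha>\<in>multi_indices m. \<Sum>\<beta>\<in>multi_indices m. c \<alpha> \<beta> * (u (madd \<gamma> \<beta>) * cnj (u (madd \<gamma> \<alpha>)))))"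
    by (rule sum_lift_coeff)
  finally show ?thesis .
qed

text \<open>Up to normalization the left side is the Fock product of the \<beta>-th and \<alpha>-th
  derivatives of h, indexed by the monomial \<gamma> = \<mu> - \<beta> = \<nu> - \<alpha> that
  remains. The right side indexes it by the pairs (\<mu>, \<nu>) of the multiplication form, so that
  the two can be compared entry by entry.\<close>

lemma wick_form:
  fixes \<alpha> \<beta> :: "'n::finite \<Rightarrow> nat" and v :: "('n \<Rightarrow> nat) \<Rightarrow> complex"
  assumes \<alpha>: "\<alpha> \<in> multi_indices m" and \<beta>: "\<beta> \<in> multi_indices m"
  defines "u \<equiv> (\<lambda>\<mu>. complex_of_real (msqrt_fact \<mu>) * v \<mu>)"
  shows "(\<Sum>\<gamma>\<in>multi_indices d. u (madd \<gamma> \<beta>) * cnj (u (madd \<gamma> \<alpha>)) / of_nat (mfact \<gamma>))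
    = (\<Sum>\<mu>\<in>multi_indices (m + d). \<Sum>\<nu>\<in>multi_indices (m + d). if madd \<alpha> \<mu> = madd \<beta> \<nu>
        then complex_of_real (if \<forall>j. \<beta> j \<le> \<mu> j then msqrt_fact \<mu> * msqrt_fact \<nu> / real (mfact (\<lambda>j. \<mu> j - \<beta> j)) else 0)
          * (v \<mu> * cnj (v \<nu>)) else 0)"
proof -
  let ?K = "multi_indices (m + d) :: ('n \<Rightarrow> nat) set"
  have "(\<Sum>\<nu>\<in>?K. if madd \<alpha> \<mu> = madd \<beta> \<nu>
        then complex_of_real (if \<forall>j. \<beta> j \<le> \<mu> j then msqrt_fact \<mu> * msqrt_fact \<nu> / real (mfact (\<lambda>j. \<mu> j - \<beta> j)) else 0)
          * (v \<mu> * cnj (v \<nu>)) else 0)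
      = (if \<forall>j. \<beta> j \<le> \<mu> j
         then u \<mu> * cnj (u (madd (\<lambda>j. \<mu> j - \<beta> j) \<alpha>)) / of_nat (mfact (\<lambda>j. \<mu> j - \<beta> j)) else 0)"
    (is "?lhs = ?rhs") if \<mu>: "\<mu> \<in> ?K" for \<mu>
  proof (cases "\<forall>j. \<beta> j \<le> \<mu> j")
    case True
    define \<nu>0 where "\<nu>0 = madd (\<lambda>j. \<mu> j - \<beta> j) \<alpha>"
    have "(\<lambda>j. \<mu> j - \<beta> j) \<in> multi_indices d"
      using \<mu> \<beta> True by (intro diff_multi_indices) (simp_all add: add.commute)
    then have "\<nu>0 \<in> multi_indices (d + m)" unfolding \<nu>0_def using \<alpha> by (rule madd_multi_indices)
    then have \<nu>0: "\<nu>0 \<in> ?K" by (simp add: add.commute)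
    have iff: "madd \<alpha> \<mu> = madd \<beta> \<nu> \<longleftrightarrow> \<nu> = \<nu>0" for \<nu>
    proof -
      have "\<alpha> j + \<mu> j = \<beta> j + \<nu> j \<longleftrightarrow> \<nu> j = \<nu>0 j" for j
        using True[rule_format, of j] by (auto simp: \<nu>0_def)
      then show ?thesis by (simp add: fun_eq_iff)
    qed
    have "?lhs = complex_of_real (msqrt_fact \<mu> * msqrt_fact \<nu>0 / real (mfact (\<lambda>j. \<mu> j - \<beta> j))) * (v \<mu> * cnj (v \<nu>0))"
      unfolding iff using \<nu>0 True by simp
    also have "\<dots> = u \<mu> * cnj (u \<nu>0) / of_nat (mfact (\<lambda>j. \<mu> j - \<beta> j))"
      by (simp add: u_def mult_ac)
    finally show ?thesis using True unfolding \<nu>0_def by simp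
  next
    case False
    then have "?lhs = 0" by (intro sum.neutral) auto
    moreover have "?rhs = 0" using False by auto
    ultimately show ?thesis by simp
  qed
  then have "(\<Sum>\<mu>\<in>?K. \<Sum>\<nu>\<in>?K. if madd \<alpha> \<mu> = madd \<beta> \<nu>
        then complex_of_real (if \<forall>j. \<beta> j \<le> \<mu> j then msqrt_fact \<mu> * msqrt_fact \<nu> / real (mfact (\<lambda>j. \<mu> j - \<beta> j)) else 0)
          * (v \<mu> * cnj (v \<nu>)) else 0)
      = (\<Sum>\<mu>\<in>multi_indices (d + m). if \<forall>j. \<beta> j \<le> \<mu> j
         then u \<mu> * cnj (u (madd (\<lambda>j. \<mu> j - \<beta> j) \<alpha>)) / of_nat (mfact (\<lambda>j. \<mu> j - \<beta> j)) else 0)"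
    by (intro sum.cong) (simp_all add: add.commute)
  also have "\<dots> = (\<Sum>\<gamma>\<in>multi_indices d. u (madd \<beta> \<gamma>) * cnj (u (madd \<gamma> \<alpha>)) / of_nat (mfact \<gamma>))"
    by (rule sum_shift_multi_indices[OF \<beta>])
  finally show ?thesis by (simp add: add.commute)
qed

text \<open>\<open>W\<close> holds the matrix elements of the multiplication form and
  \<open>T\<close> those of the derivative form; combining the latter with \<open>c\<close> gives
  the quadratic form divided by d!. The error involves m + k because that is the degree of \<alpha>
  + \<mu>, on which the weight bounds depend, while the main term involves only k = |\<mu>|.\<close>

lemma quillen_estimate:
  fixes c :: "('n::finite \<Rightarrow> nat) \<Rightarrow> ('n \<Rightarrow> nat) \<Rightarrow> complex" and v :: "('n \<Rightarrow> nat) \<Rightarrow> complex"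
  assumes low: "\<And>z. \<epsilon> * norm z ^ (2 * m) \<le> Re (bihom_poly m c z z)" and \<epsilon>: "\<epsilon> > 0" and d: "d \<ge> 1"
  defines "u \<equiv> (\<lambda>\<mu>. complex_of_real (msqrt_fact \<mu>) * v \<mu>)"
    and "C \<equiv> (\<Sum>\<alpha>\<in>multi_indices m. \<Sum>\<beta>\<in>multi_indices m. cmod (c \<alpha> \<beta>))"
    and "k \<equiv> m + d"
  shows "(\<epsilon> * real k ^ m - C * (real (m + k) ^ m * (2 * real m / sqrt (real (m + k)))))
      * norm_sq_on (multi_indices k) v
    \<le> Re (quad_form_on (multi_indices k) (lift_coeff d c) u) / fact d"
proof -
  let ?A = "multi_indices m :: ('n \<Rightarrow> nat) set" and ?K = "multi_indices k :: ('n \<Rightarrow> nat) set"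
  define w :: "('n \<Rightarrow> nat) \<Rightarrow> ('n \<Rightarrow> nat) \<Rightarrow> ('n \<Rightarrow> nat) \<Rightarrow> real" where
    "w = (\<lambda>\<alpha> \<mu> \<nu>. real (mfact (madd \<alpha> \<mu>)) / (msqrt_fact \<mu> * msqrt_fact \<nu>))"
  define t :: "('n \<Rightarrow> nat) \<Rightarrow> ('n \<Rightarrow> nat) \<Rightarrow> ('n \<Rightarrow> nat) \<Rightarrow> real" where
    "t = (\<lambda>\<beta> \<mu> \<nu>. if \<forall>j. \<beta> j \<le> \<mu> j
      then msqrt_fact \<mu> * msqrt_fact \<nu> / real (mfact (\<lambda>j. \<mu> j - \<beta> j)) else 0)"
  define W where "W = (\<lambda>\<alpha> \<beta>. \<Sum>\<mu>\<in>?K. \<Sum>\<nu>\<in>?K. if madd \<alpha> \<mu> = madd \<beta> \<nu>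
      then complex_of_real (w \<alpha> \<mu> \<nu>) * (v \<mu> * cnj (v \<nu>)) else 0)"
  define T where "T = (\<lambda>\<alpha> \<beta>. \<Sum>\<mu>\<in>?K. \<Sum>\<nu>\<in>?K. if madd \<alpha> \<mu> = madd \<beta> \<nu>
      then complex_of_real (t \<beta> \<mu> \<nu>) * (v \<mu> * cnj (v \<nu>)) else 0)"
  define \<delta> where "\<delta> = real (m + k) ^ m * (2 * real m / sqrt (real (m + k)))"
  \<comment> \<open>The diagonal coefficient matrix of ||z||^(2 m), from the multinomial
    theorem.\<close>
  define c0 :: "('n \<Rightarrow> nat) \<Rightarrow> ('n \<Rightarrow> nat) \<Rightarrow> complex" where
    "c0 = (\<lambda>\<alpha> \<beta>. if \<alpha> = \<beta> then fact m / complex_of_nat (mfact \<alpha>) else 0)"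
  have k: "k > 0" using d by (simp add: k_def)
  have quad: "quad_form_on ?K (lift_coeff d c) u = fact d * (\<Sum>\<alpha>\<in>?A. \<Sum>\<beta>\<in>?A. c \<alpha> \<beta> * T \<alpha> \<beta>)"
  proof -
    have "quad_form_on ?K (lift_coeff d c) u = (\<Sum>\<gamma>\<in>multi_indices d. \<Sum>\<alpha>\<in>?A. \<Sum>\<beta>\<in>?A. fact d *
        (c \<alpha> \<beta> * (u (madd \<gamma> \<beta>) * cnj (u (madd \<gamma> \<alpha>)) / of_nat (mfact \<gamma>))))"
      unfolding k_def quad_form_lift_coeff sum_distrib_left by (simp add: mult_ac)
    also have "\<dots> = (\<Sum>\<alpha>\<in>?A. \<Sum>\<gamma>\<in>multi_indices d. \<Sum>\<beta>\<in>?A. fact d *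
        (c \<alpha> \<beta> * (u (madd \<gamma> \<beta>) * cnj (u (madd \<gamma> \<alpha>)) / of_nat (mfact \<gamma>))))"
      by (rule sum.swap)
    also have "\<dots> = (\<Sum>\<alpha>\<in>?A. \<Sum>\<beta>\<in>?A. \<Sum>\<gamma>\<in>multi_indices d. fact d *
        (c \<alpha> \<beta> * (u (madd \<gamma> \<beta>) * cnj (u (madd \<gamma> \<alpha>)) / of_nat (mfact \<gamma>))))"
      by (rule sum.cong[OF refl], rule sum.swap)
    also have "\<dots> = (\<Sum>\<alpha>\<in>?A. \<Sum>\<beta>\<in>?A. fact d * (c \<alpha> \<beta> *
        (\<Sum>\<gamma>\<in>multi_indices d. u (madd \<gamma> \<beta>) * cnj (u (madd \<gamma> \<alpha>)) / of_nat (mfact \<gamma>))))"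
      by (simp only: sum_distrib_left)
    also have "\<dots> = (\<Sum>\<alpha>\<in>?A. \<Sum>\<beta>\<in>?A. fact d * (c \<alpha> \<beta> * T \<alpha> \<beta>))"
      unfolding u_def T_def t_def k_def by (intro sum.cong refl) (simp only: wick_form)
    finally show ?thesis by (simp only: sum_distrib_left)
  qed
  have c0: "bihom_poly m c0 z z = complex_of_real (norm z ^ (2 * m))" for z
  proof -
    have "bihom_poly m c0 z z = (\<Sum>\<alpha>\<in>?A. \<Sum>\<beta>\<in>?A. if \<beta> = \<alpha> then fact m / of_nat (mfact \<alpha>) * (mpow z \<alpha> * cnj (mpow z \<alpha>)) else 0)"
      unfolding bihom_poly_def c0_def by (intro sum.cong refl) auto
    also have "\<dots> = herm_inner z z ^ m" unfolding herm_inner_power by simp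
    finally show ?thesis by (simp add: herm_inner_self power_mult)
  qed
  \<comment> \<open>The nonnegative symbol is f - \<epsilon> ||z||^(2 m), so the multiplication form
    of f is bounded below by \<epsilon> times that of ||z||^(2 m).\<close>
  have "0 \<le> Re (\<Sum>\<alpha>\<in>?A. \<Sum>\<beta>\<in>?A. (c \<alpha> \<beta> - complex_of_real \<epsilon> * c0 \<alpha> \<beta>) * W \<alpha> \<beta>)"
  proof -
    have "bihom_poly m (\<lambda>\<alpha> \<beta>. c \<alpha> \<beta> - complex_of_real \<epsilon> * c0 \<alpha> \<beta>) z z
        = bihom_poly m c z z - complex_of_real \<epsilon> * bihom_poly m c0 z z" for z
      unfolding bihom_poly_def by (simp add: sum_subtractf sum_distrib_left algebra_simps)
    then have "0 \<le> Re (bihom_poly m (\<lambda>\<alpha> \<beta>. c \<alpha> \<beta> - complex_of_real \<epsilon> * c0 \<alpha> \<beta>) z z)" for z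
      using low[of z] by (simp add: c0 del: of_real_power)
    from anti_wick_nonneg[OF this, where K = ?K and h = "\<lambda>\<mu>. v \<mu> / complex_of_real (msqrt_fact \<mu>)"]
    moreover have "W \<alpha> \<beta> = (\<Sum>\<mu>\<in>?K. \<Sum>\<nu>\<in>?K. if madd \<alpha> \<mu> = madd \<beta> \<nu> then of_nat (mfact (madd \<alpha> \<mu>)) *
        (v \<mu> / complex_of_real (msqrt_fact \<mu>) * cnj (v \<nu> / complex_of_real (msqrt_fact \<nu>))) else 0)" for \<alpha> \<beta>
      unfolding W_def w_def by (intro sum.cong refl) simp
    ultimately show ?thesis by (simp only:)
  qed
  also have "(\<Sum>\<alpha>\<in>?A. \<Sum>\<beta>\<in>?A. (c \<alpha> \<beta> - complex_of_real \<epsilon> * c0 \<alpha> \<beta>) * W \<alpha> \<beta>)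
      = (\<Sum>\<alpha>\<in>?A. \<Sum>\<beta>\<in>?A. c \<alpha> \<beta> * W \<alpha> \<beta>) - complex_of_real \<epsilon> * (\<Sum>\<alpha>\<in>?A. \<Sum>\<beta>\<in>?A. c0 \<alpha> \<beta> * W \<alpha> \<beta>)"
    by (simp add: sum_subtractf sum_distrib_left algebra_simps)
  finally have cW: "\<epsilon> * Re (\<Sum>\<alpha>\<in>?A. \<Sum>\<beta>\<in>?A. c0 \<alpha> \<beta> * W \<alpha> \<beta>) \<le> Re (\<Sum>\<alpha>\<in>?A. \<Sum>\<beta>\<in>?A. c \<alpha> \<beta> * W \<alpha> \<beta>)"
    by simp
  have Wdiag: "W \<alpha> \<alpha> = complex_of_real (\<Sum>\<mu>\<in>?K. real (mfact (madd \<alpha> \<mu>)) / real (mfact \<mu>) * (cmod (v \<mu>))\<^sup>2)" for \<alpha>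
  proof -
    have "madd \<alpha> \<mu> = madd \<alpha> \<nu> \<longleftrightarrow> \<nu> = \<mu>" for \<mu> \<nu> by (auto simp: fun_eq_iff)
    then have "W \<alpha> \<alpha> = (\<Sum>\<mu>\<in>?K. \<Sum>\<nu>\<in>?K. if \<nu> = \<mu> then complex_of_real (w \<alpha> \<mu> \<mu>) * (v \<mu> * cnj (v \<mu>)) else 0)"
      unfolding W_def by (intro sum.cong refl) simp
    also have "\<dots> = (\<Sum>\<mu>\<in>?K. complex_of_real (w \<alpha> \<mu> \<mu>) * (v \<mu> * cnj (v \<mu>)))" by simp
    also have "\<dots> = complex_of_real (\<Sum>\<mu>\<in>?K. w \<alpha> \<mu> \<mu> * (cmod (v \<mu>))\<^sup>2)"
      by (simp add: complex_norm_square del: of_real_power)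
    also have "(\<Sum>\<mu>\<in>?K. w \<alpha> \<mu> \<mu> * (cmod (v \<mu>))\<^sup>2)
        = (\<Sum>\<mu>\<in>?K. real (mfact (madd \<alpha> \<mu>)) / real (mfact \<mu>) * (cmod (v \<mu>))\<^sup>2)"
      by (simp add: w_def msqrt_fact_def)
    finally show ?thesis .
  qed
  \<comment> \<open>The power of k arises from (\<alpha> + \<mu>)! / \<mu>! \<ge> \<mu>^\<alpha>
    together with the multinomial theorem, which sums m!/\<alpha>! \<mu>^\<alpha> over \<alpha> to
    |\<mu>|^m.\<close>
  have main: "real k ^ m * norm_sq_on ?K v \<le> Re (\<Sum>\<alpha>\<in>?A. \<Sum>\<beta>\<in>?A. c0 \<alpha> \<beta> * W \<alpha> \<beta>)"
  proof -
    have ratio: "(\<Prod>j\<in>UNIV. real (\<mu> j) ^ \<alpha> j) \<le> real (mfact (madd \<alpha> \<mu>)) / real (mfact \<mu>)" for \<alpha> \<mu> :: "'n \<Rightarrow> nat"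
    proof -
      have "(\<Prod>j\<in>UNIV. real (\<mu> j) ^ \<alpha> j) \<le> (\<Prod>j\<in>UNIV. fact (\<mu> j + \<alpha> j) / fact (\<mu> j))"
        by (intro prod_mono conjI fact_ratio_bounds(1)) auto
      then show ?thesis by (simp add: prod_dividef mfact_def add.commute)
    qed
    have multinom: "(\<Sum>\<alpha>\<in>?A. fact m / real (mfact \<alpha>) * (\<Prod>j\<in>UNIV. real (\<mu> j) ^ \<alpha> j)) = real k ^ m"
      if "\<mu> \<in> ?K" for \<mu>
    proof -
      have "complex_of_real (\<Sum>\<alpha>\<in>?A. fact m / real (mfact \<alpha>) * (\<Prod>j\<in>UNIV. real (\<mu> j) ^ \<alpha> j))
          = (\<Sum>j\<in>UNIV. of_nat (\<mu> j)) ^ m"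
        unfolding multinomial_theorem by simp
      also have "(\<Sum>j\<in>UNIV. complex_of_nat (\<mu> j)) = of_nat k"
        using that by (simp add: multi_indices_def flip: of_nat_sum)
      also have "complex_of_nat k ^ m = complex_of_real (real k ^ m)" by simp
      finally show ?thesis by (simp only: of_real_eq_iff)
    qed
    have "real k ^ m * norm_sq_on ?K v = (\<Sum>\<mu>\<in>?K. real k ^ m * (cmod (v \<mu>))\<^sup>2)"
      by (simp add: norm_sq_on_def sum_distrib_left)
    also have "\<dots> = (\<Sum>\<mu>\<in>?K. (\<Sum>\<alpha>\<in>?A. fact m / real (mfact \<alpha>) * (\<Prod>j\<in>UNIV. real (\<mu> j) ^ \<alpha> j)) * (cmod (v \<mu>))\<^sup>2)"
      by (intro sum.cong refl) (simp only: multinom)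
    also have "\<dots> = (\<Sum>\<mu>\<in>?K. \<Sum>\<alpha>\<in>?A. fact m / real (mfact \<alpha>) * (\<Prod>j\<in>UNIV. real (\<mu> j) ^ \<alpha> j) * (cmod (v \<mu>))\<^sup>2)"
      by (simp only: sum_distrib_right)
    also have "\<dots> \<le> (\<Sum>\<mu>\<in>?K. \<Sum>\<alpha>\<in>?A. fact m / real (mfact \<alpha>) * (real (mfact (madd \<alpha> \<mu>)) / real (mfact \<mu>)) * (cmod (v \<mu>))\<^sup>2)"
      by (intro sum_mono mult_right_mono mult_left_mono ratio) auto
    also have "\<dots> = (\<Sum>\<alpha>\<in>?A. \<Sum>\<mu>\<in>?K. fact m / real (mfact \<alpha>) * (real (mfact (madd \<alpha> \<mu>)) / real (mfact \<mu>)) * (cmod (v \<mu>))\<^sup>2)"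
      by (rule sum.swap)
    also have "\<dots> = Re (\<Sum>\<alpha>\<in>?A. fact m / of_nat (mfact \<alpha>) * W \<alpha> \<alpha>)"
    proof -
      have "fact m / of_nat (mfact \<alpha>) * W \<alpha> \<alpha>
        = complex_of_real (\<Sum>\<mu>\<in>?K. fact m / real (mfact \<alpha>) * (real (mfact (madd \<alpha> \<mu>)) / real (mfact \<mu>)) * (cmod (v \<mu>))\<^sup>2)" for \<alpha>
        unfolding Wdiag by (simp add: sum_distrib_left mult.assoc)
      then show ?thesis by (simp del: of_real_sum of_real_mult)
    qed
    also have "(\<Sum>\<alpha>\<in>?A. fact m / of_nat (mfact \<alpha>) * W \<alpha> \<alpha>) = (\<Sum>\<alpha>\<in>?A. \<Sum>\<beta>\<in>?A. c0 \<alpha> \<beta> * W \<alpha> \<beta>)"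
    proof (rule sum.cong[OF refl])
      fix \<alpha> assume \<alpha>: "\<alpha> \<in> ?A"
      have "(\<Sum>\<beta>\<in>?A. c0 \<alpha> \<beta> * W \<alpha> \<beta>) = (\<Sum>\<beta>\<in>?A. if \<beta> = \<alpha> then fact m / of_nat (mfact \<alpha>) * W \<alpha> \<alpha> else 0)"
        by (intro sum.cong refl) (auto simp: c0_def)
      then show "fact m / of_nat (mfact \<alpha>) * W \<alpha> \<alpha> = (\<Sum>\<beta>\<in>?A. c0 \<alpha> \<beta> * W \<alpha> \<beta>)" using \<alpha> by simp
    qed
    finally show ?thesis .
  qed
  \<comment> \<open>For fixed \<alpha>, \<beta> each of \<mu> and \<nu> determines the other, so the
    bound \<delta> on the entries passes to the form by the Schur test.\<close>
  have WT: "cmod (W \<alpha> \<beta> - T \<alpha> \<beta>) \<le> \<delta> * norm_sq_on ?K v" if \<alpha>: "\<alpha> \<in> ?A" and \<beta>: "\<beta> \<in> ?A" for \<alpha> \<beta>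
  proof -
    have diff: "W \<alpha> \<beta> - T \<alpha> \<beta> = (\<Sum>\<mu>\<in>?K. \<Sum>\<nu>\<in>?K. if madd \<alpha> \<mu> = madd \<beta> \<nu>
        then complex_of_real (w \<alpha> \<mu> \<nu> - t \<beta> \<mu> \<nu>) * (v \<mu> * cnj (v \<nu>)) else 0)"
      unfolding W_def T_def sum_subtractf[symmetric]
      by (intro sum.cong refl) (auto simp: algebra_simps)
    have "cmod (W \<alpha> \<beta> - T \<alpha> \<beta>) \<le> (\<Sum>\<mu>\<in>?K. \<Sum>\<nu>\<in>?K. \<delta> * (if madd \<alpha> \<mu> = madd \<beta> \<nu> then cmod (v \<mu>) * cmod (v \<nu>) else 0))"
      unfolding diff
    proof (intro sum_norm_le)
      fix \<mu> \<nu> assume \<mu>: "\<mu> \<in> ?K" and \<nu>: "\<nu> \<in> ?K"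
      show "cmod (if madd \<alpha> \<mu> = madd \<beta> \<nu> then complex_of_real (w \<alpha> \<mu> \<nu> - t \<beta> \<mu> \<nu>) * (v \<mu> * cnj (v \<nu>)) else 0)
          \<le> \<delta> * (if madd \<alpha> \<mu> = madd \<beta> \<nu> then cmod (v \<mu>) * cmod (v \<nu>) else 0)"
      proof (cases "madd \<alpha> \<mu> = madd \<beta> \<nu>")
        case True
        have "\<bar>w \<alpha> \<mu> \<nu> - t \<beta> \<mu> \<nu>\<bar> \<le> \<delta>"
          unfolding w_def t_def \<delta>_def by (rule wick_weight_diff[OF \<alpha> \<beta> \<mu> True k])
        then have "\<bar>w \<alpha> \<mu> \<nu> - t \<beta> \<mu> \<nu>\<bar> * (cmod (v \<mu>) * cmod (v \<nu>)) \<le> \<delta> * (cmod (v \<mu>) * cmod (v \<nu>))"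
          by (intro mult_right_mono) auto
        then show ?thesis unfolding if_P[OF True] by (simp only: norm_mult norm_of_real complex_mod_cnj)
      next
        case False
        show ?thesis unfolding if_not_P[OF False] by simp
      qed
    qed
    also have "\<dots> = \<delta> * (\<Sum>\<mu>\<in>?K. \<Sum>\<nu>\<in>?K. if madd \<alpha> \<mu> = madd \<beta> \<nu> then cmod (v \<mu>) * cmod (v \<nu>) else 0)"
      unfolding sum_distrib_left ..
    also have "\<dots> \<le> \<delta> * norm_sq_on ?K v"
    proof (rule mult_left_mono)
      show "(\<Sum>\<mu>\<in>?K. \<Sum>\<nu>\<in>?K. if madd \<alpha> \<mu> = madd \<beta> \<nu> then cmod (v \<mu>) * cmod (v \<nu>) else 0) \<le> norm_sq_on ?K v"
        unfolding norm_sq_on_def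
      proof (rule schur_partial_injection)
        show "\<nu> = \<nu>'" if "madd \<alpha> \<mu> = madd \<beta> \<nu>" "madd \<alpha> \<mu> = madd \<beta> \<nu>'" for \<mu> \<nu> \<nu>'
        proof
          fix j show "\<nu> j = \<nu>' j" using fun_cong[OF that(1), of j] fun_cong[OF that(2), of j] by linarith
        qed
        show "\<mu> = \<mu>'" if "madd \<alpha> \<mu> = madd \<beta> \<nu>" "madd \<alpha> \<mu>' = madd \<beta> \<nu>" for \<mu> \<mu>' \<nu>
        proof
          fix j show "\<mu> j = \<mu>' j" using fun_cong[OF that(1), of j] fun_cong[OF that(2), of j] by linarith
        qed
      qed simp
    qed (simp add: \<delta>_def)
    finally show ?thesis .
  qed
  have "Re (\<Sum>\<alpha>\<in>?A. \<Sum>\<beta>\<in>?A. c \<alpha> \<beta> * W \<alpha> \<beta>) - Re (\<Sum>\<alpha>\<in>?A. \<Sum>\<beta>\<in>?A. c \<alpha> \<beta> * T \<alpha> \<beta>)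
      = Re (\<Sum>\<alpha>\<in>?A. \<Sum>\<beta>\<in>?A. c \<alpha> \<beta> * (W \<alpha> \<beta> - T \<alpha> \<beta>))"
    by (simp only: right_diff_distrib sum_subtractf minus_complex.sel)
  also have "\<dots> \<le> cmod (\<Sum>\<alpha>\<in>?A. \<Sum>\<beta>\<in>?A. c \<alpha> \<beta> * (W \<alpha> \<beta> - T \<alpha> \<beta>))" by (rule complex_Re_le_cmod)
  also have "\<dots> \<le> (\<Sum>\<alpha>\<in>?A. \<Sum>\<beta>\<in>?A. cmod (c \<alpha> \<beta>) * (\<delta> * norm_sq_on ?K v))"
    by (intro sum_norm_le) (auto simp: norm_mult intro!: mult_left_mono WT)
  also have "\<dots> = C * \<delta> * norm_sq_on ?K v"
    by (simp add: C_def sum_distrib_right mult.assoc)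
  finally have "Re (\<Sum>\<alpha>\<in>?A. \<Sum>\<beta>\<in>?A. c \<alpha> \<beta> * W \<alpha> \<beta>) - C * \<delta> * norm_sq_on ?K v
      \<le> Re (\<Sum>\<alpha>\<in>?A. \<Sum>\<beta>\<in>?A. c \<alpha> \<beta> * T \<alpha> \<beta>)" by linarith
  moreover have "\<epsilon> * (real k ^ m * norm_sq_on ?K v) \<le> Re (\<Sum>\<alpha>\<in>?A. \<Sum>\<beta>\<in>?A. c \<alpha> \<beta> * W \<alpha> \<beta>)"
    using mult_left_mono[OF main, of \<epsilon>] \<epsilon> cW by linarith
  moreover have "Re (quad_form_on ?K (lift_coeff d c) u) / fact d = Re (\<Sum>\<alpha>\<in>?A. \<Sum>\<beta>\<in>?A. c \<alpha> \<beta> * T \<alpha> \<beta>)"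
  proof -
    have "Re (fact d * x) = fact d * Re x" for x :: complex
      using Re_complex_of_real[of "fact d"] Im_complex_of_real[of "fact d"] unfolding of_real_fact by simp
    then show ?thesis unfolding quad by (simp only:) simp
  qed
  ultimately show ?thesis unfolding \<delta>_def[symmetric] by (simp add: algebra_simps)
qed

lemma quillen_pos_def:
  fixes c :: "('n::finite \<Rightarrow> nat) \<Rightarrow> ('n \<Rightarrow> nat) \<Rightarrow> complex"
  assumes herm: "hermitian_on (multi_indices m) c"
    and low: "\<And>z. \<epsilon> * norm z ^ (2 * m) \<le> Re (bihom_poly m c z z)" and \<epsilon>: "\<epsilon> > 0"
  shows "\<exists>d\<ge>1. pos_def_on (multi_indices (m + d)) (lift_coeff d c)"
proof -
  define C where "C = (\<Sum>\<alpha>\<in>multi_indices m. \<Sum>\<beta>\<in>multi_indices m. cmod (c \<alpha> \<beta>))"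
  have C: "C \<ge> 0" by (simp add: C_def sum_nonneg)
  \<comment> \<open>With m + k \<le> 2 k the error is at most C (2 k)^m 2 m / sqrt (m + k). It is
    below \<epsilon> k^m as soon as sqrt (m + k) exceeds \<open>B\<close>.\<close>
  define B where "B = C * 2 ^ m * (2 * real m) / \<epsilon>"
  \<comment> \<open>The summand 1 forces d \<ge> 1 even if B = 0, for instance when m = 0.\<close>
  obtain d :: nat where d: "real d > B\<^sup>2 + 1" using reals_Archimedean2 by blast
  have "real d > 1" using d by (smt (verit) zero_le_power2)
  then have d1: "d \<ge> 1" by simp
  define k where "k = m + d"
  have "B \<le> sqrt (B\<^sup>2)" by simp
  also have "\<dots> < sqrt (real (m + k))" using d by (intro real_sqrt_less_mono) (simp add: k_def)
  finally have Bk: "B < sqrt (real (m + k))" .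
  have k0: "real k > 0" using d1 by (simp add: k_def)
  have "C * (real (m + k) ^ m * (2 * real m / sqrt (real (m + k)))) < \<epsilon> * real k ^ m"
  proof -
    have sq: "sqrt (real (m + k)) > 0" using k0 by simp
    have "real (m + k) ^ m \<le> (2 * real k) ^ m" by (intro power_mono) (auto simp: k_def)
    then have "C * (real (m + k) ^ m * (2 * real m / sqrt (real (m + k))))
        \<le> C * ((2 * real k) ^ m * (2 * real m / sqrt (real (m + k))))"
      using C by (intro mult_left_mono mult_right_mono) auto
    also have "\<dots> = B * \<epsilon> * real k ^ m / sqrt (real (m + k))"
      using \<epsilon> by (simp add: B_def power_mult_distrib)
    also have "\<dots> < \<epsilon> * real k ^ m"
    proof -
      have "B * (\<epsilon> * real k ^ m) < sqrt (real (m + k)) * (\<epsilon> * real k ^ m)"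
        using Bk \<epsilon> k0 by (intro mult_strict_right_mono) auto
      then show ?thesis using sq by (simp add: divide_less_eq mult_ac)
    qed
    finally show ?thesis .
  qed
  then have pos: "\<epsilon> * real k ^ m - C * (real (m + k) ^ m * (2 * real m / sqrt (real (m + k)))) > 0" by simp
  have "0 < Re (quad_form_on (multi_indices k) (lift_coeff d c) u)" if u: "\<exists>\<mu>\<in>multi_indices k. u \<mu> \<noteq> 0" for u
  proof -
    define v where "v = (\<lambda>\<mu>. u \<mu> / complex_of_real (msqrt_fact \<mu>))"
    have uv: "u = (\<lambda>\<mu>. complex_of_real (msqrt_fact \<mu>) * v \<mu>)"
      using msqrt_fact_pos[THEN less_imp_neq] by (auto simp: v_def fun_eq_iff)
    have "norm_sq_on (multi_indices k) v \<noteq> 0"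
      using u uv by (auto simp: norm_sq_on_eq_0_iff)
    then have "norm_sq_on (multi_indices k) v > 0"
      using norm_sq_on_nonneg[of "multi_indices k" v] by linarith
    then have "0 < (\<epsilon> * real k ^ m - C * (real (m + k) ^ m * (2 * real m / sqrt (real (m + k)))))
        * norm_sq_on (multi_indices k) v" using pos by simp
    also have "\<dots> \<le> Re (quad_form_on (multi_indices k) (lift_coeff d c) u) / fact d"
      unfolding uv C_def k_def by (rule quillen_estimate[OF low \<epsilon> d1])
    finally show ?thesis by (simp add: zero_less_divide_iff)
  qed
  then have "pos_def_on (multi_indices (m + d)) (lift_coeff d c)"
    unfolding pos_def_on_def k_def using hermitian_lift_coeff[OF herm] by blast
  then show ?thesis using d1 by blast
qed

section \<open>The integral operator on the ball\<close>

lemma integrable_on_ball: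
  fixes \<phi> :: "complex ^ 'n::finite \<Rightarrow> complex"
  assumes "continuous_on UNIV \<phi>"
  shows "set_integrable lborel (ball 0 1) \<phi>"
proof (rule set_integrable_subset)
  show "set_integrable lborel (cball 0 1) \<phi>"
    unfolding set_integrable_def
    by (rule borel_integrable_compact) (auto intro: continuous_on_subset[OF assms])
qed (auto intro: ball_subset_cball)

lemma ball_integral_sum:
  fixes \<phi> :: "'s \<Rightarrow> complex ^ 'n::finite \<Rightarrow> complex"
  assumes "\<And>s. s \<in> S \<Longrightarrow> continuous_on UNIV (\<phi> s)"
  shows "(LINT z : ball 0 1 | lborel. (\<Sum>s\<in>S. a s * \<phi> s z)) = (\<Sum>s\<in>S. a s * (LINT z : ball 0 1 | lborel. \<phi> s z))"
proof -
  have int: "integrable lborel (\<lambda>z. indicat_real (ball 0 1) z *\<^sub>R \<phi> s z)" if "s \<in> S" for s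
    using integrable_on_ball[OF assms[OF that]] by (simp add: set_integrable_def)
  have "(LINT z : ball 0 1 | lborel. (\<Sum>s\<in>S. a s * \<phi> s z))
      = (\<integral>z. (\<Sum>s\<in>S. a s * (indicat_real (ball 0 1) z *\<^sub>R \<phi> s z)) \<partial>lborel)"
    unfolding set_lebesgue_integral_def
    by (intro Bochner_Integration.integral_cong refl) (simp add: scaleR_sum_right)
  also have "\<dots> = (\<Sum>s\<in>S. (\<integral>z. a s * (indicat_real (ball 0 1) z *\<^sub>R \<phi> s z) \<partial>lborel))"
    by (rule Bochner_Integration.integral_sum) (intro integrable_mult_right int)
  also have "\<dots> = (\<Sum>s\<in>S. a s * (\<integral>z. indicat_real (ball 0 1) z *\<^sub>R \<phi> s z \<partial>lborel))"
    by (simp only: integral_mult_right_zero)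
  finally show ?thesis by (simp only: set_lebesgue_integral_def)
qed

lemma ball_inner_commute: "ball_inner h g = cnj (ball_inner g h)"
proof -
  have "cnj (ball_inner g h) = (\<integral>z. cnj (indicat_real (ball 0 1) z *\<^sub>R (g z * cnj (h z))) \<partial>lborel)"
    unfolding ball_inner_def set_lebesgue_integral_def by (simp only: Bochner_Integration.integral_cnj)
  also have "\<dots> = ball_inner h g"
    unfolding ball_inner_def set_lebesgue_integral_def
    by (intro Bochner_Integration.integral_cong refl) (simp add: mult.commute)
  finally show ?thesis by simp
qed

lemma ball_inner_sum_left:
  fixes h :: "complex ^ 'n::finite \<Rightarrow> complex"
  assumes "continuous_on UNIV h"
  shows "ball_inner (\<lambda>z. \<Sum>\<alpha>\<in>S. a \<alpha> * mpow z \<alpha>) h = (\<Sum>\<alpha>\<in>S. a \<alpha> * ball_inner (\<lambda>z. mpow z \<alpha>) h)"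
  unfolding ball_inner_def sum_distrib_right mult.assoc
  by (rule ball_integral_sum) (intro continuous_intros assms)

lemma continuous_on_hom_poly_space:
  assumes "g \<in> hom_poly_space k"
  shows "continuous_on S g"
proof -
  obtain a where "\<And>z. g z = (\<Sum>\<alpha>\<in>multi_indices k. a \<alpha> * mpow z \<alpha>)"
    using assms by (auto simp: hom_poly_space_def)
  then have "g = (\<lambda>z. \<Sum>\<alpha>\<in>multi_indices k. a \<alpha> * mpow z \<alpha>)" by (rule ext)
  then show ?thesis by (simp only:) (intro continuous_intros)
qed

text \<open>The points of the ball where \<open>g\<close> is nonzero form an open null set, and such
  a set is empty.\<close>

lemma ball_inner_self_eq_0:
  fixes g :: "complex ^ 'n::finite \<Rightarrow> complex"
  assumes g: "continuous_on UNIV g" and 0: "Re (ball_inner g g) = 0" and z: "z \<in> ball 0 1"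
  shows "g z = 0"
proof (rule ccontr)
  assume gz: "g z \<noteq> 0"
  define U where "U = {w \<in> ball 0 1. g w \<noteq> 0}"
  have U: "open U"
  proof -
    have "open (g -` (- {0}))" using g by (intro open_vimage) auto
    then have "open (ball 0 1 \<inter> g -` (- {0}))" by (intro open_Int) auto
    moreover have "U = ball 0 1 \<inter> g -` (- {0})" by (auto simp: U_def)
    ultimately show ?thesis by simp
  qed
  let ?\<phi> = "\<lambda>w. indicat_real (ball 0 1) w * (cmod (g w))\<^sup>2"
  have int: "integrable lborel (\<lambda>w. indicat_real (ball 0 1) w *\<^sub>R (g w * cnj (g w)))"
    using integrable_on_ball[of "\<lambda>w. g w * cnj (g w)"] g
    by (simp add: set_integrable_def continuous_intros)
  have \<phi>: "indicat_real (ball 0 1) w *\<^sub>R (g w * cnj (g w)) = complex_of_real (?\<phi> w)" for w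
    by (simp add: complex_norm_square[symmetric] scaleR_conv_of_real del: of_real_power)
  have "complex_of_real (\<integral>w. ?\<phi> w \<partial>lborel) = ball_inner g g"
    unfolding ball_inner_def set_lebesgue_integral_def \<phi> by (simp only: integral_complex_of_real)
  then have "(\<integral>w. ?\<phi> w \<partial>lborel) = 0" using 0 by (metis Re_complex_of_real)
  moreover have "integrable lborel ?\<phi>"
    using int unfolding \<phi> complex_of_real_integrable_eq .
  ultimately have "AE w in lborel. ?\<phi> w = 0"
    by (subst (asm) integral_nonneg_eq_0_iff_AE) auto
  then have "AE w in lborel. w \<notin> U" by eventually_elim (auto simp: U_def)
  then have "U \<in> null_sets lborel"
    using AE_iff_null_sets[of U lborel] U by auto
  then have "negligible U" by (simp add: negligible_iff_null_sets null_sets_completionI)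
  moreover have "z \<in> U" using gz z by (simp add: U_def)
  ultimately show False using open_not_negligible[OF U] by auto
qed

text \<open>Integrating the polynomial against the conjugate of z^\<nu> with the Gaussian isolates
  a_\<nu> \<nu>!.\<close>

lemma hom_poly_coeff_eq_0:
  fixes a :: "('n::finite \<Rightarrow> nat) \<Rightarrow> complex"
  assumes 0: "\<And>z. (\<Sum>\<alpha>\<in>multi_indices k. a \<alpha> * mpow z \<alpha>) = 0" and \<nu>: "\<nu> \<in> multi_indices k"
  shows "a \<nu> = 0"
proof -
  obtain M :: "('n + 'n \<Rightarrow> real) measure" and Z :: "('n + 'n \<Rightarrow> real) \<Rightarrow> complex ^ 'n"
    where int: "\<And>\<alpha> \<beta>. integrable M (\<lambda>x. mpow (Z x) \<alpha> * cnj (mpow (Z x) \<beta>))"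
      and mom: "\<And>\<alpha> \<beta>. (\<integral>x. mpow (Z x) \<alpha> * cnj (mpow (Z x) \<beta>) \<partial>M)
                  = (if \<alpha> = \<beta> then of_nat (mfact \<alpha>) else 0)"
    using gaussian_moments by blast
  have "0 = (\<integral>x. (\<Sum>\<alpha>\<in>multi_indices k. a \<alpha> * mpow (Z x) \<alpha>) * cnj (mpow (Z x) \<nu>) \<partial>M)"
    by (simp add: 0)
  also have "\<dots> = (\<integral>x. (\<Sum>\<alpha>\<in>multi_indices k. a \<alpha> * (mpow (Z x) \<alpha> * cnj (mpow (Z x) \<nu>))) \<partial>M)"
    by (simp only: sum_distrib_right mult.assoc)
  also have "\<dots> = (\<Sum>\<alpha>\<in>multi_indices k. a \<alpha> * (\<integral>x. mpow (Z x) \<alpha> * cnj (mpow (Z x) \<nu>) \<partial>M))"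
    by (simp only: Bochner_Integration.integral_sum integrable_mult_right int integral_mult_right_zero)
  also have "\<dots> = (\<Sum>\<alpha>\<in>multi_indices k. if \<alpha> = \<nu> then a \<alpha> * of_nat (mfact \<alpha>) else 0)"
    by (intro sum.cong refl) (simp add: mom)
  also have "\<dots> = a \<nu> * of_nat (mfact \<nu>)" using \<nu> by simp
  finally show ?thesis using mfact_pos[of \<nu>] by simp
qed

text \<open>The row index belongs to the conjugated monomial, so that applying the matrix to the
  coefficients of a polynomial gives its inner products with the monomials.\<close>

definition ball_gram :: "('n::finite \<Rightarrow> nat) \<Rightarrow> ('n \<Rightarrow> nat) \<Rightarrow> complex" where
  "ball_gram \<nu> \<alpha> = ball_inner (\<lambda>z. mpow z \<alpha>) (\<lambda>z. mpow z \<nu>)"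

lemma ball_inner_mpow:
  fixes a :: "('n::finite \<Rightarrow> nat) \<Rightarrow> complex"
  shows "ball_inner (\<lambda>z. \<Sum>\<alpha>\<in>K. a \<alpha> * mpow z \<alpha>) (\<lambda>z. mpow z \<nu>) = mat_vec_on K ball_gram a \<nu>"
  by (subst ball_inner_sum_left) (auto simp: mat_vec_on_def ball_gram_def mult.commute intro: continuous_intros)

lemma ball_inner_combination:
  fixes b :: "('n::finite \<Rightarrow> nat) \<Rightarrow> complex"
  assumes "continuous_on UNIV g"
  shows "ball_inner (\<lambda>z. \<Sum>\<mu>\<in>K. b \<mu> * mpow z \<mu>) g = (\<Sum>\<mu>\<in>K. b \<mu> * cnj (ball_inner g (\<lambda>z. mpow z \<mu>)))"
  by (subst ball_inner_sum_left[OF assms]) (simp only: ball_inner_commute[of "\<lambda>z. mpow z _" g])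

lemma quad_form_ball_gram:
  fixes a :: "('n::finite \<Rightarrow> nat) \<Rightarrow> complex" and K :: "('n \<Rightarrow> nat) set"
  defines "g \<equiv> (\<lambda>z. \<Sum>\<alpha>\<in>K. a \<alpha> * mpow z \<alpha>)"
  shows "quad_form_on K ball_gram a = ball_inner g g"
proof -
  have g: "continuous_on UNIV g" unfolding g_def by (intro continuous_intros)
  have "cnj (ball_inner g g) = cnj (\<Sum>\<mu>\<in>K. a \<mu> * cnj (ball_inner g (\<lambda>z. mpow z \<mu>)))"
    using ball_inner_combination[OF g, of a K] by (simp only: g_def)
  then have "ball_inner g g = (\<Sum>\<mu>\<in>K. cnj (a \<mu>) * ball_inner g (\<lambda>z. mpow z \<mu>))"
    unfolding ball_inner_commute[symmetric, of g g] by simp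
  then show ?thesis unfolding quad_form_on_def g_def ball_inner_mpow by (simp add: mult.commute)
qed

text \<open>A polynomial of norm 0 vanishes on the ball, hence everywhere by homogeneity, as every
  point can be scaled into the ball. Its coefficients are then 0.\<close>

lemma pos_def_ball_gram: "pos_def_on (multi_indices k :: ('n::finite \<Rightarrow> nat) set) ball_gram"
  unfolding pos_def_on_def
proof (intro conjI allI impI)
  let ?K = "multi_indices k :: ('n \<Rightarrow> nat) set"
  show "hermitian_on ?K ball_gram"
    by (simp add: hermitian_on_def ball_gram_def ball_inner_commute[symmetric])
  fix a :: "('n \<Rightarrow> nat) \<Rightarrow> complex" assume a: "\<exists>\<mu>\<in>?K. a \<mu> \<noteq> 0"
  define g where "g = (\<lambda>z. \<Sum>\<alpha>\<in>?K. a \<alpha> * mpow z \<alpha>)"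
  have g: "continuous_on UNIV g" unfolding g_def by (intro continuous_intros)
  have "Re (ball_inner g g) = (\<integral>w. Re (indicat_real (ball 0 1) w *\<^sub>R (g w * cnj (g w))) \<partial>lborel)"
    unfolding ball_inner_def set_lebesgue_integral_def
    using integrable_on_ball[of "\<lambda>w. g w * cnj (g w)"] g
    by (intro integral_Re[symmetric]) (simp add: set_integrable_def continuous_intros)
  also have "\<dots> \<ge> 0"
    by (rule Bochner_Integration.integral_nonneg) (simp add: complex_norm_square[symmetric] del: of_real_power)
  finally have "Re (ball_inner g g) \<ge> 0" .
  moreover have "Re (ball_inner g g) \<noteq> 0"
  proof
    assume 0: "Re (ball_inner g g) = 0"
    have "g z = 0" for z
    proof -
      define r where "r = 1 / (norm z + 1)"
      have r: "r > 0" "norm z * r < 1" by (auto simp: r_def divide_less_eq add_nonneg_pos)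
      have "g (r *\<^sub>R z) = 0"
        using r by (intro ball_inner_self_eq_0[OF g 0]) (simp add: mult.commute)
      moreover have "g (r *\<^sub>R z) = complex_of_real r ^ k * g z"
        unfolding g_def sum_distrib_left
        by (intro sum.cong refl) (simp add: mpow_scaleR multi_indices_def mult_ac)
      ultimately show ?thesis using r by simp
    qed
    then have "(\<Sum>\<alpha>\<in>?K. a \<alpha> * mpow z \<alpha>) = 0" for z by (simp add: g_def)
    from hom_poly_coeff_eq_0[OF this] show False using a by blast
  qed
  ultimately show "0 < Re (quad_form_on ?K ball_gram a)"
    unfolding quad_form_ball_gram g_def[symmetric] by linarith
qed

text \<open>Stated for all continuous \<open>g\<close>, so that linearity of the operator can be
  verified on sums and multiples without first returning them to
  \<open>hom_poly_space\<close>.\<close>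

lemma kernel_operator_bihom_poly:
  fixes E :: "('n::finite \<Rightarrow> nat) \<Rightarrow> ('n \<Rightarrow> nat) \<Rightarrow> complex"
  assumes "continuous_on UNIV g"
  shows "kernel_operator (bihom_poly k E) g z
    = (\<Sum>\<mu>\<in>multi_indices k. mat_vec_on (multi_indices k) E (\<lambda>\<nu>. ball_inner g (\<lambda>z. mpow z \<nu>)) \<mu> * mpow z \<mu>)"
proof -
  let ?K = "multi_indices k :: ('n \<Rightarrow> nat) set"
  have "bihom_poly k E z \<zeta> * g \<zeta>
      = (\<Sum>s\<in>?K \<times> ?K. (E (fst s) (snd s) * mpow z (fst s)) * (g \<zeta> * cnj (mpow \<zeta> (snd s))))" for \<zeta>
    unfolding bihom_poly_def sum.cartesian_product sum_distrib_right by (simp add: case_prod_beta mult_ac)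
  then have "kernel_operator (bihom_poly k E) g z
      = (\<Sum>s\<in>?K \<times> ?K. (E (fst s) (snd s) * mpow z (fst s)) * ball_inner g (\<lambda>z. mpow z (snd s)))"
    unfolding kernel_operator_def ball_inner_def
    by (simp only:) (rule ball_integral_sum, intro continuous_intros assms)
  also have "\<dots> = (\<Sum>\<mu>\<in>?K. \<Sum>\<nu>\<in>?K. (E \<mu> \<nu> * mpow z \<mu>) * ball_inner g (\<lambda>z. mpow z \<nu>))"
    unfolding sum.cartesian_product by (simp add: case_prod_beta)
  finally show ?thesis
    unfolding mat_vec_on_def sum_distrib_right by (simp add: mult_ac)
qed

text \<open>In one direction every vector \<open>u\<close> is the family of inner products of some
  polynomial with the monomials, since the Gram matrix is invertible. In the other, the constant is
  the product of the coercivity constants of \<open>E\<close> and of the Gram matrix.\<close>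

lemma positive_operator_iff_pos_def:
  fixes E :: "('n::finite \<Rightarrow> nat) \<Rightarrow> ('n \<Rightarrow> nat) \<Rightarrow> complex"
  assumes herm: "hermitian_on (multi_indices k) E"
  shows "positive_operator_on (hom_poly_space k) (kernel_operator (bihom_poly k E))
    \<longleftrightarrow> pos_def_on (multi_indices k) E"
proof -
  let ?K = "multi_indices k :: ('n \<Rightarrow> nat) set"
  let ?R = "kernel_operator (bihom_poly k E)"
  define y where "y = (\<lambda>(g :: complex^'n \<Rightarrow> complex) \<nu>. ball_inner g (\<lambda>z. mpow z \<nu>))"
  have R_cont: "?R g z = (\<Sum>\<mu>\<in>?K. mat_vec_on ?K E (y g) \<mu> * mpow z \<mu>)" if "continuous_on UNIV g" for g z
    unfolding y_def by (rule kernel_operator_bihom_poly[OF that])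
  note R = R_cont[OF continuous_on_hom_poly_space]
  have RV: "?R g \<in> hom_poly_space k" if "g \<in> hom_poly_space k" for g
    unfolding hom_poly_space_def using R[OF that] by blast
  have quad: "ball_inner (?R g) g = quad_form_on ?K E (y g)" if g: "g \<in> hom_poly_space k" for g
  proof -
    have "?R g = (\<lambda>z. \<Sum>\<mu>\<in>?K. mat_vec_on ?K E (y g) \<mu> * mpow z \<mu>)" using R[OF g] by (rule ext)
    then show ?thesis
      using ball_inner_combination[OF continuous_on_hom_poly_space[OF g], of "mat_vec_on ?K E (y g)" ?K]
      by (simp only: quad_form_on_def y_def)
  qed
  have real: "quad_form_on ?K E u \<in> \<real>" for u
  proof -
    have "cnj (quad_form_on ?K E u) = quad_form_on ?K E u"
      unfolding quad_form_eq_inner inner_on_commute[symmetric] by (rule inner_on_hermitian[OF herm, symmetric])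
    then show ?thesis by (simp add: Reals_cnj_iff)
  qed
  have repr: "\<exists>a. g = (\<lambda>z. \<Sum>\<alpha>\<in>?K. a \<alpha> * mpow z \<alpha>) \<and> y g = mat_vec_on ?K ball_gram a
      \<and> ball_inner g g = quad_form_on ?K ball_gram a" if "g \<in> hom_poly_space k" for g
  proof -
    obtain a where "\<And>z. g z = (\<Sum>\<alpha>\<in>?K. a \<alpha> * mpow z \<alpha>)"
      using \<open>g \<in> hom_poly_space k\<close> by (auto simp: hom_poly_space_def)
    then have g: "g = (\<lambda>z. \<Sum>\<alpha>\<in>?K. a \<alpha> * mpow z \<alpha>)" by (rule ext)
    have "y g = mat_vec_on ?K ball_gram a" unfolding y_def g ball_inner_mpow ..
    moreover have "ball_inner g g = quad_form_on ?K ball_gram a" unfolding g quad_form_ball_gram ..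
    ultimately show ?thesis using g by blast
  qed
  have additive: "?R (\<lambda>z. g z + h z) = (\<lambda>z. ?R g z + ?R h z)"
    if g: "g \<in> hom_poly_space k" and h: "h \<in> hom_poly_space k" for g h
  proof -
    have cont: "continuous_on UNIV g" "continuous_on UNIV h"
      using g h by (auto intro: continuous_on_hom_poly_space)
    have "y (\<lambda>z. g z + h z) \<nu> = y g \<nu> + y h \<nu>" for \<nu>
    proof -
      have "set_integrable lborel (ball 0 1) (\<lambda>z. g z * cnj (mpow z \<nu>))"
        "set_integrable lborel (ball 0 1) (\<lambda>z. h z * cnj (mpow z \<nu>))"
        by (intro integrable_on_ball continuous_intros cont)+
      then show ?thesis unfolding y_def ball_inner_def distrib_right by (rule set_integral_add)
    qed
    then have yadd: "y (\<lambda>z. g z + h z) = (\<lambda>\<nu>. y g \<nu> + y h \<nu>)" by (rule ext)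
    have "continuous_on UNIV (\<lambda>z. g z + h z)" by (intro continuous_intros cont)
    then show ?thesis
      by (simp add: R_cont cont yadd mat_vec_on_add fun_eq_iff distrib_right sum.distrib)
  qed
  have homogeneous: "?R (\<lambda>z. a * g z) = (\<lambda>z. a * ?R g z)" if g: "g \<in> hom_poly_space k" for a g
  proof -
    have cont: "continuous_on UNIV g" using g by (rule continuous_on_hom_poly_space)
    have "y (\<lambda>z. a * g z) \<nu> = a * y g \<nu>" for \<nu>
      unfolding y_def ball_inner_def mult.assoc by (rule set_integral_mult_right)
    then have yscale: "y (\<lambda>z. a * g z) = (\<lambda>\<nu>. a * y g \<nu>)" by (rule ext)
    have "continuous_on UNIV (\<lambda>z. a * g z)" by (intro continuous_intros cont)
    then show ?thesis
      by (simp add: R_cont cont yscale mat_vec_on_scale fun_eq_iff sum_distrib_left mult.assoc)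
  qed
  obtain cG where G: "cG > 0" "\<And>a. cG * norm_sq_on ?K a \<le> Re (quad_form_on ?K ball_gram a)"
    using pos_def_coercive[OF finite_multi_indices pos_def_ball_gram] by blast
  \<comment> \<open>If G is the Gram matrix and y = G a, then cG ||a||^2 \<le> <G a, a> \<le> ||y||
    ||a||. So cG ||a|| \<le> ||y||, and multiplying by ||y|| bounds cG <G a, a> by ||y||^2.\<close>
  have yg: "cG * Re (ball_inner g g) \<le> norm_sq_on ?K (y g)" if g: "g \<in> hom_poly_space k" for g
  proof -
    obtain a where ya: "y g = mat_vec_on ?K ball_gram a" and q: "ball_inner g g = quad_form_on ?K ball_gram a"
      using repr[OF g] by blast
    define A where "A = sqrt (norm_sq_on ?K a)"
    define Y where "Y = sqrt (norm_sq_on ?K (y g))"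
    have AY: "A \<ge> 0" "Y \<ge> 0" "A\<^sup>2 = norm_sq_on ?K a" "Y\<^sup>2 = norm_sq_on ?K (y g)"
      by (auto simp: A_def Y_def norm_sq_on_nonneg)
    have qle: "Re (ball_inner g g) \<le> Y * A"
      unfolding q quad_form_eq_inner ya[symmetric] Y_def A_def
      by (rule order_trans[OF complex_Re_le_cmod cmod_inner_on_le])
    have "cG * A * A \<le> Y * A"
      using G(2)[of a] qle unfolding q AY(3)[symmetric] by (simp add: power2_eq_square)
    then have "cG * A \<le> Y" using AY by (cases "A = 0") auto
    then have "cG * (Y * A) \<le> Y * Y" using mult_left_mono[of "cG * A" Y Y] AY by (simp add: mult_ac)
    moreover have "cG * Re (ball_inner g g) \<le> cG * (Y * A)" using qle G(1) by simp
    ultimately show ?thesis unfolding AY(4)[symmetric] power2_eq_square by linarith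
  qed
  show ?thesis
  proof
    assume "positive_operator_on (hom_poly_space k) ?R"
    then obtain c where c: "c > 0" "\<And>g. g \<in> hom_poly_space k \<Longrightarrow> c * Re (ball_inner g g) \<le> Re (ball_inner (?R g) g)"
      unfolding positive_operator_on_def by blast
    show "pos_def_on ?K E" unfolding pos_def_on_def
    proof (intro conjI allI impI herm)
      fix u :: "('n \<Rightarrow> nat) \<Rightarrow> complex" assume u: "\<exists>\<mu>\<in>?K. u \<mu> \<noteq> 0"
      obtain a where a: "\<forall>\<mu>\<in>?K. mat_vec_on ?K ball_gram a \<mu> = u \<mu>"
        using pos_def_solvable[OF finite_multi_indices pos_def_ball_gram, of k u] by blast
      define g where "g = (\<lambda>z. \<Sum>\<alpha>\<in>?K. a \<alpha> * mpow z \<alpha>)"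
      have g: "g \<in> hom_poly_space k" by (auto simp: hom_poly_space_def g_def)
      have "\<exists>\<mu>\<in>?K. a \<mu> \<noteq> 0"
      proof (rule ccontr)
        assume "\<not> ?thesis"
        then have "mat_vec_on ?K ball_gram a \<mu> = 0" for \<mu> by (simp add: mat_vec_on_def)
        then show False using a u by simp
      qed
      then have "0 < Re (quad_form_on ?K ball_gram a)" by (rule pos_def_onD[OF pos_def_ball_gram])
      then have "0 < Re (ball_inner g g)" unfolding g_def quad_form_ball_gram .
      then have "0 < c * Re (ball_inner g g)" using c(1) by simp
      also have "\<dots> \<le> Re (quad_form_on ?K E (y g))" using c(2)[OF g] quad[OF g] by simp
      also have "quad_form_on ?K E (y g) = quad_form_on ?K E u"
      proof -
        have "y g \<mu> = u \<mu>" if "\<mu> \<in> ?K" for \<mu>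
          using a that unfolding y_def g_def ball_inner_mpow by blast
        then show ?thesis
          unfolding quad_form_eq_inner by (intro inner_on_cong fun_cong[OF mat_vec_on_cong]) auto
      qed
      finally show "0 < Re (quad_form_on ?K E u)" .
    qed
  next
    assume E: "pos_def_on ?K E"
    obtain cE where lE: "cE > 0" "\<And>u. cE * norm_sq_on ?K u \<le> Re (quad_form_on ?K E u)"
      using pos_def_coercive[OF finite_multi_indices E] by blast
    have "cE * cG * Re (ball_inner g g) \<le> Re (ball_inner (?R g) g)" if g: "g \<in> hom_poly_space k" for g
    proof -
      have "cE * (cG * Re (ball_inner g g)) \<le> cE * norm_sq_on ?K (y g)"
        using yg[OF g] lE(1) by (intro mult_left_mono) auto
      also have "\<dots> \<le> Re (ball_inner (?R g) g)" unfolding quad[OF g] by (rule lE(2))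
      finally show ?thesis by (simp add: mult.assoc)
    qed
    moreover have "ball_inner (?R g) g \<in> \<real>" if "g \<in> hom_poly_space k" for g
      unfolding quad[OF that] by (rule real)
    moreover have "cE * cG > 0" using lE(1) G(1) by simp
    ultimately show "positive_operator_on (hom_poly_space k) ?R"
      unfolding positive_operator_on_def using RV additive homogeneous by blast
  qed
qed

section \<open>The equivalences\<close>

text \<open>Homogeneity of degree 2 m in real scalars carries the minimum \<epsilon> on the sphere
  to the bound \<epsilon> ||z||^(2 m). Conversely, compactness of the sphere turns pointwise
  positivity into an attained minimum.\<close>

lemma attains_positive_min_iff:
  fixes f :: "complex ^ 'n::finite \<Rightarrow> real"
  assumes f: "\<And>z. complex_of_real (f z) = bihom_poly m c z z"
  shows "attains_positive_min_on f (sphere 0 1) \<longleftrightarrow> (\<forall>z. z \<noteq> 0 \<longrightarrow> 0 < f z)"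
    and "attains_positive_min_on f (sphere 0 1) \<Longrightarrow> \<exists>\<epsilon>>0. \<forall>z. \<epsilon> * norm z ^ (2 * m) \<le> f z"
proof -
  have scale: "f (r *\<^sub>R z) = r ^ (2 * m) * f z" for r z
  proof -
    have "complex_of_real (f (r *\<^sub>R z)) = complex_of_real (r ^ (2 * m) * f z)"
      unfolding f bihom_poly_scaleR of_real_mult ..
    then show ?thesis by (simp only: of_real_eq_iff)
  qed
  show bound: "\<exists>\<epsilon>>0. \<forall>z. \<epsilon> * norm z ^ (2 * m) \<le> f z" if "attains_positive_min_on f (sphere 0 1)"
  proof -
    obtain z0 where z0: "z0 \<in> sphere 0 1" "0 < f z0" "\<forall>w\<in>sphere 0 1. f z0 \<le> f w"
      using \<open>attains_positive_min_on f (sphere 0 1)\<close> by (auto simp: attains_positive_min_on_def)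
    have "f z0 * norm z ^ (2 * m) \<le> f z" for z
    proof -
      obtain w where w: "w \<in> sphere 0 1" "z = norm z *\<^sub>R w"
      proof (cases "z = 0")
        case True
        then show ?thesis using that[of z0] z0(1) by simp
      next
        case False
        then show ?thesis using that[of "(1 / norm z) *\<^sub>R z"] by simp
      qed
      have "f z = norm z ^ (2 * m) * f w" using scale[of "norm z" w] w(2) by simp
      moreover have "f z0 * norm z ^ (2 * m) \<le> f w * norm z ^ (2 * m)"
        using z0(3) w(1) by (intro mult_right_mono) auto
      ultimately show ?thesis by (simp only: mult.commute)
    qed
    then show ?thesis using z0(2) by blast
  qed
  show "attains_positive_min_on f (sphere 0 1) \<longleftrightarrow> (\<forall>z. z \<noteq> 0 \<longrightarrow> 0 < f z)"
  proof
    assume "attains_positive_min_on f (sphere 0 1)"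
    then obtain \<epsilon> where \<epsilon>: "\<epsilon> > 0" "\<forall>z. \<epsilon> * norm z ^ (2 * m) \<le> f z" using bound by blast
    have "0 < f z" if "z \<noteq> 0" for z
    proof -
      have "0 < \<epsilon> * norm z ^ (2 * m)" using \<epsilon>(1) that by simp
      also have "\<dots> \<le> f z" using \<epsilon>(2) by blast
      finally show ?thesis .
    qed
    then show "\<forall>z. z \<noteq> 0 \<longrightarrow> 0 < f z" by blast
  next
    assume pos: "\<forall>z. z \<noteq> 0 \<longrightarrow> 0 < f z"
    have "f = (\<lambda>z. Re (bihom_poly m c z z))" using f by (metis Re_complex_of_real)
    then have "continuous_on (sphere 0 1) f" by (simp only:) (intro continuous_intros continuous_on_bihom_poly)
    \<comment> \<open>Types are nonempty, so n \<ge> 1 and the sphere contains a unit vector; an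
      attained minimum requires this.\<close>
    moreover have "axis (undefined::'n) (1::complex) \<in> sphere 0 1" by (simp add: norm_axis_1)
    then have "sphere 0 1 \<noteq> ({} :: (complex ^ 'n) set)" by blast
    ultimately obtain z0 where z0: "z0 \<in> sphere 0 1" "\<forall>w\<in>sphere 0 1. f z0 \<le> f w"
      using continuous_attains_inf[of "sphere 0 1" f] by auto
    moreover have "z0 \<noteq> 0" using z0(1) by auto
    ultimately show "attains_positive_min_on f (sphere 0 1)"
      using pos unfolding attains_positive_min_on_def by blast
  qed
qed

text \<open>The square root applied to the conjugated monomials is antiholomorphic with the right
  norm. Conjugating each component makes it a holomorphic polynomial of the same modulus.\<close>

lemma pos_semidef_sum_of_squares:
  fixes E :: "('n::finite \<Rightarrow> nat) \<Rightarrow> ('n \<Rightarrow> nat) \<Rightarrow> complex"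
  assumes E: "pos_semidef_on (multi_indices k) E"
  shows "\<exists>(r::nat) g. hom_poly_map k {..<r} g \<and> (\<forall>z. Re (bihom_poly k E z z) = norm_sq_on {..<r} (g z))"
proof -
  let ?K = "multi_indices k :: ('n \<Rightarrow> nat) set"
  define S where "S = psd_sqrt_on ?K E"
  \<comment> \<open>The components of \<open>g\<close> are indexed by {..<r}, so the multi-indices
    are enumerated by naturals.\<close>
  obtain h where h: "bij_betw h {..<card ?K} ?K"
    using ex_bij_betw_nat_finite[OF finite_multi_indices[of k]] by (auto simp: atLeast0LessThan)
  define g where "g = (\<lambda>z i. \<Sum>\<nu>\<in>?K. cnj (S (h i) \<nu>) * mpow z \<nu>)"
  have "hom_poly_map k {..<card ?K} g"
    unfolding hom_poly_map_def
  proof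
    fix i
    show "(\<lambda>z. g z i) \<in> hom_poly_space k"
      unfolding hom_poly_space_def g_def by (intro CollectI exI[of _ "\<lambda>\<nu>. cnj (S (h i) \<nu>)"] allI refl)
  qed
  moreover have "Re (bihom_poly k E z z) = norm_sq_on {..<card ?K} (g z)" for z
  proof -
    have "Re (bihom_poly k E z z) = norm_sq_on ?K (mat_vec_on ?K S (\<lambda>\<mu>. cnj (mpow z \<mu>)))"
      unfolding S_def norm_sq_psd_sqrt[OF finite_multi_indices E] quad_form_cnj_mpow ..
    also have "\<dots> = (\<Sum>\<mu>\<in>?K. (cmod (\<Sum>\<nu>\<in>?K. cnj (S \<mu> \<nu>) * mpow z \<nu>))\<^sup>2)"
    proof -
      have "cmod (mat_vec_on ?K S (\<lambda>\<mu>. cnj (mpow z \<mu>)) \<mu>) = cmod (\<Sum>\<nu>\<in>?K. cnj (S \<mu> \<nu>) * mpow z \<nu>)" for \<mu>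
        by (subst complex_mod_cnj[symmetric]) (simp add: mat_vec_on_def)
      then show ?thesis by (simp only: norm_sq_on_def)
    qed
    also have "\<dots> = norm_sq_on {..<card ?K} (g z)"
      unfolding norm_sq_on_def g_def by (rule sum.reindex_bij_betw[OF h, symmetric])
    finally show ?thesis .
  qed
  ultimately show ?thesis by blast
qed

text \<open>Coefficient vectors of \<open>H\<^sub>d \<otimes> P\<close>, where \<open>P\<^sub>i\<close> has the coefficients \<open>pa i\<close>.\<close>

definition tensor_coeff ::
  "nat \<Rightarrow> (nat \<Rightarrow> ('n::finite \<Rightarrow> nat) \<Rightarrow> complex) \<Rightarrow> ('n \<Rightarrow> nat) \<Rightarrow> ('n \<Rightarrow> nat) \<times> nat \<Rightarrow> complex" where
  "tensor_coeff d pa \<mu> = (\<lambda>(\<gamma>, i). complex_of_real (sqrt (fact d / real (mfact \<gamma>))) *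
     (if \<forall>j. \<gamma> j \<le> \<mu> j then pa i (\<lambda>j. \<mu> j - \<gamma> j) else 0))"

lemma sum_tensor_coeff:
  fixes x :: "('n::finite \<Rightarrow> nat) \<Rightarrow> complex"
  assumes "\<gamma> \<in> multi_indices d"
  shows "(\<Sum>\<mu>\<in>multi_indices (m + d). x \<mu> * tensor_coeff d pa \<mu> (\<gamma>, i))
    = complex_of_real (sqrt (fact d / real (mfact \<gamma>))) * (\<Sum>\<alpha>\<in>multi_indices m. pa i \<alpha> * x (madd \<gamma> \<alpha>))"
proof -
  have "(\<Sum>\<mu>\<in>multi_indices (m + d). x \<mu> * tensor_coeff d pa \<mu> (\<gamma>, i))
      = (\<Sum>\<mu>\<in>multi_indices (m + d). if \<forall>j. \<gamma> j \<le> \<mu> j then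
          complex_of_real (sqrt (fact d / real (mfact \<gamma>))) * (pa i (\<lambda>j. \<mu> j - \<gamma> j) * x \<mu>) else 0)"
    by (intro sum.cong refl) (auto simp: tensor_coeff_def mult_ac)
  also have "\<dots> = (\<Sum>\<alpha>\<in>multi_indices m. complex_of_real (sqrt (fact d / real (mfact \<gamma>))) * (pa i \<alpha> * x (madd \<gamma> \<alpha>)))"
    by (rule sum_shift_multi_indices[OF assms])
  finally show ?thesis by (simp only: sum_distrib_left)
qed

lemma tensor_H_map_expansion:
  assumes "\<And>z. P z i = (\<Sum>\<alpha>\<in>multi_indices m. pa i \<alpha> * mpow z \<alpha>)" and "\<gamma> \<in> multi_indices d"
  shows "tensor (H_map d z) (P z) (\<gamma>, i) = (\<Sum>\<mu>\<in>multi_indices (m + d). mpow z \<mu> * tensor_coeff d pa \<mu> (\<gamma>, i))"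
  unfolding sum_tensor_coeff[OF assms(2)]
  by (simp add: tensor_def H_map_def assms(1) mpow_madd sum_distrib_left mult_ac)

text \<open>The Gram matrix of the coefficient vectors of H_d \<otimes> P is, up to conjugation, the
  lifted coefficient matrix of ||P||^2: the square of the factor in H_d is the multinomial weight
  d!/\<gamma>!. It links positivity in 2) with the norm inequality behind 5).\<close>

lemma norm_sq_tensor_coeff:
  fixes x :: "('n::finite \<Rightarrow> nat) \<Rightarrow> complex"
  shows "complex_of_real (norm_sq_on (multi_indices d \<times> J) (\<lambda>i. \<Sum>\<mu>\<in>multi_indices (m + d). x \<mu> * tensor_coeff d pa \<mu> i))
    = quad_form_on (multi_indices (m + d)) (lift_coeff d (\<lambda>\<alpha> \<beta>. \<Sum>i\<in>J. pa i \<alpha> * cnj (pa i \<beta>))) (\<lambda>\<mu>. cnj (x \<mu>))"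
proof -
  let ?A = "multi_indices m :: ('n \<Rightarrow> nat) set" and ?D = "multi_indices d :: ('n \<Rightarrow> nat) set"
  have "complex_of_real (norm_sq_on (?D \<times> J) (\<lambda>i. \<Sum>\<mu>\<in>multi_indices (m + d). x \<mu> * tensor_coeff d pa \<mu> i))
      = (\<Sum>\<gamma>\<in>?D. \<Sum>i\<in>J. complex_of_real ((cmod (\<Sum>\<mu>\<in>multi_indices (m + d). x \<mu> * tensor_coeff d pa \<mu> (\<gamma>, i)))\<^sup>2))"
    unfolding norm_sq_on_def of_real_sum sum.cartesian_product by (simp add: case_prod_beta)
  also have "\<dots> = (\<Sum>\<gamma>\<in>?D. \<Sum>i\<in>J. fact d / of_nat (mfact \<gamma>) *
      ((\<Sum>\<alpha>\<in>?A. pa i \<alpha> * x (madd \<gamma> \<alpha>)) * cnj (\<Sum>\<beta>\<in>?A. pa i \<beta> * x (madd \<gamma> \<beta>))))"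
  proof (rule sum.cong[OF refl], rule sum.cong[OF refl])
    fix \<gamma> i assume \<gamma>: "\<gamma> \<in> ?D"
    define s where "s = (\<Sum>\<alpha>\<in>?A. pa i \<alpha> * x (madd \<gamma> \<alpha>))"
    have "(cmod (\<Sum>\<mu>\<in>multi_indices (m + d). x \<mu> * tensor_coeff d pa \<mu> (\<gamma>, i)))\<^sup>2
        = fact d / real (mfact \<gamma>) * (cmod s)\<^sup>2"
      unfolding sum_tensor_coeff[OF \<gamma>] s_def[symmetric] by (simp add: norm_mult power_mult_distrib)
    then have "complex_of_real ((cmod (\<Sum>\<mu>\<in>multi_indices (m + d). x \<mu> * tensor_coeff d pa \<mu> (\<gamma>, i)))\<^sup>2)
        = complex_of_real (fact d / real (mfact \<gamma>)) * complex_of_real ((cmod s)\<^sup>2)"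
      by (simp only: of_real_mult)
    then show "complex_of_real ((cmod (\<Sum>\<mu>\<in>multi_indices (m + d). x \<mu> * tensor_coeff d pa \<mu> (\<gamma>, i)))\<^sup>2)
        = fact d / of_nat (mfact \<gamma>) * ((\<Sum>\<alpha>\<in>?A. pa i \<alpha> * x (madd \<gamma> \<alpha>)) * cnj (\<Sum>\<beta>\<in>?A. pa i \<beta> * x (madd \<gamma> \<beta>)))"
      unfolding s_def[symmetric] complex_norm_square[of s] by simp
  qed
  also have "\<dots> = (\<Sum>\<gamma>\<in>?D. fact d / of_nat (mfact \<gamma>) *
      (\<Sum>\<alpha>\<in>?A. \<Sum>\<beta>\<in>?A. (\<Sum>i\<in>J. pa i \<alpha> * cnj (pa i \<beta>)) * (cnj (x (madd \<gamma> \<beta>)) * cnj (cnj (x (madd \<gamma> \<alpha>))))))"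
  proof (rule sum.cong[OF refl])
    fix \<gamma> :: "'n \<Rightarrow> nat"
    have "(\<Sum>i\<in>J. (\<Sum>\<alpha>\<in>?A. pa i \<alpha> * x (madd \<gamma> \<alpha>)) * cnj (\<Sum>\<beta>\<in>?A. pa i \<beta> * x (madd \<gamma> \<beta>)))
        = (\<Sum>i\<in>J. \<Sum>\<alpha>\<in>?A. \<Sum>\<beta>\<in>?A. pa i \<alpha> * cnj (pa i \<beta>) * (cnj (x (madd \<gamma> \<beta>)) * x (madd \<gamma> \<alpha>)))"
      unfolding cnj_sum sum_product by (simp add: mult_ac)
    also have "\<dots> = (\<Sum>\<alpha>\<in>?A. \<Sum>i\<in>J. \<Sum>\<beta>\<in>?A. pa i \<alpha> * cnj (pa i \<beta>) * (cnj (x (madd \<gamma> \<beta>)) * x (madd \<gamma> \<alpha>)))"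
      by (rule sum.swap)
    also have "\<dots> = (\<Sum>\<alpha>\<in>?A. \<Sum>\<beta>\<in>?A. \<Sum>i\<in>J. pa i \<alpha> * cnj (pa i \<beta>) * (cnj (x (madd \<gamma> \<beta>)) * x (madd \<gamma> \<alpha>)))"
      by (rule sum.cong[OF refl], rule sum.swap)
    finally show "(\<Sum>i\<in>J. fact d / of_nat (mfact \<gamma>) *
        ((\<Sum>\<alpha>\<in>?A. pa i \<alpha> * x (madd \<gamma> \<alpha>)) * cnj (\<Sum>\<beta>\<in>?A. pa i \<beta> * x (madd \<gamma> \<beta>))))
      = fact d / of_nat (mfact \<gamma>) *
      (\<Sum>\<alpha>\<in>?A. \<Sum>\<beta>\<in>?A. (\<Sum>i\<in>J. pa i \<alpha> * cnj (pa i \<beta>)) * (cnj (x (madd \<gamma> \<beta>)) * cnj (cnj (x (madd \<gamma> \<alpha>)))))"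
      by (simp only: sum_distrib_left[symmetric] sum_distrib_right[symmetric] complex_cnj_cnj)
  qed
  finally show ?thesis unfolding quad_form_lift_coeff .
qed

lemma lift_coeff_diff: "lift_coeff d (\<lambda>\<alpha> \<beta>. c \<alpha> \<beta> - c' \<alpha> \<beta>) \<mu> \<nu> = lift_coeff d c \<mu> \<nu> - lift_coeff d c' \<mu> \<nu>"
  unfolding lift_coeff_def sum_subtractf[symmetric]
  by (intro sum.cong refl) (auto simp: right_diff_distrib diff_divide_distrib)

lemma bihom_poly_sum_of_squares:
  assumes "\<And>i z. i \<in> J \<Longrightarrow> P z i = (\<Sum>\<alpha>\<in>multi_indices m. pa i \<alpha> * mpow z \<alpha>)"
  shows "bihom_poly m (\<lambda>\<alpha> \<beta>. \<Sum>i\<in>J. pa i \<alpha> * cnj (pa i \<beta>)) z z = complex_of_real (norm_sq_on J (P z))"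
proof -
  let ?A = "multi_indices m"
  have "complex_of_real (norm_sq_on J (P z)) = (\<Sum>i\<in>J. P z i * cnj (P z i))"
    by (simp add: norm_sq_on_def complex_norm_square del: of_real_power)
  also have "\<dots> = (\<Sum>i\<in>J. \<Sum>\<alpha>\<in>?A. \<Sum>\<beta>\<in>?A. pa i \<alpha> * cnj (pa i \<beta>) * mpow z \<alpha> * cnj (mpow z \<beta>))"
    by (intro sum.cong refl) (simp add: assms sum_product mult_ac)
  also have "\<dots> = (\<Sum>\<alpha>\<in>?A. \<Sum>i\<in>J. \<Sum>\<beta>\<in>?A. pa i \<alpha> * cnj (pa i \<beta>) * mpow z \<alpha> * cnj (mpow z \<beta>))"
    by (rule sum.swap)
  also have "\<dots> = (\<Sum>\<alpha>\<in>?A. \<Sum>\<beta>\<in>?A. \<Sum>i\<in>J. pa i \<alpha> * cnj (pa i \<beta>) * mpow z \<alpha> * cnj (mpow z \<beta>))"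
    by (rule sum.cong[OF refl], rule sum.swap)
  finally show ?thesis by (simp only: bihom_poly_def sum_distrib_right)
qed

lemma hom_poly_map_coeffs:
  assumes "hom_poly_map m J P"
  obtains pa where "\<And>i z. i \<in> J \<Longrightarrow> P z i = (\<Sum>\<alpha>\<in>multi_indices m. pa i \<alpha> * mpow z \<alpha>)"
proof -
  have "\<forall>i. \<exists>a. i \<in> J \<longrightarrow> (\<forall>z. P z i = (\<Sum>\<alpha>\<in>multi_indices m. a \<alpha> * mpow z \<alpha>))"
    using assms by (auto simp: hom_poly_map_def hom_poly_space_def)
  from choice[OF this] obtain pa where "\<forall>i. i \<in> J \<longrightarrow> (\<forall>z. P z i = (\<Sum>\<alpha>\<in>multi_indices m. pa i \<alpha> * mpow z \<alpha>))" ..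
  then show thesis using that by blast
qed

theorem theorem1:
  fixes m p q :: nat
    and c :: "('n::finite \<Rightarrow> nat) \<Rightarrow> ('n \<Rightarrow> nat) \<Rightarrow> complex"
    and f :: "complex ^ 'n \<Rightarrow> real"
    and P N :: "complex ^ 'n \<Rightarrow> nat \<Rightarrow> complex"
  assumes f: "\<And>z. complex_of_real (f z) = bihom_poly m c z z"
    and P: "hom_poly_map m {..<p} P"
    and N: "hom_poly_map m {..<q} N"
    and f_eq: "\<And>z. f z = norm_sq_on {..<p} (P z) - norm_sq_on {..<q} (N z)"
  shows
    "(attains_positive_min_on f (sphere 0 1)
      \<longleftrightarrow> (\<exists>(d::nat) E. (\<forall>z. complex_of_real (norm z ^ (2 * d) * f z) = bihom_poly (m + d) E z z)
             \<and> pos_def_on (multi_indices (m + d)) E))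
   \<and> (attains_positive_min_on f (sphere 0 1)
      \<longleftrightarrow> (\<exists>d::nat. positive_operator_on (hom_poly_space (m + d))
             (kernel_operator (\<lambda>z \<zeta>. herm_inner z \<zeta> ^ d * bihom_poly m c z \<zeta>))))
   \<and> (attains_positive_min_on f (sphere 0 1)
      \<longleftrightarrow> (\<exists>(d::nat) (r::nat) g. hom_poly_map (m + d) {..<r} g
             \<and> common_zeros {..<r} g = {0}
             \<and> (\<forall>z. norm z ^ (2 * d) * f z = norm_sq_on {..<r} (g z))))
   \<and> (attains_positive_min_on f (sphere 0 1)
      \<longleftrightarrow> (\<exists>(d::nat) L.
             let I = multi_indices d \<times> {..<p};
                 J = multi_indices d \<times> {..<q};
                 A = (\<lambda>i k. mat_id i k - mat_mul_on J (mat_adj L) L i k)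
             in pos_semidef_on I A
              \<and> (\<forall>z. \<forall>j\<in>J. tensor (H_map d z) (N z) j
                             = mat_vec_on I L (tensor (H_map d z) (P z)) j)
              \<and> common_zeros I (\<lambda>z. mat_vec_on I (psd_sqrt_on I A) (tensor (H_map d z) (P z))) = {0}))"
proof -
  obtain pa where pa: "\<And>i z. i \<in> {..<p} \<Longrightarrow> P z i = (\<Sum>\<alpha>\<in>multi_indices m. pa i \<alpha> * mpow z \<alpha>)"
    by (rule hom_poly_map_coeffs[OF P]) blast
  obtain na where na: "\<And>i z. i \<in> {..<q} \<Longrightarrow> N z i = (\<Sum>\<alpha>\<in>multi_indices m. na i \<alpha> * mpow z \<alpha>)"
    by (rule hom_poly_map_coeffs[OF N]) blast
  define cP where "cP = (\<lambda>\<alpha> \<beta>. \<Sum>i<p. pa i \<alpha> * cnj (pa i \<beta>))"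
  define cN where "cN = (\<lambda>\<alpha> \<beta>. \<Sum>i<q. na i \<alpha> * cnj (na i \<beta>))"
  \<comment> \<open>The coefficient matrix of ||P||^2 - ||N||^2, Hermitian by its form and split as
    needed for 5).\<close>
  define c' where "c' = (\<lambda>\<alpha> \<beta>. cP \<alpha> \<beta> - cN \<alpha> \<beta>)"
  have bihom_diff: "bihom_poly m (\<lambda>\<alpha> \<beta>. b \<alpha> \<beta> - b' \<alpha> \<beta>) z \<zeta> = bihom_poly m b z \<zeta> - bihom_poly m b' z \<zeta>"
    for b b' and z \<zeta> :: "complex ^ 'n"
    by (simp add: bihom_poly_def left_diff_distrib sum_subtractf)
  have f': "complex_of_real (f z) = bihom_poly m c' z z" for z
  proof -
    have "bihom_poly m c' z z = bihom_poly m cP z z - bihom_poly m cN z z"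
      unfolding c'_def by (rule bihom_diff)
    also have "bihom_poly m cP z z = complex_of_real (norm_sq_on {..<p} (P z))"
      unfolding cP_def by (rule bihom_poly_sum_of_squares[OF pa])
    also have "bihom_poly m cN z z = complex_of_real (norm_sq_on {..<q} (N z))"
      unfolding cN_def by (rule bihom_poly_sum_of_squares[OF na])
    finally show ?thesis by (simp add: f_eq)
  qed
  have c'_herm: "hermitian_on (multi_indices m) c'"
    by (simp add: hermitian_on_def c'_def cP_def cN_def mult.commute)
  \<comment> \<open>Equality on the diagonal is not enough here: the kernel in 3) takes independent
    arguments z and \<zeta>.\<close>
  have c_c': "bihom_poly m c z \<zeta> = bihom_poly m c' z \<zeta>" for z \<zeta>
  proof -
    have "bihom_poly m (\<lambda>\<alpha> \<beta>. c \<alpha> \<beta> - c' \<alpha> \<beta>) z \<zeta> = 0"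
      by (rule bihom_poly_eq_0_polarize) (simp only: bihom_diff f[symmetric] f'[symmetric] diff_self)
    then show ?thesis unfolding bihom_diff by simp
  qed
  have lift: "bihom_poly (m + d) (lift_coeff d c') z z = complex_of_real (norm z ^ (2 * d) * f z)" for d z
    unfolding bihom_poly_lift_coeff f'[symmetric] herm_inner_self by (simp add: power_mult)
  have kernel: "(\<lambda>z \<zeta>. herm_inner z \<zeta> ^ d * bihom_poly m c z \<zeta>) = bihom_poly (m + d) (lift_coeff d c')" for d
    by (intro ext) (simp only: bihom_poly_lift_coeff c_c')
  note positive_iff = attains_positive_min_iff(1)[OF f]
  \<comment> \<open>The factor ||z||^(2 d) is positive off the origin and cancels, so each converse
    only has to show positivity of the product, for whatever d it provides.\<close>
  have positiveI: "attains_positive_min_on f (sphere 0 1)" if "\<And>z. z \<noteq> 0 \<Longrightarrow> 0 < norm z ^ (2 * d) * f z" for d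
    unfolding positive_iff
  proof (intro allI impI)
    fix z :: "complex ^ 'n" assume z: "z \<noteq> 0"
    have "0 < norm z ^ (2 * d)" using z by simp
    then show "0 < f z" using that[OF z] zero_less_mult_pos by blast
  qed
  have quillen: "\<exists>d\<ge>1. pos_def_on (multi_indices (m + d)) (lift_coeff d c')"
    if pos: "attains_positive_min_on f (sphere 0 1)"
  proof -
    obtain \<epsilon> where \<epsilon>: "\<epsilon> > 0" "\<forall>z. \<epsilon> * norm z ^ (2 * m) \<le> f z"
      using attains_positive_min_iff(2)[OF f pos] by blast
    have "Re (bihom_poly m c' z z) = f z" for z using f'[of z] by (metis Re_complex_of_real)
    then have "\<epsilon> * norm z ^ (2 * m) \<le> Re (bihom_poly m c' z z)" for z using \<epsilon>(2) by simp
    from quillen_pos_def[OF c'_herm this \<epsilon>(1)] show ?thesis .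
  qed
  \<comment> \<open>With d \<ge> 1 the product vanishes at the origin even when m = 0 and f is
    constant.\<close>
  have tensor_zero: "norm z ^ (2 * d) * f z = 0 \<longleftrightarrow> z = 0"
    if "attains_positive_min_on f (sphere 0 1)" "d \<ge> 1" for z d
  proof (cases "z = 0")
    case False
    then have "0 < f z" using that(1) unfolding positive_iff by blast
    then show ?thesis using False by simp
  qed (use that(2) in simp)
  have pos_def_imp: "attains_positive_min_on f (sphere 0 1)"
    if E: "pos_def_on (multi_indices (m + d)) E"
      and eq: "\<And>z. complex_of_real (norm z ^ (2 * d) * f z) = bihom_poly (m + d) E z z" for d E
  proof (rule positiveI)
    fix z :: "complex ^ 'n" assume "z \<noteq> 0"
    from pos_def_bihom_poly_pos[OF E this] show "0 < norm z ^ (2 * d) * f z"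
      unfolding eq[symmetric] by (simp only: Re_complex_of_real)
  qed

  have two: "attains_positive_min_on f (sphere 0 1)
      \<longleftrightarrow> (\<exists>(d::nat) E. (\<forall>z. complex_of_real (norm z ^ (2 * d) * f z) = bihom_poly (m + d) E z z)
             \<and> pos_def_on (multi_indices (m + d)) E)"
    using quillen lift[symmetric] pos_def_imp by metis

  have three: "attains_positive_min_on f (sphere 0 1)
      \<longleftrightarrow> (\<exists>d::nat. positive_operator_on (hom_poly_space (m + d))
             (kernel_operator (\<lambda>z \<zeta>. herm_inner z \<zeta> ^ d * bihom_poly m c z \<zeta>)))"
    unfolding kernel positive_operator_iff_pos_def[OF hermitian_lift_coeff[OF c'_herm]]
    using quillen lift[symmetric] pos_def_imp by blast

  have four: "attains_positive_min_on f (sphere 0 1)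
      \<longleftrightarrow> (\<exists>(d::nat) (r::nat) g. hom_poly_map (m + d) {..<r} g
             \<and> common_zeros {..<r} g = {0}
             \<and> (\<forall>z. norm z ^ (2 * d) * f z = norm_sq_on {..<r} (g z)))"
  proof
    assume pos: "attains_positive_min_on f (sphere 0 1)"
    from quillen[OF this] obtain d where d: "d \<ge> 1" "pos_def_on (multi_indices (m + d)) (lift_coeff d c')" by blast
    from pos_semidef_sum_of_squares[OF pos_def_imp_pos_semidef[OF d(2)]] obtain r g
      where g: "hom_poly_map (m + d) {..<r::nat} g"
        "\<forall>z. Re (bihom_poly (m + d) (lift_coeff d c') z z) = norm_sq_on {..<r} (g z)" by blast
    have eq: "norm z ^ (2 * d) * f z = norm_sq_on {..<r} (g z)" for z
      using g(2)[rule_format, of z] unfolding lift by (simp only: Re_complex_of_real)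
    have "z \<in> common_zeros {..<r} g \<longleftrightarrow> z = 0" for z
    proof -
      have "z \<in> common_zeros {..<r} g \<longleftrightarrow> norm_sq_on {..<r} (g z) = 0"
        by (simp add: common_zeros_def norm_sq_on_eq_0_iff)
      then show ?thesis unfolding eq[symmetric] tensor_zero[OF pos d(1)] .
    qed
    then have "common_zeros {..<r} g = {0}" by blast
    then show "\<exists>(d::nat) (r::nat) g. hom_poly_map (m + d) {..<r} g
             \<and> common_zeros {..<r} g = {0}
             \<and> (\<forall>z. norm z ^ (2 * d) * f z = norm_sq_on {..<r} (g z))"
      using g(1) eq by blast
  next
    assume "\<exists>(d::nat) (r::nat) g. hom_poly_map (m + d) {..<r} g
             \<and> common_zeros {..<r} g = {0}
             \<and> (\<forall>z. norm z ^ (2 * d) * f z = norm_sq_on {..<r} (g z))"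
    then obtain d r g where g: "common_zeros {..<r::nat} g = {0}"
      "\<And>z. norm z ^ (2 * d) * f z = norm_sq_on {..<r} (g z)" by blast
    show "attains_positive_min_on f (sphere 0 1)"
    proof (rule positiveI)
      fix z :: "complex ^ 'n" assume "z \<noteq> 0"
      then have "norm_sq_on {..<r} (g z) \<noteq> 0"
        using g(1) by (auto simp: common_zeros_def norm_sq_on_eq_0_iff)
      then show "0 < norm z ^ (2 * d) * f z"
        unfolding g(2) using norm_sq_on_nonneg[of "{..<r}" "g z"] by linarith
    qed
  qed

  \<comment> \<open>The squared norm is ||H_d \<otimes> P||^2 - ||L (H_d \<otimes> P)||^2, and (5.2)
    turns the subtracted term into ||H_d \<otimes> N||^2. Thus (5.3) says that ||z||^(2 d) f
    vanishes only at the origin.\<close>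
  have sqrt_norm: "norm_sq_on (multi_indices d \<times> {..<p}) (mat_vec_on (multi_indices d \<times> {..<p})
        (psd_sqrt_on (multi_indices d \<times> {..<p})
          (\<lambda>i k. mat_id i k - mat_mul_on (multi_indices d \<times> {..<q}) (mat_adj L) L i k))
        (tensor (H_map d z) (P z))) = norm z ^ (2 * d) * f z"
    if psd: "pos_semidef_on (multi_indices d \<times> {..<p})
        (\<lambda>i k. mat_id i k - mat_mul_on (multi_indices d \<times> {..<q}) (mat_adj L) L i k)"
      and L: "\<And>z j. j \<in> multi_indices d \<times> {..<q} \<Longrightarrow>
        tensor (H_map d z) (N z) j = mat_vec_on (multi_indices d \<times> {..<p}) L (tensor (H_map d z) (P z)) j"
    for d L z
  proof -
    let ?I = "multi_indices d \<times> {..<p} :: (('n \<Rightarrow> nat) \<times> nat) set"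
    let ?J = "multi_indices d \<times> {..<q} :: (('n \<Rightarrow> nat) \<times> nat) set"
    have I: "finite ?I" by simp
    have "norm_sq_on ?J (mat_vec_on ?I L (tensor (H_map d z) (P z))) = norm_sq_on ?J (tensor (H_map d z) (N z))"
      unfolding norm_sq_on_def by (intro sum.cong refl) (simp only: L)
    then show ?thesis
      unfolding norm_sq_psd_sqrt[OF I psd] quad_form_id_minus_adj[OF I]
      by (simp add: norm_sq_tensor norm_sq_H_map f_eq right_diff_distrib)
  qed

  have zeros: "common_zeros (multi_indices d \<times> {..<p}) (\<lambda>z. g z) = {z. norm_sq_on (multi_indices d \<times> {..<p}) (g z) = 0}"
    for d and g :: "complex ^ 'n \<Rightarrow> ('n \<Rightarrow> nat) \<times> nat \<Rightarrow> complex"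
    unfolding common_zeros_def by (subst norm_sq_on_eq_0_iff) auto

  have five: "attains_positive_min_on f (sphere 0 1)
      \<longleftrightarrow> (\<exists>(d::nat) L.
             let I = multi_indices d \<times> {..<p};
                 J = multi_indices d \<times> {..<q};
                 A = (\<lambda>i k. mat_id i k - mat_mul_on J (mat_adj L) L i k)
             in pos_semidef_on I A
              \<and> (\<forall>z. \<forall>j\<in>J. tensor (H_map d z) (N z) j
                             = mat_vec_on I L (tensor (H_map d z) (P z)) j)
              \<and> common_zeros I (\<lambda>z. mat_vec_on I (psd_sqrt_on I A) (tensor (H_map d z) (P z))) = {0})"
    (is "_ \<longleftrightarrow> ?five")
  proof
    assume pos: "attains_positive_min_on f (sphere 0 1)"
    from quillen[OF this] obtain d where d: "d \<ge> 1" "pos_def_on (multi_indices (m + d)) (lift_coeff d c')" by blast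
    let ?K = "multi_indices (m + d) :: ('n \<Rightarrow> nat) set"
    let ?I = "multi_indices d \<times> {..<p} :: (('n \<Rightarrow> nat) \<times> nat) set"
    let ?J = "multi_indices d \<times> {..<q} :: (('n \<Rightarrow> nat) \<times> nat) set"
    have I: "finite ?I" by simp
    \<comment> \<open>The difference of the two squared norms is the form of the lifted matrix at
      the conjugate of \<open>x\<close>, which is positive by the choice of d.\<close>
    have less: "norm_sq_on ?J (\<lambda>j. \<Sum>\<mu>\<in>?K. x \<mu> * tensor_coeff d na \<mu> j) < norm_sq_on ?I (\<lambda>i. \<Sum>\<mu>\<in>?K. x \<mu> * tensor_coeff d pa \<mu> i)"
      if x: "\<exists>\<mu>\<in>?K. x \<mu> \<noteq> 0" for x
    proof -
      have "\<exists>\<mu>\<in>?K. cnj (x \<mu>) \<noteq> 0" using x by simp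
      from pos_def_onD[OF d(2) this] have "0 < Re (quad_form_on ?K (lift_coeff d c') (\<lambda>\<mu>. cnj (x \<mu>)))" .
      also have "quad_form_on ?K (lift_coeff d c') (\<lambda>\<mu>. cnj (x \<mu>))
          = quad_form_on ?K (lift_coeff d cP) (\<lambda>\<mu>. cnj (x \<mu>)) - quad_form_on ?K (lift_coeff d cN) (\<lambda>\<mu>. cnj (x \<mu>))"
        unfolding c'_def quad_form_on_def mat_vec_on_def lift_coeff_diff left_diff_distrib sum_subtractf ..
      also have "quad_form_on ?K (lift_coeff d cP) (\<lambda>\<mu>. cnj (x \<mu>))
          = complex_of_real (norm_sq_on ?I (\<lambda>i. \<Sum>\<mu>\<in>?K. x \<mu> * tensor_coeff d pa \<mu> i))"
        unfolding cP_def by (rule norm_sq_tensor_coeff[symmetric])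
      also have "quad_form_on ?K (lift_coeff d cN) (\<lambda>\<mu>. cnj (x \<mu>))
          = complex_of_real (norm_sq_on ?J (\<lambda>i. \<Sum>\<mu>\<in>?K. x \<mu> * tensor_coeff d na \<mu> i))"
        unfolding cN_def by (rule norm_sq_tensor_coeff[symmetric])
      finally show ?thesis by simp
    qed
    from contraction_exists[OF I finite_multi_indices less] obtain L where
      contr: "\<forall>u. norm_sq_on ?J (mat_vec_on ?I L u) \<le> norm_sq_on ?I u"
      and La: "\<forall>\<mu>\<in>?K. \<forall>j\<in>?J. mat_vec_on ?I L (tensor_coeff d pa \<mu>) j = tensor_coeff d na \<mu> j" by blast
    let ?A = "\<lambda>i k. mat_id i k - mat_mul_on ?J (mat_adj L) L i k"
    have psd: "pos_semidef_on ?I ?A" using contr pos_semidef_id_minus_adj_iff[OF I] by blast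
    have L: "tensor (H_map d z) (N z) j = mat_vec_on ?I L (tensor (H_map d z) (P z)) j" if j: "j \<in> ?J" for z j
    proof -
      have "tensor (H_map d z) (P z) i = (\<Sum>\<mu>\<in>?K. mpow z \<mu> * tensor_coeff d pa \<mu> i)" if "i \<in> ?I" for i
      proof -
        obtain \<gamma> l where i: "i = (\<gamma>, l)" "\<gamma> \<in> multi_indices d" "l \<in> {..<p}" using \<open>i \<in> ?I\<close> by auto
        show ?thesis unfolding i(1) by (rule tensor_H_map_expansion[where P = P and pa = pa, OF pa[OF i(3)] i(2)])
      qed
      then have "mat_vec_on ?I L (tensor (H_map d z) (P z)) j
          = mat_vec_on ?I L (\<lambda>i. \<Sum>\<mu>\<in>?K. mpow z \<mu> * tensor_coeff d pa \<mu> i) j"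
        by (intro fun_cong[OF mat_vec_on_cong])
      also have "\<dots> = (\<Sum>\<mu>\<in>?K. mpow z \<mu> * tensor_coeff d na \<mu> j)"
      proof -
        have "mat_vec_on ?I L (tensor_coeff d pa \<mu>) j = tensor_coeff d na \<mu> j" if "\<mu> \<in> ?K" for \<mu>
          using La j that by blast
        then show ?thesis
          unfolding mat_vec_on_sum mat_vec_on_scale by (intro sum.cong refl) (simp only:)
      qed
      also have "\<dots> = tensor (H_map d z) (N z) j"
      proof -
        obtain \<gamma> l where j': "j = (\<gamma>, l)" "\<gamma> \<in> multi_indices d" "l \<in> {..<q}" using j by auto
        show ?thesis unfolding j'(1) by (rule tensor_H_map_expansion[where P = N and pa = na, OF na[OF j'(3)] j'(2), symmetric])
      qed
      finally show ?thesis by simp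
    qed
    have "norm_sq_on ?I (mat_vec_on ?I (psd_sqrt_on ?I ?A) (tensor (H_map d z) (P z))) = 0 \<longleftrightarrow> z = 0" for z
    proof -
      have "norm_sq_on ?I (mat_vec_on ?I (psd_sqrt_on ?I ?A) (tensor (H_map d z) (P z))) = norm z ^ (2 * d) * f z"
        by (rule sqrt_norm[OF psd]) (rule L)
      then show ?thesis using tensor_zero[OF pos d(1)] by simp
    qed
    then have "common_zeros ?I (\<lambda>z. mat_vec_on ?I (psd_sqrt_on ?I ?A) (tensor (H_map d z) (P z))) = {0}"
      unfolding zeros by simp
    then show ?five unfolding Let_def using psd L by blast
  next
    assume ?five
    then obtain d L where
      psd: "pos_semidef_on (multi_indices d \<times> {..<p})
        (\<lambda>i k. mat_id i k - mat_mul_on (multi_indices d \<times> {..<q}) (mat_adj L) L i k)"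
      and L: "\<And>z j. j \<in> multi_indices d \<times> {..<q} \<Longrightarrow>
        tensor (H_map d z) (N z) j = mat_vec_on (multi_indices d \<times> {..<p}) L (tensor (H_map d z) (P z)) j"
      and Z: "common_zeros (multi_indices d \<times> {..<p}) (\<lambda>z. mat_vec_on (multi_indices d \<times> {..<p})
        (psd_sqrt_on (multi_indices d \<times> {..<p})
          (\<lambda>i k. mat_id i k - mat_mul_on (multi_indices d \<times> {..<q}) (mat_adj L) L i k))
        (tensor (H_map d z) (P z))) = {0}"
      unfolding Let_def by blast
    show "attains_positive_min_on f (sphere 0 1)"
    proof (rule positiveI)
      fix z :: "complex ^ 'n" assume "z \<noteq> 0"
      let ?s = "norm_sq_on (multi_indices d \<times> {..<p}) (mat_vec_on (multi_indices d \<times> {..<p})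
        (psd_sqrt_on (multi_indices d \<times> {..<p})
          (\<lambda>i k. mat_id i k - mat_mul_on (multi_indices d \<times> {..<q}) (mat_adj L) L i k))
        (tensor (H_map d z) (P z)))"
      have "?s \<noteq> 0" using Z \<open>z \<noteq> 0\<close> unfolding zeros by blast
      moreover have "?s = norm z ^ (2 * d) * f z" by (rule sqrt_norm[OF psd]) (rule L)
      moreover have "0 \<le> ?s" by (rule norm_sq_on_nonneg)
      ultimately show "0 < norm z ^ (2 * d) * f z" by linarith
    qed
  qed

  show ?thesis using two three four five by (intro conjI)
qed

end
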